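(* Let $\pi$ be a nontrivial irreducible orthogonal or unitary representation of $\mathsf{SO}(n)$ or $\mathsf{Spin}(n)$ with highest weight $\lambda$. Let $\rho$ be the half-sum of positive roots of $\mathfrak{so}(n,\mathbb C)$ and let $r=\frac{\langle\lambda,\lambda+2\rho\rangle}{\|\lambda\|^2}$. Then, for every curvature operator $R\colon\wedge^2\mathbb R^n\to\wedge^2\mathbb R^n$, $$K(R,\pi)\succeq\|\lambda\|^2\,\Sigma(r,R)\operatorname{Id}.$$
   Context: $R$ is the curvature operator of a Riemannian $n$-manifold at a point, in an orthonormal frame, i.e. a self-adjoint operator on $\wedge^2\mathbb R^n\cong\mathfrak{so}(n)$ satisfying the first Bianchi identity, with eigenvalues $\nu_1\le\dots\le\nu_{\binom n2}$. For real $0<r\le\binom n2$, $\Sigma(r,R)=\nu_1+\dots+\nu_{\lfloor r\rfloor}+(r-\lfloor r\rfloor)\nu_{\lfloor r\rfloor+1}$. $\mathfrak{so}(n,\mathbb C)\cong\wedge^2\mathbb C^n$ carries the inner product $\langle X,Y\rangle=\frac12\operatorname{Re}\operatorname{tr}XY^*$. For a representation $\pi$ on $E$, $$K(R,\pi)=-\sum_a \mathrm d\pi(R(X_a))\circ \mathrm d\pi(X_a)\in\operatorname{End}(E),$$ where $\{X_a\}$ is an orthonormal basis of $\mathfrak{so}(n)$. $A\succeq B$ means $A-B$ is positive semidefinite. Weights carry the induced inner product: with $m=\lfloor n/2\rfloor$, the Cartan subalgebra of block-diagonal elements with $2\times2$ blocks $\begin{pmatrix}0&\theta_j\\-\theta_j&0\end{pmatrix}$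 (and a zero if $n$ is odd), weights are written (up to the usual factor $\sqrt{-1}$) as real combinations of the functionals $\varepsilon_j\colon(\theta_1,\dots,\theta_m)\mapsto\theta_j$, which are orthonormal; positive roots are $\varepsilon_i\pm\varepsilon_j$, $i<j$, and additionally $\varepsilon_i$ if $n$ is odd, so $\rho=\sum_{i=1}^m(\frac n2-i)\varepsilon_i$. The highest weight of $\pi\colon\mathsf G\to\operatorname{Aut}(E)$ means: that of $E$ if $E$ is complex; that of $E_{\mathbb C}$ if $E$ is real and $E_{\mathbb C}$ is irreducible; and that of $V$ if $E$ is real and $E_{\mathbb C}\cong V\oplus V^*$ with $V$ irreducible (the quantities $\|\lambda\|^2$ and $\langle\lambda,\lambda+2\rho\rangle$ are the same for $V$ and $V^*$). *)

theory Defs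
  imports "HOL-Analysis.Analysis" "HOL-Algebra.Group"
begin

text \<open>
  Throughout, \<open>n = CARD('n)\<close>. The linear order on the index type lists the standard orthonormal
  frame of \<open>R^n\<close>; it is used for the Clifford product and for the Cartan subalgebra.
  \<open>\<wedge>^2 R^n\<close> is identified with \<open>so(n)\<close> by sending \<open>x \<and> y\<close> to \<open>wedge x y\<close>.
\<close>

definition so_alg :: "(real^'n^'n) set" where
  "so_alg = {X. transpose X = - X}"

definition so_inner :: "real^'n^'n \<Rightarrow> real^'n^'n \<Rightarrow> real" where
  "so_inner X Y = trace (X ** transpose Y) / 2"

definition wedge :: "real^'n \<Rightarrow> real^'n \<Rightarrow> real^'n^'n" where
  "wedge x y = (\<chi> i j. x $ i * y $ j - x $ j * y $ i)"

definition orthonormal_basis_so :: "(real^'n^'n) set \<Rightarrow> bool" where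
  "orthonormal_basis_so B \<longleftrightarrow>
     B \<subseteq> so_alg \<and>
     (\<forall>X\<in>B. \<forall>Y\<in>B. so_inner X Y = (if X = Y then 1 else 0)) \<and>
     span B = so_alg"

text \<open>Only the restriction of \<open>R\<close> to \<open>so_alg\<close> is meaningful.\<close>

definition curvature_operator :: "(real^'n^'n \<Rightarrow> real^'n^'n) \<Rightarrow> bool" where
  "curvature_operator R \<longleftrightarrow>
     (\<forall>X\<in>so_alg. R X \<in> so_alg) \<and>
     (\<forall>X\<in>so_alg. \<forall>Y\<in>so_alg. R (X + Y) = R X + R Y) \<and>
     (\<forall>c. \<forall>X\<in>so_alg. R (c *\<^sub>R X) = c *\<^sub>R R X) \<and>
     (\<forall>X\<in>so_alg. \<forall>Y\<in>so_alg. so_inner (R X) Y = so_inner X (R Y)) \<and>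
     (\<forall>x y z w. so_inner (R (wedge x y)) (wedge z w)
              + so_inner (R (wedge y z)) (wedge x w)
              + so_inner (R (wedge z x)) (wedge y w) = 0)"

definition curv_eigenspace :: "(real^'n^'n \<Rightarrow> real^'n^'n) \<Rightarrow> real \<Rightarrow> (real^'n^'n) set" where
  "curv_eigenspace R c = {X \<in> so_alg. R X = c *\<^sub>R X}"

text \<open>The eigenvalues in nondecreasing order, repeated according to multiplicity.\<close>

definition curv_eigenvalues :: "(real^'n^'n \<Rightarrow> real^'n^'n) \<Rightarrow> real list" where
  "curv_eigenvalues R =
     concat (map (\<lambda>c. replicate (dim (curv_eigenspace R c)) c)
       (sorted_list_of_set {c. curv_eigenspace R c \<noteq> {0}}))"

text \<open>
  List positions start at 0, so \<open>\<nu>\<^sub>k\<close> is entry \<open>k - 1\<close>. For \<open>r = n choose 2\<close> the entry in the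
  last summand does not exist, but its coefficient is 0.
\<close>

definition eig_sum :: "real \<Rightarrow> (real^'n^'n \<Rightarrow> real^'n^'n) \<Rightarrow> real" where
  "eig_sum r R =
     (\<Sum>k<nat \<lfloor>r\<rfloor>. curv_eigenvalues R ! k)
     + (r - of_int \<lfloor>r\<rfloor>) * curv_eigenvalues R ! nat \<lfloor>r\<rfloor>"

definition SO_grp :: "(real^'n^'n) monoid" where
  "SO_grp = \<lparr>carrier = {A. orthogonal_matrix A \<and> det A = 1}, mult = (**), one = mat 1\<rparr>"

definition O_grp :: "(real^'k^'k) monoid" where
  "O_grp = \<lparr>carrier = {A. orthogonal_matrix A}, mult = (**), one = mat 1\<rparr>"

definition adjoint_mat :: "complex^'k^'k \<Rightarrow> complex^'k^'k" where
  "adjoint_mat A = (\<chi> i j. cnj (A $ j $ i))"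

definition U_grp :: "(complex^'k^'k) monoid" where
  "U_grp = \<lparr>carrier = {A. adjoint_mat A ** A = mat 1 \<and> A ** adjoint_mat A = mat 1},
            mult = (**), one = mat 1\<rparr>"

text \<open>
  The real Clifford algebra with \<open>e\<^sub>i * e\<^sub>i = -1\<close>. Coordinate \<open>A\<close> belongs to the product \<open>e_A\<close> of
  the \<open>e\<^sub>i\<close>, \<open>i \<in> A\<close>, in increasing order. Then \<open>e_A * e_B = (-1)^s e_{sym_diff A B}\<close> where
  \<open>s\<close> is the number of \<open>(a, b) \<in> A \<times> B\<close> with \<open>b \<le> a\<close>: the pairs \<open>b < a\<close> count
  transpositions, the pairs \<open>b = a\<close> count squares.
\<close>

definition cl_mult ::
  "real^(('n::{finite,linorder}) set) \<Rightarrow> real^('n set) \<Rightarrow> real^('n set)" where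
  "cl_mult x y = (\<chi> C. \<Sum>A\<in>UNIV.
     (- 1) ^ card {(a, b). a \<in> A \<and> b \<in> sym_diff A C \<and> b \<le> a} * x $ A * y $ sym_diff A C)"

definition cl_one :: "real^(('n::{finite,linorder}) set)" where
  "cl_one = axis {} 1"

definition cl_vec :: "real^('n::{finite,linorder}) \<Rightarrow> real^('n set)" where
  "cl_vec v = (\<Sum>i\<in>UNIV. v $ i *\<^sub>R axis {i} 1)"

inductive_set spin_set :: "(real^(('n::{finite,linorder}) set)) set" where
  one: "cl_one \<in> spin_set"
| step: "norm v = 1 \<Longrightarrow> norm w = 1 \<Longrightarrow> x \<in> spin_set \<Longrightarrow>
    cl_mult (cl_vec v) (cl_mult (cl_vec w) x) \<in> spin_set"

definition Spin_grp :: "(real^(('n::{finite,linorder}) set)) monoid" where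
  "Spin_grp = \<lparr>carrier = spin_set, mult = cl_mult, one = cl_one\<rparr>"

text \<open>
  The inverse of the differential of the covering \<open>Spin(n) \<rightarrow> SO(n)\<close>, \<open>g \<mapsto> (v \<mapsto> g v g^{-1})\<close>:
  \<open>spin_of_so X\<close> is the element \<open>\<xi>\<close> of the span of the \<open>e\<^sub>i e\<^sub>j\<close>, \<open>i \<noteq> j\<close>, with
  \<open>\<xi> v - v \<xi> = X v\<close> for every vector \<open>v\<close> (see \<open>spin_of_so_commutator\<close>).
\<close>

definition spin_of_so :: "real^('n::{finite,linorder})^('n::{finite,linorder}) \<Rightarrow> real^('n set)" where
  "spin_of_so X = (1 / 4) *\<^sub>R
     (\<Sum>i\<in>UNIV. \<Sum>j\<in>UNIV. X $ j $ i *\<^sub>R cl_mult (cl_vec (axis i 1)) (cl_vec (axis j 1)))"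

lemma bilinear_cl_mult: "bilinear cl_mult"
  unfolding bilinear_def
  by (auto intro!: linearI simp: cl_mult_def vec_eq_iff algebra_simps sum.distrib sum_distrib_left)

lemma cl_mult_axis:
  fixes A B :: "'n::{finite,linorder} set"
  shows "cl_mult (axis A 1) (axis B 1) =
    (- 1) ^ card {(a, b). a \<in> A \<and> b \<in> B \<and> b \<le> a} *\<^sub>R axis (sym_diff A B) 1"
proof -
  have sd: "sym_diff A C = B \<longleftrightarrow> C = sym_diff A B" for C by blast
  have sd': "sym_diff A (sym_diff A B) = B" by blast
  have *: "cl_mult (axis A 1) (axis B 1) $ C =
    (\<Sum>A'\<in>UNIV. if A' = A then
      (- 1) ^ card {(a, b). a \<in> A \<and> b \<in> sym_diff A C \<and> b \<le> a} * (axis B 1 :: real^'n set) $ sym_diff A C else 0)" for C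
    unfolding cl_mult_def vec_lambda_beta
    by (rule sum.cong) (auto simp: axis_def)
  show ?thesis
    unfolding vec_eq_iff
  proof
    fix C
    show "cl_mult (axis A 1) (axis B 1) $ C =
      ((- 1) ^ card {(a, b). a \<in> A \<and> b \<in> B \<and> b \<le> a} *\<^sub>R axis (sym_diff A B) 1) $ C"
    proof (cases "C = sym_diff A B")
      case True
      show ?thesis unfolding * True sd' by (simp add: axis_def)
    next
      case False
      then have "sym_diff A C \<noteq> B" using sd by blast
      with False show ?thesis unfolding * by (simp only: axis_def vec_lambda_beta vector_scaleR_component sum.delta) simp
    qed
  qed
qed

lemma cl_sign_sym_diff:
  fixes A B C :: "'n::{finite,linorder} set"
  defines "s \<equiv> \<lambda>A B :: 'n set. (- 1 :: real) ^ card {(a, b). a \<in> A \<and> b \<in> B \<and> b \<le> a}"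
  shows "s (sym_diff A B) C = s A C * s B C" "s C (sym_diff A B) = s C A * s C B"
proof -
  have *: "(- 1 :: real) ^ card (sym_diff S T) = (- 1) ^ card S * (- 1) ^ card T"
    for S T :: "('n \<times> 'n) set"
  proof -
    have "card S = card (S - T) + card (S \<inter> T)" "card T = card (T - S) + card (S \<inter> T)"
      by (metis card_Int_Diff finite add.commute Int_commute)+
    moreover have "card (sym_diff S T) = card (S - T) + card (T - S)"
      by (rule card_Un_disjoint) auto
    ultimately show ?thesis by (simp add: minus_one_power_iff)
  qed
  have "{(a, b). a \<in> sym_diff A B \<and> b \<in> C \<and> b \<le> a} =
    sym_diff {(a, b). a \<in> A \<and> b \<in> C \<and> b \<le> a} {(a, b). a \<in> B \<and> b \<in> C \<and> b \<le> a}" by auto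
  then show "s (sym_diff A B) C = s A C * s B C" unfolding s_def by (simp only: *)
  have "{(a, b). a \<in> C \<and> b \<in> sym_diff A B \<and> b \<le> a} =
    sym_diff {(a, b). a \<in> C \<and> b \<in> A \<and> b \<le> a} {(a, b). a \<in> C \<and> b \<in> B \<and> b \<le> a}" by auto
  then show "s C (sym_diff A B) = s C A * s C B" unfolding s_def by (simp only: *)
qed

lemma cl_sign_single:
  "(- 1 :: real) ^ card {(a, b). a \<in> {i} \<and> b \<in> {j} \<and> b \<le> a} =
    (if j \<le> (i::'n::{finite,linorder}) then - 1 else 1)"
proof -
  have "{(a, b). a \<in> {i} \<and> b \<in> {j} \<and> b \<le> a} = (if j \<le> i then {(i, j)} else {})" by auto
  then show ?thesis by simp
qed

lemma cl_commutator_basis: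
  fixes i j k :: "'n::{finite,linorder}"
  shows "cl_mult (cl_mult (axis {i} 1) (axis {j} 1)) (axis {k} 1)
       - cl_mult (axis {k} 1) (cl_mult (axis {i} 1) (axis {j} 1))
     = (if i = k then 2 *\<^sub>R axis {j} 1 else 0) - (if j = k then 2 *\<^sub>R axis {i} 1 else 0)"
proof -
  have sd: "sym_diff {k} (sym_diff {i} {j}) = sym_diff (sym_diff {i} {j}) {k}" by blast
  have sd1: "i \<noteq> j \<Longrightarrow> {i, j} - {i} = {j}" "i \<noteq> j \<Longrightarrow> {i, j} - {j} = {i}" for i j :: 'n by auto
  show ?thesis
    unfolding cl_mult_axis bilinear_lmul[OF bilinear_cl_mult] bilinear_rmul[OF bilinear_cl_mult]
      cl_sign_sym_diff cl_sign_single sd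
    by (cases "i = k"; cases "j = k") (auto simp: sd1 scaleR_2)
qed

lemma cl_vec_axis: "cl_vec (axis i 1) = axis {i} 1"
proof -
  have "cl_vec (axis i 1) = (\<Sum>j\<in>UNIV. if j = i then axis {i} 1 else 0)"
    unfolding cl_vec_def by (rule sum.cong) (auto simp: axis_def)
  then show ?thesis by simp
qed

lemma spin_of_so_commutator:
  fixes X :: "real^('n::{finite,linorder})^('n::{finite,linorder})"
  assumes "X \<in> so_alg"
  shows "cl_mult (spin_of_so X) (cl_vec v) - cl_mult (cl_vec v) (spin_of_so X) = cl_vec (X *v v)"
proof -
  note b = bilinear_cl_mult
  have sk: "X $ j $ i = - X $ i $ j" for i j
  proof -
    have "transpose X = - X" using assms by (simp only: so_alg_def mem_Collect_eq)
    then have "transpose X $ i $ j = (- X) $ i $ j" by (rule arg_cong)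
    then show ?thesis by (simp add: transpose_def)
  qed
  let ?e = "\<lambda>i. axis {i} (1::real)"
  define L where "L x y = cl_mult x y - cl_mult y x" for x y :: "real^'n set"
  have lin: "linear (\<lambda>x. L x y)" "linear (L y)" for y
    using b unfolding bilinear_def L_def[abs_def] by (auto intro: linear_compose_sub)
  have l1: "L (sum f S) y = (\<Sum>i\<in>S. L (f i) y)" "L y (sum f S) = (\<Sum>i\<in>S. L y (f i))"
    for f :: "'n \<Rightarrow> _" and S y
    using linear_sum[OF lin(1)] linear_sum[OF lin(2)] by auto
  have l2: "L (c *\<^sub>R x) y = c *\<^sub>R L x y" "L x (c *\<^sub>R y) = c *\<^sub>R L x y" for c x y
    using linear_scale[OF lin(1)] linear_scale[OF lin(2)] by auto
  have "L (spin_of_so X) (cl_vec v) =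
     (1/4) *\<^sub>R (\<Sum>k\<in>UNIV. v $ k *\<^sub>R (\<Sum>i\<in>UNIV. \<Sum>j\<in>UNIV. X $ j $ i *\<^sub>R
       L (cl_mult (?e i) (?e j)) (?e k)))"
    unfolding spin_of_so_def cl_vec_axis unfolding cl_vec_def
    by (simp only: l1 l2 scaleR_sum_right scaleR_scaleR mult.commute mult.left_commute mult.assoc)
  also have "\<dots> = (1/4) *\<^sub>R (\<Sum>k\<in>UNIV. v $ k *\<^sub>R
      ((\<Sum>j\<in>UNIV. (2 * X $ j $ k) *\<^sub>R ?e j) - (\<Sum>i\<in>UNIV. (2 * X $ k $ i) *\<^sub>R ?e i)))"
  proof -
    have 1: "(\<Sum>i\<in>UNIV. \<Sum>j\<in>UNIV. X $ j $ i *\<^sub>R (if i = k then 2 *\<^sub>R ?e j else 0)) =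
       (\<Sum>j\<in>UNIV. (2 * X $ j $ k) *\<^sub>R ?e j)" for k
    proof -
      have "(\<Sum>i\<in>UNIV. \<Sum>j\<in>UNIV. X $ j $ i *\<^sub>R (if i = k then 2 *\<^sub>R ?e j else 0)) =
        (\<Sum>i\<in>UNIV. if i = k then (\<Sum>j\<in>UNIV. (2 * X $ j $ k) *\<^sub>R ?e j) else 0)"
        by (intro sum.cong refl) (simp add: mult.commute)
      then show ?thesis by (simp only: sum.delta[OF finite] UNIV_I if_True)
    qed
    have 2: "(\<Sum>i\<in>UNIV. \<Sum>j\<in>UNIV. X $ j $ i *\<^sub>R (if j = k then 2 *\<^sub>R ?e i else 0)) =
       (\<Sum>j\<in>UNIV. (2 * X $ k $ j) *\<^sub>R ?e j)" for k
    proof -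
      have "(\<Sum>j\<in>UNIV. X $ j $ i *\<^sub>R (if j = k then 2 *\<^sub>R ?e i else 0)) =
        (\<Sum>j\<in>UNIV. if j = k then (2 * X $ k $ i) *\<^sub>R ?e i else 0)" for i
        by (intro sum.cong refl) (simp add: mult.commute)
      then show ?thesis by (simp only: sum.delta[OF finite] UNIV_I if_True)
    qed
    show ?thesis
      by (simp only: L_def cl_commutator_basis scaleR_diff_right sum_subtractf 1 2)
  qed
  also have "\<dots> = (1/4) *\<^sub>R (\<Sum>k\<in>UNIV. v $ k *\<^sub>R (\<Sum>j\<in>UNIV. (4 * X $ j $ k) *\<^sub>R ?e j))"
  proof -
    have "(2 * X $ j $ k) *\<^sub>R ?e j - (2 * X $ k $ j) *\<^sub>R ?e j = (4 * X $ j $ k) *\<^sub>R ?e j" for j k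
      unfolding scaleR_diff_left[symmetric] sk[of j k] by simp
    then show ?thesis by (simp only: sum_subtractf[symmetric])
  qed
  also have "\<dots> = (\<Sum>j\<in>UNIV. \<Sum>k\<in>UNIV. (X $ j $ k * v $ k) *\<^sub>R ?e j)"
    by (subst sum.swap) (simp add: scaleR_sum_right mult.commute)
  also have "\<dots> = cl_vec (X *v v)"
    by (simp add: cl_vec_def matrix_vector_mult_def scaleR_sum_left)
  finally show ?thesis unfolding L_def .
qed

text \<open>
  Both groups sit inside a real algebra on which \<open>mult\<close> and \<open>one\<close> are defined everywhere, so the
  exponential series makes sense there.
\<close>

definition exp_in :: "('g::real_normed_vector) monoid \<Rightarrow> 'g \<Rightarrow> 'g" where
  "exp_in G x = (\<Sum>k. (x [^]\<^bsub>G\<^esub> (k::nat)) /\<^sub>R fact k)"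

text \<open>
  The differential of \<open>\<pi>\<close> as a map on \<open>so(n)\<close>, where \<open>\<iota>\<close> maps \<open>so(n)\<close> onto the Lie algebra of \<open>G\<close>
  (the identity for \<open>SO(n)\<close>, \<open>spin_of_so\<close> for \<open>Spin(n)\<close>).
\<close>

definition drep ::
  "('g::real_normed_vector) monoid \<Rightarrow> (real^'n^'n \<Rightarrow> 'g) \<Rightarrow>
   ('g \<Rightarrow> ('f::real_normed_field)^'k^'k) \<Rightarrow> real^'n^'n \<Rightarrow> 'f^'k^'k" where
  "drep G \<iota> \<pi> X = vector_derivative (\<lambda>t. \<pi> (exp_in G (t *\<^sub>R \<iota> X))) (at 0)"

text \<open>
  Representation spaces are \<open>R^k\<close> and \<open>C^k\<close> with their standard inner products; every nonzero
  finite-dimensional real or complex inner product space is isometric to one of these.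
\<close>

definition orthogonal_rep :: "('g::real_normed_vector) monoid \<Rightarrow> ('g \<Rightarrow> real^'k^'k) \<Rightarrow> bool" where
  "orthogonal_rep G \<pi> \<longleftrightarrow> \<pi> \<in> hom G O_grp \<and> continuous_on (carrier G) \<pi>"

definition unitary_rep :: "('g::real_normed_vector) monoid \<Rightarrow> ('g \<Rightarrow> complex^'k^'k) \<Rightarrow> bool" where
  "unitary_rep G \<pi> \<longleftrightarrow> \<pi> \<in> hom G U_grp \<and> continuous_on (carrier G) \<pi>"

definition nontrivial_rep :: "'g monoid \<Rightarrow> ('g \<Rightarrow> ('f::field)^'k^'k) \<Rightarrow> bool" where
  "nontrivial_rep G \<pi> \<longleftrightarrow> (\<exists>g\<in>carrier G. \<pi> g \<noteq> mat 1)"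

definition invariant_subspace ::
  "'g monoid \<Rightarrow> ('g \<Rightarrow> ('f::field)^'k^'k) \<Rightarrow> ('f^'k) set \<Rightarrow> bool" where
  "invariant_subspace G \<pi> V \<longleftrightarrow> vec.subspace V \<and> (\<forall>g\<in>carrier G. \<forall>v\<in>V. \<pi> g *v v \<in> V)"

definition irreducible_on ::
  "'g monoid \<Rightarrow> ('g \<Rightarrow> ('f::field)^'k^'k) \<Rightarrow> ('f^'k) set \<Rightarrow> bool" where
  "irreducible_on G \<pi> V \<longleftrightarrow>
     invariant_subspace G \<pi> V \<and> V \<noteq> {0} \<and>
     (\<forall>W. invariant_subspace G \<pi> W \<and> W \<subseteq> V \<longrightarrow> W = {0} \<or> W = V)"

text \<open>
  A weight \<open>\<Sum>\<^sub>j \<mu>\<^sub>j \<epsilon>\<^sub>j\<close> is represented by its coefficient function \<open>\<mu>\<close>, of which only the values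
  on \<open>{1..n div 2}\<close> matter.
\<close>

definition wt_inner :: "nat \<Rightarrow> (nat \<Rightarrow> real) \<Rightarrow> (nat \<Rightarrow> real) \<Rightarrow> real" where
  "wt_inner n \<mu> \<mu>' = (\<Sum>j=1..n div 2. \<mu> j * \<mu>' j)"

definition eps :: "nat \<Rightarrow> nat \<Rightarrow> real" where
  "eps i = (\<lambda>j. if j = i then 1 else 0)"

definition positive_roots :: "nat \<Rightarrow> (nat \<Rightarrow> real) set" where
  "positive_roots n =
     {(\<lambda>k. eps i k + eps j k) | i j. 1 \<le> i \<and> i < j \<and> j \<le> n div 2} \<union>
     {(\<lambda>k. eps i k - eps j k) | i j. 1 \<le> i \<and> i < j \<and> j \<le> n div 2} \<union>
     {eps i | i. odd n \<and> 1 \<le> i \<and> i \<le> n div 2}"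

definition rho :: "nat \<Rightarrow> nat \<Rightarrow> real" where
  "rho n = (\<lambda>k. (\<Sum>\<alpha>\<in>positive_roots n. \<alpha> k) / 2)"

lemma rho_eq:
  assumes "1 \<le> k" "k \<le> n div 2"
  shows "rho n k = real n / 2 - real k"
proof -
  define m where "m = n div 2"
  define P where "P = {(i, j). 1 \<le> i \<and> i < j \<and> j \<le> m}"
  define f where "f = (\<lambda>(i, j) k. eps i k + eps j k)"
  define g where "g = (\<lambda>(i, j) k. eps i k - eps j k)"
  define Q where "Q = {i. odd n \<and> 1 \<le> i \<and> i \<le> m}"
  have finP: "finite P" by (rule finite_subset[of _ "{1..m} \<times> {1..m}"]) (auto simp: P_def)
  have finQ: "finite Q" by (simp add: Q_def)
  have roots: "positive_roots n = f ` P \<union> g ` P \<union> eps ` Q"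
    by (fastforce simp: positive_roots_def P_def Q_def f_def g_def m_def image_iff)
  have val: "eps i l = (if l = i then 1 else 0)" for i l by (simp add: eps_def)
  have injf: "inj_on f P"
  proof (rule inj_onI)
    fix p q assume pq: "p \<in> P" "q \<in> P" and eq: "f p = f q"
    obtain i j i' j' where p: "p = (i, j)" and q: "q = (i', j')" by (cases p, cases q)
    have lt: "i < j" "i' < j'" using pq by (auto simp: P_def p q)
    have "{l. f p l \<noteq> 0} = {i, j}" "{l. f q l \<noteq> 0} = {i', j'}"
      using lt by (auto simp: f_def p q val)
    then have "{i, j} = {i', j'}" by (simp add: eq)
    then show "p = q" using lt unfolding p q doubleton_eq_iff by auto
  qed
  have injg: "inj_on g P"
  proof (rule inj_onI)
    fix p q assume pq: "p \<in> P" "q \<in> P" and eq: "g p = g q"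
    obtain i j i' j' where p: "p = (i, j)" and q: "q = (i', j')" by (cases p, cases q)
    have lt: "i < j" "i' < j'" using pq by (auto simp: P_def p q)
    have "{l. g p l > 0} = {i}" "{l. g q l > 0} = {i'}" "{l. g p l < 0} = {j}" "{l. g q l < 0} = {j'}"
      using lt by (auto simp: g_def p q val split: if_splits)
    then have "{i} = {i'}" "{j} = {j'}" by (simp_all add: eq)
    then show "p = q" by (simp add: p q)
  qed
  have inje: "inj_on eps Q"
    by (rule inj_onI) (metis val zero_neq_one)
  have d1: "f ` P \<inter> g ` P = {}"
  proof -
    have "f p \<noteq> g q" if pq: "p \<in> P" "q \<in> P" for p q
    proof -
      obtain i j i' j' where [simp]: "p = (i, j)" "q = (i', j')" by (cases p, cases q)
      have "f p j' \<ge> 0" "g q j' < 0" using pq by (auto simp: P_def f_def g_def val)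
      then show ?thesis by auto
    qed
    then show ?thesis by blast
  qed
  have d2: "(f ` P \<union> g ` P) \<inter> eps ` Q = {}"
  proof -
    have "f p \<noteq> eps l" "g p \<noteq> eps l" if "p \<in> P" for p l
    proof -
      obtain i j where [simp]: "p = (i, j)" by (cases p)
      have ij: "i < j" using that by (simp add: P_def)
      have "f p i = 1" "f p j = 1" using ij by (auto simp: f_def val)
      then show "f p \<noteq> eps l" using ij by (auto simp: val split: if_splits)
      have "g p j < 0" using ij by (auto simp: g_def val)
      then show "g p \<noteq> eps l" by (auto simp: val split: if_splits)
    qed
    then show ?thesis by blast
  qed
  have "(\<Sum>\<alpha>\<in>positive_roots n. \<alpha> k) = (\<Sum>p\<in>P. f p k) + (\<Sum>p\<in>P. g p k) + (\<Sum>i\<in>Q. eps i k)"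
    unfolding roots using finP finQ d1 d2 injf injg inje
    by (simp add: sum.union_disjoint sum.reindex)
  also have "(\<Sum>p\<in>P. f p k) + (\<Sum>p\<in>P. g p k) = (\<Sum>p\<in>P. if p \<in> {k} \<times> {k<..m} then 2 else 0)"
    unfolding sum.distrib[symmetric]
    by (rule sum.cong) (auto simp: f_def g_def val P_def split: if_splits)
  also have "\<dots> = 2 * real (m - k)"
  proof -
    have "P \<inter> {k} \<times> {k<..m} = {k} \<times> {k<..m}" using assms by (auto simp: P_def)
    then show ?thesis using finP by (simp add: sum.If_cases card_cartesian_product)
  qed
  also have "(\<Sum>i\<in>Q. eps i k) = (if odd n then 1 else 0)"
    using assms finQ by (simp add: val Q_def m_def)
  finally have "rho n k = (2 * real (m - k) + (if odd n then 1 else 0)) / 2"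
    by (simp add: rho_def)
  moreover have "real n = 2 * real m + (if odd n then 1 else 0)"
    by (cases "odd n") (auto simp: m_def elim!: oddE evenE)
  ultimately show ?thesis using assms
    by (cases "odd n") (simp_all add: m_def[symmetric] of_nat_diff field_simps)
qed

definition casimir_ratio :: "nat \<Rightarrow> (nat \<Rightarrow> real) \<Rightarrow> real" where
  "casimir_ratio n \<mu> = wt_inner n \<mu> (\<lambda>k. \<mu> k + 2 * rho n k) / wt_inner n \<mu> \<mu>"

text \<open>\<open>idx_pos\<close> is the 0-based position; block \<open>j\<close> occupies positions \<open>2 * j - 2\<close> and \<open>2 * j - 1\<close>.\<close>

definition idx_pos :: "'n::{finite,linorder} \<Rightarrow> nat" where
  "idx_pos i = card {k. k < i}"

definition cartan :: "(nat \<Rightarrow> real) \<Rightarrow> real^('n::{finite,linorder})^('n::{finite,linorder})" where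
  "cartan \<theta> = (\<chi> i j.
     if even (idx_pos i) \<and> idx_pos j = idx_pos i + 1 then \<theta> (idx_pos i div 2 + 1)
     else if even (idx_pos j) \<and> idx_pos i = idx_pos j + 1 then - \<theta> (idx_pos j div 2 + 1)
     else 0)"

definition weight_space ::
  "(real^('n::{finite,linorder})^('n::{finite,linorder}) \<Rightarrow> complex^'k^'k) \<Rightarrow> (complex^'k) set \<Rightarrow>
   (nat \<Rightarrow> real) \<Rightarrow> (complex^'k) set" where
  "weight_space D V \<mu> =
     {v \<in> V. \<forall>\<theta>. D (cartan \<theta>) *v v = (\<i> * complex_of_real (wt_inner CARD('n) \<mu> \<theta>)) *s v}"

text \<open>
  Highest with respect to the order in which \<open>\<mu> \<le> lam\<close> iff \<open>lam - \<mu>\<close> is a sum of positive roots.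
\<close>

definition highest_weight_on ::
  "('g::real_normed_vector) monoid \<Rightarrow> (real^('n::{finite,linorder})^('n::{finite,linorder}) \<Rightarrow> 'g) \<Rightarrow>
   ('g \<Rightarrow> complex^'k^'k) \<Rightarrow> (complex^'k) set \<Rightarrow> (nat \<Rightarrow> real) \<Rightarrow> bool" where
  "highest_weight_on G \<iota> \<pi> V lam \<longleftrightarrow>
     weight_space (drep G \<iota> \<pi>) V lam \<noteq> {0} \<and>
     (\<forall>\<mu>. weight_space (drep G \<iota> \<pi>) V \<mu> \<noteq> {0} \<longrightarrow>
       (\<exists>c :: (nat \<Rightarrow> real) \<Rightarrow> nat. \<forall>j\<in>{1..CARD('n) div 2}.
          lam j - \<mu> j = (\<Sum>\<alpha>\<in>positive_roots CARD('n). of_nat (c \<alpha>) * \<alpha> j)))"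

definition complexified_rep :: "('g \<Rightarrow> real^'k^'k) \<Rightarrow> 'g \<Rightarrow> complex^'k^'k" where
  "complexified_rep \<pi> g = map_matrix complex_of_real (\<pi> g)"

text \<open>
  The subrepresentation on \<open>W\<close> is isomorphic to the dual of the one on \<open>V\<close>: the map
  \<open>w \<mapsto> \<Phi> w\<close>, restricted to functionals on \<open>V\<close>, is an equivariant isomorphism from \<open>W\<close> to the dual
  of \<open>V\<close>. Here \<open>\<Phi>\<close> is given on the ambient spaces, which costs no generality.
\<close>

definition dual_subreps ::
  "'g monoid \<Rightarrow> ('g \<Rightarrow> complex^'k^'k) \<Rightarrow> (complex^'k) set \<Rightarrow> (complex^'k) set \<Rightarrow> bool" where
  "dual_subreps G \<pi> V W \<longleftrightarrow>
     (\<exists>\<Phi> :: complex^'k \<Rightarrow> complex^'k \<Rightarrow> complex.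
        (\<forall>w. Vector_Spaces.linear (*s) (*) (\<Phi> w)) \<and>
        (\<forall>v. Vector_Spaces.linear (*s) (*) (\<lambda>w. \<Phi> w v)) \<and>
        (\<forall>g\<in>carrier G. \<forall>w\<in>W. \<forall>v\<in>V. \<Phi> (\<pi> g *v w) (\<pi> g *v v) = \<Phi> w v) \<and>
        (\<forall>w\<in>W. (\<forall>v\<in>V. \<Phi> w v = 0) \<longrightarrow> w = 0) \<and>
        (\<forall>f. Vector_Spaces.linear (*s) (*) f \<longrightarrow> (\<exists>w\<in>W. \<forall>v\<in>V. \<Phi> w v = f v)))"

definition real_highest_weight ::
  "('g::real_normed_vector) monoid \<Rightarrow> (real^('n::{finite,linorder})^('n::{finite,linorder}) \<Rightarrow> 'g) \<Rightarrow>
   ('g \<Rightarrow> real^'k^'k) \<Rightarrow> (nat \<Rightarrow> real) \<Rightarrow> bool" where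
  "real_highest_weight G \<iota> \<pi> lam \<longleftrightarrow>
     (irreducible_on G (complexified_rep \<pi>) UNIV \<and>
      highest_weight_on G \<iota> (complexified_rep \<pi>) UNIV lam) \<or>
     (\<exists>V W. irreducible_on G (complexified_rep \<pi>) V \<and>
        invariant_subspace G (complexified_rep \<pi>) W \<and>
        V \<inter> W = {0} \<and> {v + w | v w. v \<in> V \<and> w \<in> W} = UNIV \<and>
        dual_subreps G (complexified_rep \<pi>) V W \<and>
        highest_weight_on G \<iota> (complexified_rep \<pi>) V lam)"

definition curvature_term ::
  "(real^'n^'n) set \<Rightarrow> (real^'n^'n \<Rightarrow> real^'n^'n) \<Rightarrow>
   (real^'n^'n \<Rightarrow> ('f::real_normed_field)^'k^'k) \<Rightarrow> 'f^'k^'k" where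
  "curvature_term B R D = - (\<Sum>X\<in>B. D (R X) ** D X)"

definition psd_real :: "real^'k^'k \<Rightarrow> bool" where
  "psd_real A \<longleftrightarrow> transpose A = A \<and> (\<forall>v. 0 \<le> v \<bullet> (A *v v))"

definition psd_complex :: "complex^'k^'k \<Rightarrow> bool" where
  "psd_complex A \<longleftrightarrow> adjoint_mat A = A \<and>
     (\<forall>v. 0 \<le> Re (\<Sum>i\<in>UNIV. cnj (v $ i) * (A *v v) $ i))"

end

theory Submission
  imports Defs
begin

text \<open>
  In an orthonormal eigenbasis \<open>X\<^sub>k\<close> of \<open>R\<close> the curvature term is \<open>\<Sum> \<nu>\<^sub>k d\<pi>(X\<^sub>k)\<^sup>* d\<pi>(X\<^sub>k)\<close>, so that
  for a unit vector \<open>v\<close> its quadratic form is \<open>\<Sum> \<nu>\<^sub>k w\<^sub>k\<close> with \<open>w\<^sub>k = |d\<pi>(X\<^sub>k)v|\<^sup>2\<close>. The numbers \<open>w\<^sub>k\<close>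
  add up to the Casimir eigenvalue \<open>\<langle>\<lambda>, \<lambda> + 2\<rho>\<rangle>\<close>, and each is at most \<open>|\<lambda>|\<^sup>2\<close>: a unit vector of
  \<open>so(n)\<close> is conjugate to a dominant element \<open>\<theta>\<close> of the Cartan subalgebra, and every weight \<open>\<mu>\<close> satisfies
  \<open>\<langle>\<mu>, \<theta>\<rangle> \<le> \<langle>\<lambda>, \<theta>\<rangle>\<close>. Under these constraints the sum is smallest when the \<open>w\<^sub>k\<close> of the
  smallest eigenvalues are as large as possible, which gives \<open>|\<lambda>|\<^sup>2 \<Sigma>(r, R)\<close>.
  For a real representation both facts are transported along the real part of an irreducible constituent of the complexification.
\<close>

section \<open>One-parameter groups in Banach algebras\<close>

text \<open>A representation is assumed to be continuous only, and \<open>drep\<close> is defined as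
  a derivative along \<open>exp_in\<close>. Its existence, linearity and bracket relations therefore
  have to be proved: a continuous one-parameter group in a Banach algebra is an exponential, a
  product formula of Trotter type gives additivity, and differentiating the adjoint action gives
  brackets. The Casimir value is computed on a highest weight vector only. It holds on the whole
  module by a Schur argument, which can start from a real eigenvalue because the operator is
  self-adjoint. The real case has its own obstacle. A bound for all powers with a constant depending
  on the preimage does, and skewness recovers the sharp constant from the growth rate.\<close>

lemma exp_one_param_unique:
  fixes U :: "real \<Rightarrow> 'a::{real_normed_algebra_1,banach}"
  assumes "\<And>t. (U has_vector_derivative D * U t) (at t)" and "U 0 = 1"
  shows "U t = exp (t *\<^sub>R D)"
proof -
  \<comment> \<open>Multiplication by the inverse flow makes the curve constant: the two terms of
    the product rule are \<open>exp (- t D) * D * U t\<close> with opposite signs.\<close>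
  define F where "F t = exp (t *\<^sub>R (- D)) * U t" for t
  have "(F has_vector_derivative 0) (at t)" for t
    unfolding F_def
    using has_vector_derivative_mult[OF exp_scaleR_has_vector_derivative_right[of "-D" t UNIV] assms(1)]
    by (simp add: mult.assoc)
  then obtain c where "\<And>t. F t = c"
    using has_vector_derivative_zero_constant[OF convex_UNIV, of F] by auto
  then have "F t = F 0" by simp
  then have 1: "exp (- (t *\<^sub>R D)) * U t = 1"
    by (simp add: F_def assms(2))
  have "U t = (exp (t *\<^sub>R D) * exp (- (t *\<^sub>R D))) * U t"
    by (simp only: exp_minus_inverse mult_1_left)
  also have "\<dots> = exp (t *\<^sub>R D)"
    by (simp only: mult.assoc 1 mult_1_right)
  finally show ?thesis .
qed

text \<open>Neumann series. It serves to divide by an average of the curve in the next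
  theorem.\<close>

lemma right_inverse_near_1:
  fixes x :: "'a::{real_normed_algebra_1,banach}"
  assumes "norm (1 - x) < 1"
  obtains y where "x * y = 1"
proof
  define z where "z = 1 - x"
  have s: "summable (\<lambda>n. z ^ n)"
    using assms by (simp add: z_def complete_algebra_summable_geometric)
  have "(\<Sum>n. z ^ n) = z ^ 0 + (\<Sum>n. z ^ Suc n)"
    using suminf_split_head[OF s] by simp
  also have "(\<Sum>n. z ^ Suc n) = z * (\<Sum>n. z ^ n)"
    using suminf_mult[OF s] by simp
  finally show "x * (\<Sum>n. z ^ n) = 1"
    by (simp add: z_def algebra_simps)
qed

text \<open>Averaging turns continuity into differentiability. The product \<open>U t * I a\<close>
  is the integral of \<open>U\<close> over the window from t to t + a, hence differentiable in t,
  and for small a the mean value of \<open>U\<close> is close enough to 1 to be cancelled on the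
  right.\<close>

theorem continuous_one_param_group:
  fixes U :: "real \<Rightarrow> 'a::{real_normed_algebra_1,banach}"
  assumes cont: "continuous_on UNIV U" and add: "\<And>s t. U (s + t) = U s * U t" and "U 0 = 1"
  obtains D where "\<And>t. U t = exp (t *\<^sub>R D)"
proof -
  define I where "I t = integral {0..t} U" for t
  have cont': "continuous_on S U" for S using cont continuous_on_subset by blast
  have integ: "U integrable_on {a..b}" for a b by (intro integrable_continuous_real cont')
  have "\<exists>d>0. \<forall>s. dist s 0 < d \<longrightarrow> dist (U s) (U 0) < 1/2"
    using cont[unfolded continuous_on_iff, rule_format, of 0 "1/2"] by simp
  then obtain d where d: "d > 0" "\<And>s. \<bar>s\<bar> < d \<Longrightarrow> norm (U s - 1) < 1/2"
    using \<open>U 0 = 1\<close> by (auto simp: dist_norm)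
  \<comment> \<open>On this window \<open>U\<close> stays within 1/2 of 1, and so does its mean
    value.\<close>
  define a where "a = d / 2"
  have a: "a > 0" and Ua: "\<And>s. s \<in> {0..a} \<Longrightarrow> norm (U s - 1) \<le> 1/2"
    using d by (auto simp: a_def intro!: less_imp_le)
  have "norm (integral {0..a} (\<lambda>s. U s - 1)) \<le> (1/2) * (a - 0)"
    by (rule integral_bound) (use a Ua in \<open>auto intro!: continuous_intros cont'\<close>)
  moreover have "integral {0..a} (\<lambda>s. U s - 1) = I a - a *\<^sub>R 1"
    unfolding I_def using a by (subst integral_diff) (auto intro: integ)
  ultimately have "norm (I a - a *\<^sub>R 1) \<le> a / 2" by simp
  then have "norm (1 - (1/a) *\<^sub>R I a) < 1"
  proof -
    have "1 - (1/a) *\<^sub>R I a = (-1/a) *\<^sub>R (I a - a *\<^sub>R 1)" using a by (simp add: algebra_simps)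
    then have "norm (1 - (1/a) *\<^sub>R I a) = norm (I a - a *\<^sub>R 1) / a" using a by simp
    also have "\<dots> \<le> 1/2" using \<open>norm (I a - a *\<^sub>R 1) \<le> a / 2\<close> a by (simp add:
        field_simps)
    finally show ?thesis by simp
  qed
  then obtain y where "(1/a) *\<^sub>R I a * y = 1" by (rule right_inverse_near_1)
  then have y: "I a * ((1/a) *\<^sub>R y) = 1" by simp
  define D where "D = (U a - 1) * ((1/a) *\<^sub>R y)"
  \<comment> \<open>The antiderivative \<open>J\<close> is shown differentiable only to the right of
    its base point, which therefore has to lie left of both 0 and a.\<close>
  define c where "c = - (a + 1)"
  define J where "J u = integral {c..u} U" for u
  have J: "(J has_vector_derivative U u) (at u)" if "u > c" for u
  proof -
    have "(J has_vector_derivative U u) (at u within {c..u+1})"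
      unfolding J_def by (rule integral_has_vector_derivative[OF cont']) (use that in auto)
    then show ?thesis using that
      by (subst (asm) at_within_interior) (auto)
  qed
  have shift: "U t * I a = J (t + a) - J t" if "t > c" "t<1" for t
  proof -
    have "integral {0..a} (\<lambda>s. U (t + s)) = integral {t..t+a} U"
      using integral_shift_Icc_real[of 0 a U t] by (simp add: add.commute o_def)
    moreover have "integral {0..a} (\<lambda>s. U (t + s)) = U t * I a"
      unfolding add I_def
      using integral_linear[OF integ bounded_linear_mult_right[of "U t"], of 0 a] by (simp add: o_def)
    moreover have "J t + integral {t..t+a} U = J (t + a)"
      unfolding J_def by (rule Henstock_Kurzweil_Integration.integral_combine) (use that a integ in auto)
    ultimately show ?thesis by (simp add: algebra_simps)
  qed
  have Ueq: "U t = (J (t + a) - J t) * ((1/a) *\<^sub>R y)" if "t > c" "t < 1" for t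
    using shift[OF that] y by (metis mult.assoc mult_1_right)
  have d0: "((\<lambda>t. (J (t + a) - J t) * ((1/a) *\<^sub>R y)) has_vector_derivative D) (at 0)"
  proof -
    have "((\<lambda>t. t + a) has_vector_derivative 1) (at 0)"
      by (auto intro!: derivative_eq_intros)
    then have "((\<lambda>t. J (t + a)) has_vector_derivative U (0 + a)) (at 0)"
      using vector_diff_chain_at[of "\<lambda>t. t + a" 1 0 J "U (0 + a)"] J[of "0 + a"] a
      by (simp add: c_def o_def)
    then have "((\<lambda>t. J (t + a) - J t) has_vector_derivative U a - U 0) (at 0)"
      using J[of 0] a by (auto simp: c_def intro!: derivative_intros)
    then show ?thesis unfolding D_def \<open>U 0 = 1\<close>
      using bounded_linear.has_vector_derivative[OF bounded_linear_mult_left] by blast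
  qed
  have D0: "(U has_vector_derivative D) (at 0)"
    by (rule has_vector_derivative_transform_within_open[OF d0, of "{c<..<1}"])
       (use Ueq a in \<open>auto simp: c_def\<close>)
  \<comment> \<open>The group law \<open>U s = U (s - t) * U t\<close> moves the derivative from 0
    to t.\<close>
  have "(U has_vector_derivative D * U t) (at t)" for t
  proof -
    have "((\<lambda>s. s - t) has_vector_derivative 1) (at t)"
      by (auto intro!: derivative_eq_intros)
    then have "((\<lambda>s. U (s - t)) has_vector_derivative D) (at t)"
      using vector_diff_chain_at[of "\<lambda>s. s - t" 1 t U D] D0 by (simp add: o_def)
    then have "((\<lambda>s. U (s - t) * U t) has_vector_derivative D * U t) (at t)"
      using bounded_linear.has_vector_derivative[OF bounded_linear_mult_left] by blast
    then show ?thesis by (simp add: add[symmetric])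
  qed
  then have "U t = exp (t *\<^sub>R D)" for t by (rule exp_one_param_unique) fact
  then show ?thesis by (rule that)
qed

text \<open>Telescoping. The exponent n instead of n - 1 costs nothing in the application and is
  allowed by K \<ge> 1.\<close>

lemma power_diff_norm_le:
  fixes x y :: "'a::real_normed_algebra_1"
  assumes "norm x \<le> K" "norm y \<le> K" "K \<ge> 1"
  shows "norm (x ^ n - y ^ n) \<le> real n * K ^ n * norm (x - y)"
proof (induction n)
  case (Suc n)
  have "x ^ Suc n - y ^ Suc n = x * (x ^ n - y ^ n) + (x - y) * y ^ n"
    by (simp add: algebra_simps)
  also have "norm \<dots> \<le> norm x * norm (x ^ n - y ^ n) + norm (x - y) * norm (y ^ n)"
    by (intro order_trans[OF norm_triangle_ineq] add_mono norm_mult_ineq)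
  also have "\<dots> \<le> K * (real n * K ^ n * norm (x - y)) + norm (x - y) * K ^ Suc n"
  proof (intro add_mono mult_mono assms(1) Suc.IH)
    have "norm (y ^ n) \<le> norm y ^ n" by (rule norm_power_ineq)
    also have "\<dots> \<le> K ^ n" using assms by (intro power_mono) auto
    also have "\<dots> \<le> K ^ Suc n" using assms by (intro power_increasing) auto
    finally show "norm (y ^ n) \<le> K ^ Suc n" .
  qed (use assms in auto)
  also have "\<dots> = real (Suc n) * K ^ Suc n * norm (x - y)"
    by (simp add: algebra_simps)
  finally show ?case .
qed simp

lemma exp_scaleR_power:
  fixes x :: "'a::{real_normed_algebra_1,banach}"
  shows "exp (t *\<^sub>R x) ^ n = exp ((real n * t) *\<^sub>R x)"
proof (induction n)
  case (Suc n)
  have "exp (t *\<^sub>R x + (real n * t) *\<^sub>R x) = exp (t *\<^sub>R x) * exp ((real n * t) *\<^sub>R x)"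
    by (rule exp_add_commuting) simp
  then show ?case using Suc by (simp add: algebra_simps)
qed simp

text \<open>Trotter's formula for an arbitrary curve through 1. It is compared with
  \<open>e t = exp (t Z)\<close>, for which the power equals \<open>exp Z\<close> exactly; the two
  curves agree to first order at 0, so their distance at 1/n is o(1/n), and raising to the n-th
  power multiplies it by n times a bounded factor.\<close>

lemma power_inverse_nat_tendsto_exp:
  fixes a :: "real \<Rightarrow> 'a::{real_normed_algebra_1,banach}"
  assumes "(a has_vector_derivative Z) (at 0)" and "a 0 = 1"
  shows "(\<lambda>n. a (1 / real (Suc n)) ^ Suc n) \<longlonglongrightarrow> exp Z"
proof -
  define h where "h n = 1 / real (Suc n)" for n
  have h0: "h \<longlonglongrightarrow> 0" unfolding h_def using LIMSEQ_inverse_real_of_nat by (simp add: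
      inverse_eq_divide)
  have hpos: "h n > 0" for n by (simp add: h_def)
  have h_at: "filterlim h (at 0) sequentially"
    using h0 hpos by (auto simp: filterlim_at less_imp_neq[symmetric])
  have lim: "(\<lambda>n. (1 / h n) *\<^sub>R (b (h n) - 1)) \<longlonglongrightarrow> Z"
    if "(b has_vector_derivative Z) (at 0)" "b 0 = 1" for b :: "real \<Rightarrow> 'a"
  proof -
    have "((\<lambda>s. (1 / norm (s - 0)) *\<^sub>R (b s - (b 0 + (s - 0) *\<^sub>R Z))) \<longlongrightarrow>
        0) (at 0)"
      using that(1) unfolding has_vector_derivative_def has_derivative_within by blast
    then have "(\<lambda>n. (1 / norm (h n - 0)) *\<^sub>R (b (h n) - (b 0 + (h n - 0) *\<^sub>R Z)))
        \<longlonglongrightarrow> 0"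
      by (rule filterlim_compose[OF _ h_at])
    moreover have "(1 / norm (h n - 0)) *\<^sub>R (b (h n) - (b 0 + (h n - 0) *\<^sub>R Z))
        = (1 / h n) *\<^sub>R (b (h n) - 1) - Z" for n
      using hpos[of n] that(2) by (simp add: algebra_simps)
    ultimately show ?thesis by (simp add: LIM_zero_iff)
  qed
  define e where "e t = exp (t *\<^sub>R Z)" for t
  have e': "(e has_vector_derivative Z) (at 0)" and e0: "e 0 = 1"
    using exp_scaleR_has_vector_derivative_left[of Z 0] by (simp_all add: e_def[abs_def])
  have la: "(\<lambda>n. (1 / h n) *\<^sub>R (a (h n) - 1)) \<longlonglongrightarrow> Z" and le: "(\<lambda>n.
      (1 / h n) *\<^sub>R (e (h n) - 1)) \<longlonglongrightarrow> Z"
    using lim assms e' e0 by auto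
  obtain C1 where C1: "\<forall>n. norm ((1 / h n) *\<^sub>R (a (h n) - 1)) \<le> C1"
    using convergent_imp_Bseq[OF convergentI[OF la]] by (rule BseqE)
  obtain C2 where C2: "\<forall>n. norm ((1 / h n) *\<^sub>R (e (h n) - 1)) \<le> C2"
    using convergent_imp_Bseq[OF convergentI[OF le]] by (rule BseqE)
  define C where "C = max 0 (max C1 C2)"
  \<comment> \<open>This form of the bound is chosen because its power with exponent
    \<open>Suc n\<close> is \<open>exp C\<close>, independent of n.\<close>
  have bnd: "norm x \<le> exp (h n * C)" if "norm ((1 / h n) *\<^sub>R (x - 1)) \<le> C" for x :: 'a and n
  proof -
    have "norm (x - 1) \<le> h n * C" using that hpos[of n] unfolding norm_scaleR by (simp add: field_simps)
    then have "norm x \<le> 1 + h n * C" using norm_triangle_ineq[of 1 "x - 1"] by simp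
    then show ?thesis using exp_ge_add_one_self[of "h n * C"] by linarith
  qed
  have "norm (a (h n) ^ Suc n - exp Z) \<le> exp C * norm ((1 / h n) *\<^sub>R (a (h n) - e (h n)))" for n
  proof -
    have "exp Z = e (h n) ^ Suc n"
      using exp_scaleR_power[of "h n" Z "Suc n"] by (simp add: e_def h_def del: power_Suc)
    then have "norm (a (h n) ^ Suc n - exp Z) \<le> real (Suc n) * exp (h n * C) ^ Suc n * norm (a (h n) - e (h n))"
      using power_diff_norm_le[of "a (h n)" "exp (h n * C)" "e (h n)" "Suc n"] bnd[of n "a (h n)"] bnd[of n "e (h n)"]
        C1[rule_format, of n] C2[rule_format, of n] hpos[of n] by (auto simp: C_def)
    also have "exp (h n * C) ^ Suc n = exp C"
      by (simp add: exp_of_nat_mult[symmetric] h_def del: power_Suc)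
    finally show ?thesis by (simp add: h_def ac_simps del: power_Suc)
  qed
  then have ev: "\<forall>\<^sub>F n in sequentially.
      norm (a (h n) ^ Suc n - exp Z) \<le> exp C * norm ((1 / h n) *\<^sub>R (a (h n) - e (h n)))"
    by (intro always_eventually allI)
  have "(\<lambda>n. (1 / h n) *\<^sub>R (a (h n) - 1) - (1 / h n) *\<^sub>R (e (h n) - 1))
      \<longlonglongrightarrow> Z - Z"
    by (rule tendsto_diff[OF la le])
  then have "(\<lambda>n. (1 / h n) *\<^sub>R (a (h n) - e (h n))) \<longlonglongrightarrow> 0"
    by (simp only: scaleR_diff_right[symmetric] diff_self diff_diff_eq2 diff_add_cancel)
  then have "(\<lambda>n. exp C * norm ((1 / h n) *\<^sub>R (a (h n) - e (h n)))) \<longlonglongrightarrow> 0"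
    by (intro tendsto_mult_right_zero tendsto_norm_zero)
  then have "(\<lambda>n. a (h n) ^ Suc n - exp Z) \<longlonglongrightarrow> 0"
    by (rule Lim_null_comparison[OF ev])
  then show ?thesis
    unfolding h_def by (rule LIM_zero_cancel)
qed

text \<open>Euler's formula. In the Clifford algebra a product of two orthogonal unit vectors is
  such a \<open>j\<close>, which makes exponentials of coordinate rotations explicit.\<close>

lemma exp_scaleR_of_square_minus_one:
  fixes j :: "'a::{real_normed_algebra_1,banach}"
  assumes "j * j = - 1"
  shows "exp (t *\<^sub>R j) = cos t *\<^sub>R 1 + sin t *\<^sub>R j"
proof -
  define U where "U t = cos t *\<^sub>R 1 + sin t *\<^sub>R j" for t
  have "(U has_vector_derivative j * U t) (at t)" for t
    unfolding U_def
    by (rule derivative_eq_intros refl | simp add: algebra_simps assms)+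
  then have "U t = exp (t *\<^sub>R j)" by (rule exp_one_param_unique) (simp add: U_def)
  then show ?thesis by (simp add: U_def)
qed

section \<open>The endomorphisms of a Euclidean space as a Banach algebra\<close>

typedef (overloaded) ('a::euclidean_space) endo = "UNIV :: ('a \<Rightarrow>\<^sub>L 'a) set"
  morphisms op_of Endo ..

setup_lifting type_definition_endo

instantiation endo :: (euclidean_space) real_normed_algebra_1
begin

lift_definition zero_endo :: "'a endo" is 0 .
lift_definition one_endo :: "'a endo" is id_blinfun .
lift_definition plus_endo :: "'a endo \<Rightarrow> 'a endo \<Rightarrow> 'a endo" is "(+)" .
lift_definition minus_endo :: "'a endo \<Rightarrow> 'a endo \<Rightarrow> 'a endo" is "(-)" .
lift_definition uminus_endo :: "'a endo \<Rightarrow> 'a endo" is "uminus" .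
lift_definition times_endo :: "'a endo \<Rightarrow> 'a endo \<Rightarrow> 'a endo" is "(o\<^sub>L)" .
lift_definition scaleR_endo :: "real \<Rightarrow> 'a endo \<Rightarrow> 'a endo" is "(*\<^sub>R)" .
lift_definition norm_endo :: "'a endo \<Rightarrow> real" is norm .

definition dist_endo :: "'a endo \<Rightarrow> 'a endo \<Rightarrow> real" where "dist_endo a b = norm (a - b)"
definition sgn_endo :: "'a endo \<Rightarrow> 'a endo" where "sgn_endo x = scaleR (inverse (norm x)) x"
definition uniformity_endo :: "('a endo \<times> 'a endo) filter"
  where "uniformity_endo = (INF e\<in>{0<..}. principal {(x, y). dist x y < e})"
definition open_endo :: "'a endo set \<Rightarrow> bool"
  where "open_endo S = (\<forall>x\<in>S. \<forall>\<^sub>F (x', y) in uniformity. x' = x \<longrightarrow> y \<in> S)"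

instance
proof
  fix x y z :: "'a endo" and r s :: real
  show "x + y + z = x + (y + z)" by transfer simp
  show "x + y = y + x" by transfer simp
  show "0 + x = x" by transfer simp
  show "- x + x = 0" by transfer simp
  show "x - y = x + - y" by transfer simp
  show "x * y * z = x * (y * z)" by transfer (auto intro!: blinfun_eqI)
  show "(x + y) * z = x * z + y * z" by transfer (auto intro!: blinfun_eqI simp: blinfun.bilinear_simps)
  show "x * (y + z) = x * y + x * z" by transfer (auto intro!: blinfun_eqI simp: blinfun.bilinear_simps)
  show "1 * x = x" by transfer (auto intro!: blinfun_eqI)
  show "x * 1 = x" by transfer (auto intro!: blinfun_eqI)
  show n1: "norm (1 :: 'a endo) = 1" by transfer (simp add: norm_blinfun_id)
  show "(0 :: 'a endo) \<noteq> 1" by transfer (metis norm_blinfun_id norm_zero zero_neq_one)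
  show "r *\<^sub>R (x + y) = r *\<^sub>R x + r *\<^sub>R y" by transfer (simp add: algebra_simps)
  show "(r + s) *\<^sub>R x = r *\<^sub>R x + s *\<^sub>R x" by transfer (simp add: algebra_simps)
  show "r *\<^sub>R s *\<^sub>R x = (r * s) *\<^sub>R x" by transfer simp
  show "1 *\<^sub>R x = x" by transfer simp
  show "r *\<^sub>R x * y = r *\<^sub>R (x * y)" by transfer (auto intro!: blinfun_eqI simp: blinfun.bilinear_simps)
  show "x * r *\<^sub>R y = r *\<^sub>R (x * y)" by transfer (auto intro!: blinfun_eqI simp: blinfun.bilinear_simps)
  show "(norm x = 0) = (x = 0)" by transfer simp
  show "norm (x + y) \<le> norm x + norm y" by transfer (rule norm_triangle_ineq)
  show "norm (r *\<^sub>R x) = \<bar>r\<bar> * norm x" by transfer simp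
  show "norm (x * y) \<le> norm x * norm y" by transfer (rule norm_blinfun_compose)
  show "dist x y = norm (x - y)" by (rule dist_endo_def)
  show "sgn x = inverse (norm x) *\<^sub>R x" by (rule sgn_endo_def)
  show "uniformity = (INF e\<in>{0<..}. principal {(x :: 'a endo, y). dist x y < e})"
    by (rule uniformity_endo_def)
  show "open S = (\<forall>x\<in>S. \<forall>\<^sub>F (x', y) in uniformity. x' = x \<longrightarrow> y \<in>
      S)" for S :: "'a endo set"
    by (rule open_endo_def)
qed

end

instance endo :: (euclidean_space) banach
proof
  fix X :: "nat \<Rightarrow> 'a endo"
  assume "Cauchy X"
  have dist: "dist x y = dist (op_of x) (op_of y)" for x y :: "'a endo"
    unfolding dist_norm by transfer simp
  have "Cauchy (\<lambda>n. op_of (X n))" using \<open>Cauchy X\<close> unfolding Cauchy_def dist .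
  then obtain l where l: "(\<lambda>n. op_of (X n)) \<longlonglongrightarrow> l" using Cauchy_convergent
      convergent_def by blast
  have "X \<longlonglongrightarrow> Endo l" using l unfolding tendsto_iff dist by (simp add: Endo_inverse)
  then show "convergent X" by (rule convergentI)
qed

lift_definition endo_apply :: "'a::euclidean_space endo \<Rightarrow> 'a \<Rightarrow> 'a" is blinfun_apply .

text \<open>Meaningful for linear \<open>f\<close>, which is bounded because the space is
  finite-dimensional.\<close>

lift_definition endo_of :: "('a::euclidean_space \<Rightarrow> 'a) \<Rightarrow> 'a endo" is "\<lambda>f. Blinfun f" .

lemma endo_apply_endo_of [simp]: "linear f \<Longrightarrow> endo_apply (endo_of f) = f"
  by transfer (simp add: bounded_linear_Blinfun_apply linear_conv_bounded_linear)

lemma endo_eqI: "(\<And>v. endo_apply x v = endo_apply y v) \<Longrightarrow> x = y"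
  by transfer (rule blinfun_eqI)

lemma endo_apply_simps [simp]:
  "endo_apply (x * y) v = endo_apply x (endo_apply y v)"
  "endo_apply 1 v = v"
  "endo_apply (x + y) v = endo_apply x v + endo_apply y v"
  "endo_apply (r *\<^sub>R x) v = r *\<^sub>R endo_apply x v"
  by (transfer; simp add: blinfun.bilinear_simps)+

lemma bounded_linear_endo_apply: "bounded_linear (\<lambda>x. endo_apply x v)"
proof
  fix x y :: "'a endo" and r :: real
  show "endo_apply (x + y) v = endo_apply x v + endo_apply y v" by simp
  show "endo_apply (r *\<^sub>R x) v = r *\<^sub>R endo_apply x v" by simp
  show "\<exists>K. \<forall>x. norm (endo_apply x v) \<le> norm x * K"
    by (intro exI[of _ "norm v"] allI, transfer) (rule norm_blinfun)
qed

section \<open>Self-adjoint operators\<close>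

text \<open>The maximiser of the Rayleigh quotient on the unit sphere of \<open>S\<close> is an
  eigenvector. The last conclusion records that its eigenvalue is the largest one, which later
  yields an operator norm.\<close>

lemma self_adjoint_has_eigenvector:
  fixes f :: "'a::euclidean_space \<Rightarrow> 'a"
  assumes f: "linear f" and S: "subspace S" "S \<noteq> {0}" "\<And>x. x \<in> S \<Longrightarrow> f x \<in> S"
    and sa: "\<And>x y. x \<in> S \<Longrightarrow> y \<in> S \<Longrightarrow> f x \<bullet> y = x \<bullet> f y"
  obtains x c where "x \<in> S" "x \<noteq> 0" "f x = c *\<^sub>R x" "\<And>y. y \<in> S \<Longrightarrow> f y
      \<bullet> y \<le> c * (y \<bullet> y)"
proof -
  define K where "K = S \<inter> sphere 0 1"
  obtain z where z: "z \<in> S" "z \<noteq> 0" using S subspace_0 by blast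
  have "compact K" unfolding K_def by (intro closed_Int_compact closed_subspace S compact_sphere)
  moreover have "(1 / norm z) *\<^sub>R z \<in> K" using z S(1) by (simp add: K_def subspace_scale)
  moreover have "continuous_on K (\<lambda>x. f x \<bullet> x)"
    by (intro continuous_intros linear_continuous_on linear_conv_bounded_linear[THEN iffD1] f)
  ultimately obtain x where x: "x \<in> K" "\<And>y. y \<in> K \<Longrightarrow> f y \<bullet> y \<le> f x \<bullet> x"
    using continuous_attains_sup[of K "\<lambda>x. f x \<bullet> x"] by blast
  define c where "c = f x \<bullet> x"
  have xS: "x \<in> S" and xx: "x \<bullet> x = 1" using x by (auto simp: K_def norm_eq_1)
  have bound: "f y \<bullet> y \<le> c * (y \<bullet> y)" if "y \<in> S" for y
  proof (cases "y = 0")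
    case False
    have "(1 / norm y) *\<^sub>R y \<in> K" using False that S(1) by (simp add: K_def subspace_scale)
    from x(2)[OF this] False show ?thesis
      by (simp add: c_def linear_scale[OF f] field_simps power2_norm_eq_inner[symmetric] power2_eq_square)
  qed (simp add: linear_0[OF f])
  \<comment> \<open>The residual of the eigenvalue equation serves as the direction of variation;
    comparing the quotient at x and at x + t w gives a quadratic inequality in t whose linear
    coefficient is twice the squared length of the residual.\<close>
  define w where "w = c *\<^sub>R x - f x"
  have wS: "w \<in> S" unfolding w_def by (intro subspace_diff subspace_scale S xS)
  define a where "a = w \<bullet> w" define b where "b = c * (w \<bullet> w) - f w \<bullet> w"
  have q: "0 \<le> 2 * t * a + t\<^sup>2 * b" for t
  proof -
    have le: "f (x + t *\<^sub>R w) \<bullet> (x + t *\<^sub>R w) \<le> c * ((x + t *\<^sub>R w) \<bullet> (x +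
        t *\<^sub>R w))"
      by (intro bound subspace_add subspace_scale S xS wS)
    have eq1: "f (x + t *\<^sub>R w) \<bullet> (x + t *\<^sub>R w) = c + 2 * t * (f x \<bullet> w) + t\<^sup>2
        * (f w \<bullet> w)"
      using sa[OF wS xS] by (simp add: linear_add[OF f] linear_scale[OF f] inner_simps c_def inner_commute
          power2_eq_square algebra_simps)
    have eq2: "(x + t *\<^sub>R w) \<bullet> (x + t *\<^sub>R w) = 1 + 2 * t * (x \<bullet> w) + t\<^sup>2 * (w
        \<bullet> w)"
      using xx by (simp add: inner_simps inner_commute power2_eq_square algebra_simps)
    have e: "a = c * (x \<bullet> w) - f x \<bullet> w"
      unfolding a_def by (subst w_def) (simp add: inner_simps)
    have "2 * t * a = c * (2 * t * (x \<bullet> w)) - 2 * t * (f x \<bullet> w)"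
      unfolding e by (simp add: algebra_simps)
    then show ?thesis using le unfolding eq1 eq2 b_def by (simp add: algebra_simps)
  qed
  have "a = 0"
  proof (rule ccontr)
    assume "a \<noteq> 0"
    then have a: "a > 0" by (simp add: a_def)
    \<comment> \<open>If b \<le> 0 the polynomial is negative at t = -1, otherwise at its vertex t =
      -a/b.\<close>
    show False
    proof (cases "b \<le> 0")
      case True
      have "2 * (-1) * a + (-1)\<^sup>2 * b < 0" using a True by simp
      with q[of "-1"] show False by simp
    next
      case False
      have "2 * (- a / b) * a + (- a / b)\<^sup>2 * b = - a\<^sup>2 / b"
        using False by (simp add: field_simps power2_eq_square)
      also have "\<dots> < 0" using a False by simp
      finally show False using q[of "-a/b"] by simp
    qed
  qed
  then have "f x = c *\<^sub>R x" by (simp add: a_def w_def)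
  with xS xx bound show ?thesis by (intro that[of x c]) auto
qed

text \<open>The orthogonal complement of all eigenvectors is invariant, so if it were nonzero it
  would contain an eigenvector, orthogonal to itself.\<close>

lemma self_adjoint_eigenvectors_span:
  fixes f :: "'a::euclidean_space \<Rightarrow> 'a"
  assumes f: "linear f" and S: "subspace S" "\<And>x. x \<in> S \<Longrightarrow> f x \<in> S"
    and sa: "\<And>x y. x \<in> S \<Longrightarrow> y \<in> S \<Longrightarrow> f x \<bullet> y = x \<bullet> f y"
  shows "span {x \<in> S. \<exists>c. f x = c *\<^sub>R x} = S"
proof -
  let ?E = "{x \<in> S. \<exists>c. f x = c *\<^sub>R x}"
  define T where "T = {x \<in> S. \<forall>y\<in>?E. y \<bullet> x = 0}"
  have ET: "span ?E \<subseteq> S" by (rule span_minimal) (use S in auto)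
  have "T = {0}"
  proof (rule ccontr)
    assume T0: "T \<noteq> {0}"
    have sT: "subspace T"
      using S(1) by (auto simp: T_def subspace_def inner_simps)
    have fT: "f x \<in> T" if "x \<in> T" for x
    proof -
      have "y \<bullet> f x = 0" if "y \<in> ?E" for y
      proof -
        from that obtain c where "y \<in> S" "f y = c *\<^sub>R y" by auto
        then show ?thesis using sa[of y x] \<open>x \<in> T\<close> that by (auto simp: T_def)
      qed
      then show ?thesis using that S by (auto simp: T_def)
    qed
    have saT: "f x \<bullet> y = x \<bullet> f y" if "x \<in> T" "y \<in> T" for x y
      using that sa by (simp add: T_def)
    obtain x c where "x \<in> T" "x \<noteq> 0" "f x = c *\<^sub>R x"
      by (rule self_adjoint_has_eigenvector[OF f sT T0 fT saT])
    then have "x \<bullet> x = 0" unfolding T_def by blast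
    with \<open>x \<noteq> 0\<close> show False by simp
  qed
  have "S \<subseteq> span ?E"
  proof
    fix x assume "x \<in> S"
    obtain y z where yz: "y \<in> span ?E" "\<And>w. w \<in> span ?E \<Longrightarrow> orthogonal z w" "x = y + z"
      by (rule orthogonal_subspace_decomp_exists[of ?E x]) blast
    have "x - y \<in> S" using \<open>x \<in> S\<close> yz(1) ET by (intro subspace_diff S(1)) auto
    then have "z \<in> S" using yz(3) by simp
    then have "z \<in> T" using yz(2) by (auto simp: T_def orthogonal_def inner_commute span_base)
    then show "x \<in> span ?E" using yz \<open>T = {0}\<close> by simp
  qed
  with ET show ?thesis by blast
qed

text \<open>A general bilinear form replaces the inner product of the type because
  \<open>so_inner\<close> is half of the latter.\<close>

lemma orthonormal_expansion:
  fixes B :: "'a::euclidean_space set"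
  assumes "finite B" "\<And>x y. x \<in> B \<Longrightarrow> y \<in> B \<Longrightarrow> g x y = (if x = y then
      1 else 0)"
    and g: "bilinear g" and "v \<in> span B"
  shows "v = (\<Sum>b\<in>B. g v b *\<^sub>R b)"
proof -
  obtain u where u: "v = (\<Sum>b\<in>B. u b *\<^sub>R b)"
    using assms(1,4) span_finite by blast
  have lin: "linear (\<lambda>x. g x b)" for b using g by (simp add: bilinear_def)
  have "g v b = u b" if "b \<in> B" for b
  proof -
    have "g v b = (\<Sum>a\<in>B. u a * g a b)"
      unfolding u linear_sum[OF lin] linear_scale[OF lin] by simp
    also have "\<dots> = (\<Sum>a\<in>B. if a = b then u a else 0)"
      by (rule sum.cong) (use assms(2) that in auto)
    finally show ?thesis using that \<open>finite B\<close> by simp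
  qed
  then show ?thesis using u by (metis (no_types, lifting) sum.cong)
qed

text \<open>Expanding in one basis and collecting in the other. Bilinearity of \<beta> is asked on
  the span only, since curvature operators and \<open>drep\<close> are controlled on
  \<open>so_alg\<close> alone.\<close>

lemma trace_orthonormal_invariant:
  fixes B B' :: "'a::euclidean_space set" and g :: "'a \<Rightarrow> 'a \<Rightarrow> real" and \<beta> :: "'a
      \<Rightarrow> 'a \<Rightarrow> 'b::real_vector"
  assumes B: "finite B" "\<And>x y. x \<in> B \<Longrightarrow> y \<in> B \<Longrightarrow> g x y = (if x = y
      then 1 else 0)"
    and B': "finite B'" "\<And>x y. x \<in> B' \<Longrightarrow> y \<in> B' \<Longrightarrow> g x y = (if x = y
        then 1 else 0)"
    and g: "bilinear g" "\<And>x y. g x y = g y x" and sp: "span B = span B'"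
    and add: "\<And>x y z. x \<in> span B \<Longrightarrow> y \<in> span B \<Longrightarrow> z \<in> span B
        \<Longrightarrow> \<beta> (x + y) z = \<beta> x z + \<beta> y z"
      "\<And>x y z. x \<in> span B \<Longrightarrow> y \<in> span B \<Longrightarrow> z \<in> span B
          \<Longrightarrow> \<beta> z (x + y) = \<beta> z x + \<beta> z y"
    and scale: "\<And>c x z. x \<in> span B \<Longrightarrow> z \<in> span B \<Longrightarrow> \<beta> (c
        *\<^sub>R x) z = c *\<^sub>R \<beta> x z"
      "\<And>c x z. x \<in> span B \<Longrightarrow> z \<in> span B \<Longrightarrow> \<beta> z (c *\<^sub>R x)
          = c *\<^sub>R \<beta> z x"
  shows "(\<Sum>b\<in>B. \<beta> b b) = (\<Sum>b\<in>B'. \<beta> b b)"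
proof -
  have zero: "\<beta> 0 z = 0" "\<beta> z 0 = 0" if "z \<in> span B" for z
    using scale(1)[of 0 z 0] scale(2)[of 0 z 0] that span_zero by auto
  have s1: "\<beta> (\<Sum>b\<in>A. u b *\<^sub>R b) z = (\<Sum>b\<in>A. u b *\<^sub>R \<beta> b z)"
    if "finite A" "A \<subseteq> span B" "z \<in> span B" for A u z
    using that
  proof (induction A rule: finite_induct)
    case (insert x F)
    have "(\<Sum>b\<in>F. u b *\<^sub>R b) \<in> span B"
      by (rule span_sum) (use insert.prems in \<open>auto intro: span_scale\<close>)
    moreover have "u x *\<^sub>R x \<in> span B" "x \<in> span B"
      using insert.prems by (auto intro: span_scale)
    ultimately show ?case
      using insert.IH insert.hyps insert.prems by (simp add: add(1) scale(1))
  qed (simp add: zero)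
  have s2: "\<beta> z (\<Sum>b\<in>A. u b *\<^sub>R b) = (\<Sum>b\<in>A. u b *\<^sub>R \<beta> z b)"
    if "finite A" "A \<subseteq> span B" "z \<in> span B" for A u z
    using that
  proof (induction A rule: finite_induct)
    case (insert x F)
    have "(\<Sum>b\<in>F. u b *\<^sub>R b) \<in> span B"
      by (rule span_sum) (use insert.prems in \<open>auto intro: span_scale\<close>)
    moreover have "u x *\<^sub>R x \<in> span B" "x \<in> span B"
      using insert.prems by (auto intro: span_scale)
    ultimately show ?case
      using insert.IH insert.hyps insert.prems by (simp add: add(2) scale(2))
  qed (simp add: zero)
  have sub: "B \<subseteq> span B" "B' \<subseteq> span B" using sp span_superset by auto
  have "(\<Sum>b\<in>B. \<beta> b b) = (\<Sum>b\<in>B. \<Sum>a\<in>B'. g b a *\<^sub>R \<beta> b a)"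
  proof (rule sum.cong[OF refl])
    fix b assume b: "b \<in> B"
    have "b = (\<Sum>a\<in>B'. g b a *\<^sub>R a)"
      using orthonormal_expansion[OF B' g(1)] b sp span_base by blast
    then have "\<beta> b b = \<beta> b (\<Sum>a\<in>B'. g b a *\<^sub>R a)" by simp
    also have "\<dots> = (\<Sum>a\<in>B'. g b a *\<^sub>R \<beta> b a)" using s2 B'(1) sub b by blast
    finally show "\<beta> b b = (\<Sum>a\<in>B'. g b a *\<^sub>R \<beta> b a)" .
  qed
  also have "\<dots> = (\<Sum>a\<in>B'. \<Sum>b\<in>B. g a b *\<^sub>R \<beta> b a)"
    by (subst sum.swap) (simp add: g(2))
  also have "\<dots> = (\<Sum>a\<in>B'. \<beta> a a)"
  proof (rule sum.cong[OF refl])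
    fix a assume a: "a \<in> B'"
    have "a = (\<Sum>b\<in>B. g a b *\<^sub>R b)"
      using orthonormal_expansion[OF B g(1)] a sp span_base by blast
    then have "\<beta> a a = \<beta> (\<Sum>b\<in>B. g a b *\<^sub>R b) a" by simp
    also have "\<dots> = (\<Sum>b\<in>B. g a b *\<^sub>R \<beta> b a)" using s1 B(1) sub a by blast
    finally show "(\<Sum>b\<in>B. g a b *\<^sub>R \<beta> b a) = \<beta> a a" by simp
  qed
  finally show ?thesis .
qed

text \<open>The bathtub principle, with the first eigenvalue that is not fully loaded as threshold
  \<tau>: before it \<open>(\<nu> k - \<tau>) * (w k - \<Lambda>)\<close> and from it on
  \<open>(\<nu> k - \<tau>) * w k\<close> are nonnegative, and the terms with \<tau> are determined
  by the prescribed total.\<close>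

lemma weighted_sum_ge:
  fixes \<nu> w :: "nat \<Rightarrow> real"
  assumes mono: "\<And>i j. i \<le> j \<Longrightarrow> j < N \<Longrightarrow> \<nu> i \<le> \<nu> j"
    and w: "\<And>k. k < N \<Longrightarrow> 0 \<le> w k" "\<And>k. k < N \<Longrightarrow> w k \<le> \<Lambda>" 
    and sum: "(\<Sum>k<N. w k) = r * \<Lambda>" and "\<Lambda> > 0"
  shows "(\<Sum>k<N. \<nu> k * w k) \<ge> \<Lambda> * ((\<Sum>k<nat \<lfloor>r\<rfloor>. \<nu> k) + (r - of_int
      \<lfloor>r\<rfloor>) * \<nu> (nat \<lfloor>r\<rfloor>))"
proof -
  define f where "f = nat \<lfloor>r\<rfloor>"
  have "0 \<le> r * \<Lambda>" unfolding sum[symmetric] by (rule sum_nonneg) (use w in auto)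
  then have r0: "0 \<le> r" using \<open>\<Lambda> > 0\<close> by (simp add: zero_le_mult_iff)
  have "r * \<Lambda> \<le> real N * \<Lambda>" unfolding sum[symmetric]
    using sum_bounded_above[of "{..<N}" w \<Lambda>] w(2) by simp
  then have rN: "r \<le> real N" using \<open>\<Lambda> > 0\<close> by simp
  have fr: "of_int \<lfloor>r\<rfloor> = real f" using r0 by (simp add: f_def)
  have f1: "real f \<le> r" using r0 unfolding f_def by linarith
  then have fN: "f \<le> N" using rN by linarith
  \<comment> \<open>For r = N there is no eigenvalue number f; the default 0 is harmless because the
    coefficient r - f is then 0.\<close>
  define \<tau> where "\<tau> = (if f < N then \<nu> f else 0)"
  have d: "(r - real f) * \<nu> f = (r - real f) * \<tau>"
    using f1 rN fN by (auto simp: \<tau>_def)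
  have split: "(\<Sum>k<N. h k) = (\<Sum>k<f. h k) + (\<Sum>k=f..<N. h k)" for h :: "nat \<Rightarrow> real"
    using fN by (metis lessThan_atLeast0 sum.atLeastLessThan_concat zero_le)
  show ?thesis
  proof (cases "f < N")
    case True
    have "0 \<le> (\<Sum>k<f. (\<nu> k - \<tau>) * (w k - \<Lambda>))"
      by (intro sum_nonneg mult_nonpos_nonpos) (use True mono w in \<open>auto simp: \<tau>_def\<close>)
    moreover have "0 \<le> (\<Sum>k=f..<N. (\<nu> k - \<tau>) * w k)"
      by (intro sum_nonneg mult_nonneg_nonneg) (use True mono w in \<open>auto simp: \<tau>_def\<close>)
    moreover have "(\<Sum>k<f. (\<nu> k - \<tau>) * (w k - \<Lambda>)) = (\<Sum>k<f. \<nu> k * w k) - \<Lambda>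
        * (\<Sum>k<f. \<nu> k) - \<tau> * (\<Sum>k<f. w k) + real f * \<tau> * \<Lambda>"
      by (simp add: algebra_simps sum.distrib sum_subtractf sum_distrib_left)
    moreover have "(\<Sum>k=f..<N. (\<nu> k - \<tau>) * w k) = (\<Sum>k=f..<N. \<nu> k * w k) - \<tau> *
        (\<Sum>k=f..<N. w k)"
      by (simp add: algebra_simps sum_subtractf sum_distrib_left)
    moreover have "\<tau> * (\<Sum>k<f. w k) + \<tau> * (\<Sum>k=f..<N. w k) = \<tau> * (r * \<Lambda>)"
      using sum split[of w] by (metis distrib_left)
    ultimately have "\<Lambda> * ((\<Sum>k<f. \<nu> k) + (r - real f) * \<tau>) \<le> (\<Sum>k<N. \<nu> k * w k)"
      unfolding split[of "\<lambda>k. \<nu> k * w k"] by (simp add: algebra_simps)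
    then show ?thesis unfolding fr f_def[symmetric] d .
  next
    case False
    then have "f = N" "r = real N" using fN f1 rN by auto
    \<comment> \<open>The total equals the sum of all caps, so every cap is attained.\<close>
    have "(\<Sum>k<N. \<Lambda> - w k) = 0" using sum \<open>r = real N\<close> by (simp add: sum_subtractf)
    then have "\<forall>k\<in>{..<N}. \<Lambda> - w k = 0"
      by (subst (asm) sum_nonneg_eq_0_iff) (use w in auto)
    then have "(\<Sum>k<N. \<nu> k * w k) = (\<Sum>k<N. \<nu> k * \<Lambda>)" by (intro sum.cong) auto
    then show ?thesis unfolding fr f_def[symmetric] d
      using \<open>f = N\<close> \<open>r = real N\<close> by (simp add: sum_distrib_left mult.commute)
  qed
qed

section \<open>The eigenbasis of the curvature operator\<close>

lemma so_inner_eq: "so_inner X Y = (X \<bullet> Y) / 2"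
  by (simp add: so_inner_def trace_def matrix_matrix_mult_def transpose_def inner_vec_def)

lemma bilinear_so_inner: "bilinear so_inner"
  unfolding bilinear_def so_inner_eq
  by (auto intro!: linearI simp: inner_simps algebra_simps add_divide_distrib)

lemma so_inner_commute: "so_inner X Y = so_inner Y X"
  by (simp add: so_inner_eq inner_commute)

lemma so_alg_iff: "X \<in> so_alg \<longleftrightarrow> (\<forall>i j. X $ j $ i = - X $ i $ j)"
  by (simp add: so_alg_def transpose_def vec_eq_iff)

lemma subspace_so_alg: "subspace so_alg"
proof (rule subspaceI)
  show "0 \<in> so_alg" by (simp add: so_alg_iff)
next
  fix X Y :: "real^'n^'n" and c :: real
  assume X: "X \<in> so_alg"
  then have *: "X $ j $ i = - X $ i $ j" for i j unfolding so_alg_iff by blast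
  show "c *\<^sub>R X \<in> so_alg" unfolding so_alg_iff
  proof (intro allI)
    fix i j show "(c *\<^sub>R X) $ j $ i = - (c *\<^sub>R X) $ i $ j" using *[of j i] by simp
  qed
  assume "Y \<in> so_alg"
  then have **: "Y $ j $ i = - Y $ i $ j" for i j unfolding so_alg_iff by blast
  show "X + Y \<in> so_alg" unfolding so_alg_iff
  proof (intro allI)
    fix i j show "(X + Y) $ j $ i = - (X + Y) $ i $ j" using *[of j i] **[of j i] by simp
  qed
qed

lemma linear_transpose: "linear (transpose :: real^'n^'n \<Rightarrow> _)"
  by (auto intro!: linearI simp: transpose_def vec_eq_iff)

text \<open>The projection onto \<open>so_alg\<close>. Precomposing with it turns a map that is
  specified on \<open>so_alg\<close> only into a linear map on all matrices.\<close>

definition skew_part :: "real^'n^'n \<Rightarrow> real^'n^'n" where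
  "skew_part X = (1/2) *\<^sub>R (X - transpose X)"

lemma skew_part_in: "skew_part X \<in> so_alg"
  by (simp add: skew_part_def so_alg_iff transpose_def field_simps)

lemma skew_part_id: "X \<in> so_alg \<Longrightarrow> skew_part X = X"
  by (simp add: skew_part_def so_alg_def flip: scaleR_2)

lemma linear_skew_part: "linear skew_part"
  unfolding skew_part_def[abs_def]
  by (auto intro!: linear_compose_scale_right linear_compose_sub linear_transpose linear_ident)

lemma linear_comp_skew_part:
  assumes "\<And>X Y. X \<in> so_alg \<Longrightarrow> Y \<in> so_alg \<Longrightarrow> F (X + Y) = F X + F Y"
    and "\<And>c X. X \<in> so_alg \<Longrightarrow> F (c *\<^sub>R X) = c *\<^sub>R F X"
  shows "linear (F \<circ> skew_part)"
  by (auto intro!: linearI simp: assms skew_part_in linear_add[OF linear_skew_part] linear_scale[OF linear_skew_part])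

lemma finite_orthonormal_basis_so: "orthonormal_basis_so B \<Longrightarrow> finite B"
proof -
  assume B: "orthonormal_basis_so B"
  have "pairwise orthogonal B"
    using B by (auto simp: orthonormal_basis_so_def so_inner_eq pairwise_def orthogonal_def)
  moreover have "0 \<notin> B"
    using B by (force simp: orthonormal_basis_so_def so_inner_eq)
  ultimately show "finite B" using pairwise_orthogonal_independent independent_imp_finite by blast
qed

lemma trace_orthonormal_so:
  fixes \<beta> :: "real^'n^'n \<Rightarrow> real^'n^'n \<Rightarrow> 'b::real_vector"
  assumes "orthonormal_basis_so B" "orthonormal_basis_so B'"
    and "\<And>x y z. x \<in> so_alg \<Longrightarrow> y \<in> so_alg \<Longrightarrow> z \<in> so_alg
        \<Longrightarrow> \<beta> (x + y) z = \<beta> x z + \<beta> y z"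
      "\<And>x y z. x \<in> so_alg \<Longrightarrow> y \<in> so_alg \<Longrightarrow> z \<in> so_alg
          \<Longrightarrow> \<beta> z (x + y) = \<beta> z x + \<beta> z y"
    and "\<And>c x z. x \<in> so_alg \<Longrightarrow> z \<in> so_alg \<Longrightarrow> \<beta> (c *\<^sub>R x)
        z = c *\<^sub>R \<beta> x z"
      "\<And>c x z. x \<in> so_alg \<Longrightarrow> z \<in> so_alg \<Longrightarrow> \<beta> z (c *\<^sub>R x)
          = c *\<^sub>R \<beta> z x"
  shows "(\<Sum>b\<in>B. \<beta> b b) = (\<Sum>b\<in>B'. \<beta> b b)"
proof -
  have sp: "span B = so_alg" "span B' = so_alg"
    and o: "\<And>x y. x \<in> B \<Longrightarrow> y \<in> B \<Longrightarrow> so_inner x y = (if x = y then 1 else 0)"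
       "\<And>x y. x \<in> B' \<Longrightarrow> y \<in> B' \<Longrightarrow> so_inner x y = (if x = y then 1 else 0)"
    using assms(1,2) by (auto simp: orthonormal_basis_so_def)
  show ?thesis
    by (rule trace_orthonormal_invariant[where g = so_inner])
      (auto simp: sp o bilinear_so_inner so_inner_commute assms finite_orthonormal_basis_so)
qed

context
  fixes R :: "real^'n^'n \<Rightarrow> real^'n^'n"
  assumes R: "curvature_operator R"
begin

lemma curv_linear: "linear (R \<circ> skew_part)"
  by (rule linear_comp_skew_part) (use R in \<open>auto simp: curvature_operator_def\<close>)

lemma subspace_curv_eigenspace: "subspace (curv_eigenspace R c)"
proof (rule subspaceI)
  have "R (0 *\<^sub>R 0) = 0 *\<^sub>R R 0"
    using R subspace_0[OF subspace_so_alg] unfolding curvature_operator_def by blast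
  then show "0 \<in> curv_eigenspace R c"
    by (simp add: curv_eigenspace_def subspace_0[OF subspace_so_alg])
next
  fix X Y :: "real^'n^'n" and a :: real
  assume X: "X \<in> curv_eigenspace R c"
  then have "R (a *\<^sub>R X) = a *\<^sub>R R X"
    using R unfolding curvature_operator_def curv_eigenspace_def by blast
  then show "a *\<^sub>R X \<in> curv_eigenspace R c"
    using X by (simp add: curv_eigenspace_def subspace_scale[OF subspace_so_alg])
  assume Y: "Y \<in> curv_eigenspace R c"
  then have "R (X + Y) = R X + R Y"
    using R X unfolding curvature_operator_def curv_eigenspace_def by blast
  then show "X + Y \<in> curv_eigenspace R c"
    using X Y by (simp add: curv_eigenspace_def subspace_add[OF subspace_so_alg] scaleR_add_right)
qed

lemma curv_eigenspace_orthogonal: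
  assumes "c \<noteq> d" "x \<in> curv_eigenspace R c" "y \<in> curv_eigenspace R d"
  shows "x \<bullet> y = 0"
proof -
  have "so_inner (R x) y = so_inner x (R y)"
    using R assms unfolding curvature_operator_def curv_eigenspace_def by blast
  then have "R x \<bullet> y = x \<bullet> R y" by (simp add: so_inner_eq)
  then have "(c - d) * (x \<bullet> y) = 0"
    using assms by (simp add: curv_eigenspace_def algebra_simps)
  with assms(1) show ?thesis by simp
qed

text \<open>Eigenvectors for distinct eigenvalues are orthogonal, hence independent. Finiteness
  makes \<open>curv_eigenvalues\<close> meaningful, since \<open>sorted_list_of_set\<close> returns
  the empty list on infinite sets.\<close>

lemma finite_curv_spectrum: "finite {c. curv_eigenspace R c \<noteq> {0}}" (is "finite ?C")
proof -
  have "\<exists>x. x \<in> curv_eigenspace R c \<and> x \<noteq> 0" if "c \<in> ?C" for c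
    using that subspace_0[OF subspace_curv_eigenspace] by blast
  then obtain e where e: "\<And>c. c \<in> ?C \<Longrightarrow> e c \<in> curv_eigenspace R c \<and> e c
      \<noteq> 0" by metis
  have orth: "e c \<bullet> e d = 0" if "c \<in> ?C" "d \<in> ?C" "c \<noteq> d" for c d
    using curv_eigenspace_orthogonal[OF that(3)] e that by blast
  have "inj_on e ?C"
  proof (rule inj_onI, rule ccontr)
    fix c d assume "c \<in> ?C" "d \<in> ?C" "e c = e d" "c \<noteq> d"
    then have "e d \<bullet> e d = 0" using orth[of c d] by simp
    then show False using e[OF \<open>d \<in> ?C\<close>] by simp
  qed
  moreover have "finite (e ` ?C)"
  proof (intro independent_imp_finite pairwise_orthogonal_independent)
    show "pairwise orthogonal (e ` ?C)"
      using orth by (auto simp: pairwise_def orthogonal_def)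
    show "0 \<notin> e ` ?C" using e by force
  qed
  ultimately show ?thesis using finite_imageD by blast
qed

text \<open>Bases of the eigenspaces are concatenated in the same order and with the same block
  lengths as in \<open>curv_eigenvalues\<close>, so that vectors and eigenvalues match position by
  position.\<close>

lemma curv_eigenbasis:
  obtains xs where "orthonormal_basis_so (set xs)" "distinct xs"
    "length xs = length (curv_eigenvalues R)" "sorted (curv_eigenvalues R)"
    "\<And>k. k < length xs \<Longrightarrow> R (xs ! k) = (curv_eigenvalues R ! k) *\<^sub>R (xs ! k)"
proof -
  let ?E = "curv_eigenspace R"
  define cs where "cs = sorted_list_of_set {c. ?E c \<noteq> {0}}"
  have cs: "sorted cs" "distinct cs" "set cs = {c. ?E c \<noteq> {0}}"
    using finite_curv_spectrum by (auto simp: cs_def)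
  have "\<exists>l. distinct l \<and> length l = dim (?E c) \<and> span (set l) = ?E c \<and>
     (\<forall>x\<in>set l. \<forall>y\<in>set l. so_inner x y = (if x = y then 1 else 0))" for c
  proof -
    obtain B where B: "B \<subseteq> ?E c" "pairwise orthogonal B" "\<And>x. x \<in> B \<Longrightarrow> norm x = 1"
      "independent B" "card B = dim (?E c)" "span B = ?E c"
      using orthonormal_basis_subspace[OF subspace_curv_eigenspace] by blast
    obtain l where l: "set l = B" "distinct l"
      using finite_distinct_list independent_imp_finite[OF B(4)] by blast
    \<comment> \<open>Unit vectors for \<open>so_inner\<close>, which is half the inner product of
      matrices, have length \<open>sqrt 2\<close>.\<close>
    define m where "m = map (\<lambda>x. sqrt 2 *\<^sub>R x) l"
    have "distinct m" using l by (auto simp: m_def distinct_map inj_on_def)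
    moreover have "length m = dim (?E c)" using l B by (simp add: m_def distinct_card[symmetric])
    moreover have "span (set m) = ?E c"
    proof -
      have "set m = (\<lambda>x. sqrt 2 *\<^sub>R x) ` B" by (simp add: m_def l)
      moreover have "span ((\<lambda>x. sqrt 2 *\<^sub>R x) ` B) = span B"
        by (rule span_image_scale) (use B(4) independent_imp_finite in auto)
      ultimately show ?thesis by (simp add: B)
    qed
    moreover have "so_inner x y = (if x = y then 1 else 0)" if "x \<in> set m" "y \<in> set m" for x y
    proof -
      from that obtain a b where ab: "a \<in> B" "b \<in> B" "x = sqrt 2 *\<^sub>R a" "y = sqrt 2 *\<^sub>R b"
        by (auto simp: m_def l)
      have "so_inner x y = a \<bullet> b" by (simp add: ab so_inner_eq)
      also have "\<dots> = (if a = b then 1 else 0)"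
        using B(2) B(3)[OF ab(1)] ab(1,2) by (auto simp: pairwise_def orthogonal_def norm_eq_1)
      finally show ?thesis by (simp add: ab)
    qed
    ultimately show ?thesis by blast
  qed
  then obtain l where l: "\<And>c. distinct (l c)" "\<And>c. length (l c) = dim (?E c)" "\<And>c. span (set (l
      c)) = ?E c"
     "\<And>c x y. x \<in> set (l c) \<Longrightarrow> y \<in> set (l c) \<Longrightarrow> so_inner x y = (if x
         = y then 1 else 0)"
    by metis
  have lE: "set (l c) \<subseteq> ?E c" for c using l(3) span_superset by blast
  define xs where "xs = concat (map l cs)"
  have ev: "curv_eigenvalues R = concat (map (\<lambda>c. replicate (length (l c)) c) cs)"
    by (simp add: curv_eigenvalues_def cs_def l(2))
  have la: "list_all2 (\<lambda>x c. x \<in> ?E c) (concat (map l ds)) (concat (map (\<lambda>c. replicate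
      (length (l c)) c) ds))" for ds
  proof (induction ds)
    case (Cons d ds)
    have "list_all2 (\<lambda>x c. x \<in> ?E c) (l d) (replicate (length (l d)) d)"
      using lE[of d] by (auto simp: list_all2_conv_all_nth subset_iff)
    then show ?case using Cons by (simp add: list_all2_appendI)
  qed simp
  have ne: "x \<noteq> y" if "x \<in> set (l c)" "y \<in> set (l d)" "c \<noteq> d" for x y c d
  proof
    assume "x = y"
    have "x \<bullet> y = 0" using curv_eigenspace_orthogonal[OF that(3)] that lE by blast
    then show False using l(4)[OF that(1) that(1)] \<open>x = y\<close> by (simp add: so_inner_eq)
  qed
  have dist: "distinct (concat (map l ds))" if "distinct ds" for ds
    using that
  proof (induction ds)
    case (Cons d ds)
    have "set (l d) \<inter> set (concat (map l ds)) = {}"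
      using Cons.prems ne by fastforce
    then show ?case using Cons l(1) by simp
  qed simp
  have srt: "sorted (concat (map (\<lambda>c. replicate (length (l c)) c) ds))" if "sorted ds" for ds
    using that by (induction ds) (auto simp: sorted_append)
  have sub: "set xs \<subseteq> so_alg" using lE by (auto simp: xs_def curv_eigenspace_def)
  have "span (set xs) = so_alg"
  proof
    show "span (set xs) \<subseteq> so_alg" by (intro span_minimal sub subspace_so_alg)
    have "{x \<in> so_alg. \<exists>c. (R \<circ> skew_part) x = c *\<^sub>R x} \<subseteq> span (set xs)"
    proof safe
      fix x c assume x: "x \<in> so_alg" "(R \<circ> skew_part) x = c *\<^sub>R x"
      then have xE: "x \<in> ?E c" by (simp add: skew_part_id curv_eigenspace_def)
      show "x \<in> span (set xs)"
      proof (cases "x = 0")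
        case False
        then have "c \<in> set cs" using xE cs by auto
        then have "set (l c) \<subseteq> set xs" by (auto simp: xs_def)
        then show ?thesis using xE l(3)[of c] span_mono by blast
      qed (simp add: span_zero)
    qed
    then have "span {x \<in> so_alg. \<exists>c. (R \<circ> skew_part) x = c *\<^sub>R x} \<subseteq> span (set xs)"
      by (rule span_minimal) simp
    also have "span {x \<in> so_alg. \<exists>c. (R \<circ> skew_part) x = c *\<^sub>R x} = so_alg"
      by (rule self_adjoint_eigenvectors_span[OF curv_linear subspace_so_alg])
        (use R in \<open>auto simp: curvature_operator_def skew_part_id so_inner_eq\<close>)
    finally show "so_alg \<subseteq> span (set xs)" .
  qed
  moreover have "so_inner x y = (if x = y then 1 else 0)" if xy: "x \<in> set xs" "y \<in> set xs" for x y
  proof -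
    from xy obtain c d where cd: "x \<in> set (l c)" "y \<in> set (l d)" by (auto simp: xs_def)
    show ?thesis
    proof (cases "c = d")
      case True
      then show ?thesis using l(4) cd by blast
    next
      case False
      then have "x \<bullet> y = 0" using curv_eigenspace_orthogonal cd lE by blast
      then show ?thesis using ne[OF cd False] by (simp add: so_inner_eq)
    qed
  qed
  ultimately have "orthonormal_basis_so (set xs)"
    using sub by (simp add: orthonormal_basis_so_def)
  moreover have "distinct xs" unfolding xs_def by (rule dist[OF cs(2)])
  moreover have "length xs = length (curv_eigenvalues R)"
    using list_all2_lengthD[OF la] by (simp only: ev xs_def)
  moreover have "sorted (curv_eigenvalues R)" unfolding ev by (rule srt[OF cs(1)])
  moreover have "R (xs ! k) = (curv_eigenvalues R ! k) *\<^sub>R (xs ! k)" if "k < length xs" for k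
    using list_all2_nthD[OF la[of cs]] that by (simp add: ev xs_def curv_eigenspace_def)
  ultimately show ?thesis by (rule that)
qed

end

text \<open>This is all that the estimate uses of a representation. Complex modules enter as real
  Euclidean spaces, so the orthogonal and the unitary case share one argument.\<close>

locale skew_action =
  fixes d :: "real^'n^'n \<Rightarrow> 'e::euclidean_space \<Rightarrow> 'e"
  assumes add: "X \<in> so_alg \<Longrightarrow> Y \<in> so_alg \<Longrightarrow> d (X + Y) v = d X v + d Y v"
    and scale: "X \<in> so_alg \<Longrightarrow> d (c *\<^sub>R X) v = c *\<^sub>R d X v"
    and lin: "X \<in> so_alg \<Longrightarrow> linear (d X)"
    and skew: "X \<in> so_alg \<Longrightarrow> d X v \<bullet> w = - (v \<bullet> d X w)"
begin

lemma sum_squares_basis_invariant: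
  assumes "orthonormal_basis_so B" "orthonormal_basis_so B'"
  shows "(\<Sum>X\<in>B. d X (d X v)) = (\<Sum>X\<in>B'. d X (d X v))"
  by (rule trace_orthonormal_so[OF assms])
    (simp_all add: add scale linear_add[OF lin] linear_scale[OF lin])

lemma curvature_form_eigenbasis:
  assumes R: "curvature_operator R" and B: "orthonormal_basis_so B"
  obtains xs where "orthonormal_basis_so (set xs)" "distinct xs"
    "length xs = length (curv_eigenvalues R)" "sorted (curv_eigenvalues R)"
    "\<And>v. (\<Sum>X\<in>B. d (R X) (d X v)) = (\<Sum>k<length xs. (curv_eigenvalues R ! k) *\<^sub>R d (xs !
        k) (d (xs ! k) v))"
proof -
  obtain xs where xs: "orthonormal_basis_so (set xs)" "distinct xs"
    "length xs = length (curv_eigenvalues R)" "sorted (curv_eigenvalues R)"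
    "\<And>k. k < length xs \<Longrightarrow> R (xs ! k) = (curv_eigenvalues R ! k) *\<^sub>R (xs ! k)"
    using curv_eigenbasis[OF R] by blast
  have so: "xs ! k \<in> so_alg" if "k < length xs" for k
    using xs(1) that by (auto simp: orthonormal_basis_so_def)
  have "(\<Sum>X\<in>B. d (R X) (d X v)) = (\<Sum>k<length xs. (curv_eigenvalues R ! k) *\<^sub>R d (xs ! k) (d
      (xs ! k) v))" for v
  proof -
    have "(\<Sum>X\<in>B. d (R X) (d X v)) = (\<Sum>X\<in>set xs. d (R X) (d X v))"
      by (rule trace_orthonormal_so[OF B xs(1)])
        (use R in \<open>simp_all add: curvature_operator_def add scale linear_add[OF lin] linear_scale[OF lin]\<close>)
    also have "\<dots> = (\<Sum>k<length xs. d (R (xs ! k)) (d (xs ! k) v))"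
      by (rule sum.reindex_bij_betw[OF bij_betw_nth[OF xs(2) refl refl], symmetric])
    also have "\<dots> = (\<Sum>k<length xs. (curv_eigenvalues R ! k) *\<^sub>R d (xs ! k) (d (xs ! k) v))"
      by (rule sum.cong) (use xs(5) so scale in auto)
    finally show ?thesis .
  qed
  with xs show ?thesis by (intro that) auto
qed

lemma curvature_form_symmetric:
  assumes "curvature_operator R" "orthonormal_basis_so B"
  shows "(\<Sum>X\<in>B. d (R X) (d X v)) \<bullet> w = v \<bullet> (\<Sum>X\<in>B. d (R X) (d X w))"
proof -
  obtain xs where xs: "orthonormal_basis_so (set xs)"
    and form: "\<And>v. (\<Sum>X\<in>B. d (R X) (d X v)) = (\<Sum>k<length xs. (curv_eigenvalues R ! k)
        *\<^sub>R d (xs ! k) (d (xs ! k) v))"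
    using curvature_form_eigenbasis[OF assms] by blast
  have "xs ! k \<in> so_alg" if "k < length xs" for k
    using xs that by (auto simp: orthonormal_basis_so_def)
  then show ?thesis unfolding form inner_sum_left inner_sum_right
    by (intro sum.cong refl) (simp add: skew)
qed

text \<open>The vector is not normalised: cap and total in \<open>weighted_sum_ge\<close> are
  \<Lambda> and q multiplied by \<open>v \<bullet> v\<close>, and their ratio is the r of the
  theorem.\<close>

lemma curvature_form_lower_bound:
  assumes R: "curvature_operator R" and B: "orthonormal_basis_so B"
    and cas: "\<And>v. (\<Sum>X\<in>B. d X (d X v)) = - q *\<^sub>R v"
    and bound: "\<And>X v. X \<in> so_alg \<Longrightarrow> so_inner X X = 1 \<Longrightarrow> (norm (d X
        v))\<^sup>2 \<le> \<Lambda> * (norm v)\<^sup>2"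
  shows "\<Lambda> * eig_sum (q / \<Lambda>) R * (v \<bullet> v) \<le> v \<bullet> - (\<Sum>X\<in>B. d (R X) (d X v))"
proof -
  obtain xs where xs: "orthonormal_basis_so (set xs)" "distinct xs"
    "length xs = length (curv_eigenvalues R)" "sorted (curv_eigenvalues R)"
    and form0: "\<And>v. (\<Sum>X\<in>B. d (R X) (d X v)) = (\<Sum>k<length xs. (curv_eigenvalues R ! k)
        *\<^sub>R d (xs ! k) (d (xs ! k) v))"
    using curvature_form_eigenbasis[OF R B] by blast
  let ?nu = "\<lambda>k. curv_eigenvalues R ! k"
  define N where "N = length xs"
  define w where "w k = (norm (d (xs ! k) v))\<^sup>2" for k
  have so: "xs ! k \<in> so_alg" "so_inner (xs ! k) (xs ! k) = 1" if "k < N" for k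
    using xs(1) that by (auto simp: orthonormal_basis_so_def N_def)
  have dd: "v \<bullet> d X (d X v) = - (norm (d X v))\<^sup>2" if "X \<in> so_alg" for X
    using skew[OF that, of v "d X v"] by (simp add: power2_norm_eq_inner)
  have form: "v \<bullet> - (\<Sum>X\<in>B. d (R X) (d X v)) = (\<Sum>k<N. ?nu k * w k)"
    unfolding form0 using so by (simp add: inner_sum_right dd w_def sum_negf N_def)
  have tot: "(\<Sum>k<N. w k) = q * (v \<bullet> v)"
  proof -
    have "- q *\<^sub>R v = (\<Sum>X\<in>set xs. d X (d X v))"
      using cas[of v] sum_squares_basis_invariant[OF B xs(1)] by simp
    also have "\<dots> = (\<Sum>k<N. d (xs ! k) (d (xs ! k) v))"
      unfolding N_def by (rule sum.reindex_bij_betw[OF bij_betw_nth[OF xs(2) refl refl], symmetric])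
    finally have "v \<bullet> (\<Sum>k<N. d (xs ! k) (d (xs ! k) v)) = - q * (v \<bullet> v)"
      by (metis inner_scaleR_right)
    then show ?thesis using so by (simp add: inner_sum_right dd w_def sum_negf)
  qed
  have w: "0 \<le> w k" "k < N \<Longrightarrow> w k \<le> \<Lambda> * (v \<bullet> v)" for k
    using bound so by (auto simp: w_def power2_norm_eq_inner)
  have mono: "?nu i \<le> ?nu j" if "i \<le> j" "j < N" for i j
    using sorted_nth_mono[OF xs(4)] that xs(3) by (simp add: N_def)
  show ?thesis
  proof (cases "\<Lambda> * (v \<bullet> v) > 0")
    case True
    then have "\<Lambda> \<noteq> 0" by auto
    have "(\<Sum>k<N. w k) = q / \<Lambda> * (\<Lambda> * (v \<bullet> v))" using tot \<open>\<Lambda> \<noteq>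
        0\<close> by simp
    from weighted_sum_ge[where \<nu> = ?nu, OF mono w this True] show ?thesis
      unfolding form eig_sum_def by (simp only: ac_simps)
  next
    \<comment> \<open>The bathtub argument wants a positive cap. Without one, either the basis is
      empty, and then q = 0 or v = 0, or nonnegativity of \<open>w 0\<close> forces the cap to be 0;
      in both cases the two sides vanish.\<close>
    case False
    show ?thesis
    proof (cases "N = 0")
      case True
      then have "q * (v \<bullet> v) = 0" using tot by simp
      then have "q = 0 \<or> v = 0" by simp
      then show ?thesis using form True by (auto simp: eig_sum_def)
    next
      case N: False
      then have "0 \<le> \<Lambda> * (v \<bullet> v)" using w[of 0] by linarith
      with False have z: "\<Lambda> * (v \<bullet> v) = 0" by simp
      then have "w k = 0" if "k < N" for k using w[of k] that z by linarith
      then have "v \<bullet> - (\<Sum>X\<in>B. d (R X) (d X v)) = 0" unfolding form by simp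
      then show ?thesis using z by auto
    qed
  qed
qed

end

section \<open>The Lie algebra so(n) and its Cartan subalgebra\<close>

type_synonym 'n sqmat = "((real, 'n) vec, 'n) vec"

definition bracket :: "real^'n^'n \<Rightarrow> real^'n^'n \<Rightarrow> real^'n^'n" where
  "bracket X Y = X ** Y - Y ** X"

lemma so_alg_component: "X \<in> so_alg \<Longrightarrow> X $ j $ i = - X $ i $ j"
  unfolding so_alg_iff by blast

lemma so_algI: "(\<And>i j. X $ j $ i = - X $ i $ j) \<Longrightarrow> X \<in> so_alg"
  unfolding so_alg_iff by blast

lemma so_alg_transpose: "X \<in> so_alg \<Longrightarrow> transpose X = - X"
  by (simp add: so_alg_def)

lemma transpose_minus_matrix: "transpose (A - B) = transpose A - transpose (B :: real^'n^'m)"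
  by (simp add: transpose_def vec_eq_iff)

lemma matrix_mult_minus_right: "A ** (- B) = - (A ** (B :: real^'n^'m))"
  by (simp add: matrix_matrix_mult_def vec_eq_iff sum_negf)

lemma matrix_mult_minus_left: "(- A) ** B = - (A ** (B :: real^'n^'m))"
  by (simp add: matrix_matrix_mult_def vec_eq_iff sum_negf)

lemma bracket_in_so: "X \<in> so_alg \<Longrightarrow> Y \<in> so_alg \<Longrightarrow> bracket X Y \<in> so_alg"
  by (simp add: so_alg_def bracket_def transpose_minus_matrix matrix_transpose_mul matrix_mult_minus_left
      matrix_mult_minus_right)

lemma conj_in_so: "X \<in> so_alg \<Longrightarrow> A ** X ** transpose A \<in> so_alg"
  by (simp add: so_alg_def matrix_transpose_mul matrix_mult_minus_left
      matrix_mult_minus_right matrix_mul_assoc)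

lemma bracket_uminus: "bracket Y X = - bracket X Y"
  by (simp add: bracket_def)

lemma inner_matrix_mult_right:
  fixes A :: "real^'m^'n"
  shows "(A ** B) \<bullet> C = A \<bullet> (C ** transpose B)"
proof -
  have "(\<Sum>j\<in>UNIV. (\<Sum>k\<in>UNIV. A $ i $ k * B $ k $ j) * C $ i $ j) =
     (\<Sum>k\<in>UNIV. A $ i $ k * (\<Sum>j\<in>UNIV. C $ i $ j * B $ k $ j))" for i
    unfolding sum_distrib_left sum_distrib_right by (subst sum.swap) (simp add: ac_simps)
  then show ?thesis
    by (simp add: inner_vec_def matrix_matrix_mult_def transpose_def)
qed

lemma inner_transpose_transpose: "transpose A \<bullet> transpose B = A \<bullet> (B :: real^'n^'m)"
  unfolding inner_vec_def transpose_def by (simp add: inner_real_def) (rule sum.swap)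

lemma inner_matrix_mult_left:
  fixes A :: "real^'m^'n"
  shows "(A ** B) \<bullet> C = B \<bullet> (transpose A ** C)"
proof -
  have "(A ** B) \<bullet> C = (transpose B ** transpose A) \<bullet> transpose C"
    by (simp add: inner_transpose_transpose flip: matrix_transpose_mul)
  also have "\<dots> = transpose B \<bullet> transpose (transpose A ** C)"
    by (simp add: inner_matrix_mult_right matrix_transpose_mul)
  finally show ?thesis by (simp add: inner_transpose_transpose)
qed

text \<open>Invariance of the form, arranged so that a first order condition against all Y becomes a
  condition on \<open>bracket Z H\<close>.\<close>

lemma so_inner_bracket:
  assumes "Z \<in> so_alg" "H \<in> so_alg"
  shows "so_inner (bracket Y Z) H = so_inner Y (bracket Z H)"
proof -
  have "bracket Y Z \<bullet> H = Y \<bullet> (H ** transpose Z) - Y \<bullet> (transpose Z ** H)"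
    by (simp add: bracket_def inner_diff_left inner_matrix_mult_right[of Y Z] inner_matrix_mult_left[of Z Y])
  also have "\<dots> = Y \<bullet> bracket Z H"
    using assms by (simp add: bracket_def so_alg_transpose matrix_mult_minus_right matrix_mult_minus_left
      inner_diff_right)
  finally show ?thesis by (simp add: so_inner_eq)
qed

lemma wedge_in_so: "wedge x y \<in> so_alg"
  by (rule so_algI) (simp add: wedge_def)

lemma wedge_linear:
  "wedge (x + x') y = wedge x y + wedge x' y" "wedge x (y + y') = wedge x y + wedge x y'"
  "wedge (c *\<^sub>R x) y = c *\<^sub>R wedge x y" "wedge x (c *\<^sub>R y) = c *\<^sub>R wedge x y"
  "wedge (- x) y = - wedge x y" "wedge x (- y) = - wedge x y"
  "wedge 0 y = 0" "wedge x 0 = 0" "wedge x x = 0"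
  by (simp_all add: wedge_def vec_eq_iff algebra_simps)

lemma wedge_swap: "wedge y x = - wedge x y"
  by (simp add: wedge_def vec_eq_iff)

text \<open>so(n) acts on bivectors by derivations. Commutators with basis elements thereby reduce
  to matrix-vector products.\<close>

lemma bracket_wedge:
  assumes "Z \<in> so_alg"
  shows "bracket Z (wedge x y) = wedge (Z *v x) y + wedge x (Z *v y)"
proof -
  have "bracket Z (wedge x y) $ a $ b = (wedge (Z *v x) y + wedge x (Z *v y)) $ a $ b" for a b
  proof -
    have "(wedge x y ** Z) $ a $ b = (\<Sum>c\<in>UNIV. - (x $ a * (Z $ b $ c * y $ c)) + y $ a * (Z $ b $ c * x $ c))"
      unfolding matrix_matrix_mult_def vec_lambda_beta wedge_def
      by (rule sum.cong) (simp_all add: so_alg_component[OF assms, of _ b] algebra_simps)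
    then show ?thesis
      by (simp add: bracket_def matrix_matrix_mult_def wedge_def matrix_vector_mult_def
        sum.distrib sum_subtractf sum_negf sum_distrib_left sum_distrib_right algebra_simps)
  qed
  then show ?thesis by (simp add: vec_eq_iff)
qed

abbreviation ax :: "'n \<Rightarrow> real^'n" where "ax i \<equiv> axis i 1"

lemma wedge_axis_component:
  "wedge (ax i) (ax j) $ a $ b = (if a = i \<and> b = j then 1 else 0) - (if b = i \<and> a = j then 1 else 0)"
proof -
  have "(if P then 1 else 0) * (if Q then 1 else 0) = (if P \<and> Q then 1 else (0::real))" for P Q
    by simp
  then show ?thesis unfolding wedge_def axis_def vec_lambda_beta by simp
qed

lemma wedge_axis_mult:
  "wedge (ax i) (ax j) *v ax k = (if k = j then ax i else 0) - (if k = i then ax j else 0)"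
  unfolding vec_eq_iff matrix_vector_mult_basis column_def vec_lambda_beta wedge_axis_component
  by (auto simp: axis_def)

lemma sum_delta2:
  "(\<Sum>i\<in>UNIV. \<Sum>j\<in>UNIV. if i = a then if j = b then F i j else 0 else 0) = F a b"
  for F :: "'i::finite \<Rightarrow> 'j::finite \<Rightarrow> 'b::comm_monoid_add"
proof -
  have "(\<Sum>j\<in>UNIV. if i = a then if j = b then F i j else 0 else 0) = (if i = a then F i b else 0)" for i
    by simp
  then show ?thesis by simp
qed

lemma so_inner_wedge_axis:
  assumes "Y \<in> so_alg"
  shows "so_inner (wedge (ax i) (ax j)) Y = Y $ i $ j"
proof -
  have "wedge (ax i) (ax j) \<bullet> Y = (\<Sum>a\<in>UNIV. \<Sum>b\<in>UNIV. (if a = i then if b = j then Y $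
      a $ b else 0 else 0)
      - (if a = j then if b = i then Y $ a $ b else 0 else 0))"
    unfolding inner_vec_def by (intro sum.cong refl) (auto simp: wedge_axis_component)
  also have "\<dots> = Y $ i $ j - Y $ j $ i"
    by (simp add: sum_subtractf sum_delta2)
  finally show ?thesis using so_alg_component[OF assms, of j i] by (simp add: so_inner_eq)
qed

section \<open>The standard orthonormal basis of so(n)\<close>

definition std_basis_so :: "('n::{finite,linorder} sqmat) set" where
  "std_basis_so = (\<lambda>(i, j). wedge (ax i) (ax j)) ` {(i, j). i < j}"

lemma inj_on_wedge_axis: "inj_on (\<lambda>(i, j). wedge (ax i) (ax j)) {(i, j :: 'n::{finite,linorder}). i < j}"
proof (rule inj_onI, clarify)
  fix i j k l :: 'n assume a: "i < j" "k < l" "wedge (ax i) (ax j) = wedge (ax k) (ax l)"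
  have "wedge (ax i) (ax j) $ i $ j = 1" unfolding wedge_axis_component using a(1) by simp
  then have "wedge (ax k) (ax l) $ i $ j = 1" unfolding a(3) .
  then have *: "(if i = k \<and> j = l then 1 else 0) - (if j = k \<and> i = l then 1 else 0) = (1 :: real)"
    unfolding wedge_axis_component .
  show "i = k \<and> j = l"
  proof (rule ccontr)
    assume "\<not> (i = k \<and> j = l)"
    then have "0 - (if j = k \<and> i = l then 1 else 0) = (1 :: real)" using * by (simp only: if_False)
    then show False by (cases "j = k \<and> i = l") (simp_all only: if_True if_False, simp_all)
  qed
qed

lemma orthonormal_std_basis_so: "orthonormal_basis_so (std_basis_so :: ('n::{finite,linorder} sqmat) set)"
  unfolding orthonormal_basis_so_def
proof (intro conjI ballI)
  let ?S = "std_basis_so :: ('n::{finite,linorder} sqmat) set"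
  show sub: "?S \<subseteq> so_alg" by (auto simp: std_basis_so_def wedge_in_so)
  show "so_inner X Y = (if X = Y then 1 else 0)" if XY: "X \<in> ?S" "Y \<in> ?S" for X Y
  proof -
    from XY obtain i j k l where ij: "i < j" "k < l" "X = wedge (ax i) (ax j)" "Y = wedge (ax k) (ax l)"
      by (auto simp: std_basis_so_def)
    have "so_inner X Y = (if i = k \<and> j = l then 1 else 0)"
      unfolding ij(3,4) so_inner_wedge_axis[OF wedge_in_so] wedge_axis_component using ij(1,2) by auto
    moreover have "X = Y \<longleftrightarrow> i = k \<and> j = l"
      using inj_onD[OF inj_on_wedge_axis, of "(i, j)" "(k, l)"] ij by auto
    ultimately show ?thesis by simp
  qed
  show "span ?S = so_alg"
  proof
    show "span ?S \<subseteq> so_alg" by (intro span_minimal sub subspace_so_alg)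
    show "so_alg \<subseteq> span ?S"
    proof
      fix X assume "X \<in> (so_alg :: ('n::{finite,linorder} sqmat) set)"
      then have X: "X \<in> so_alg" .
      have w: "wedge (ax i) (ax j) \<in> span ?S" for i j :: 'n
      proof (cases i j rule: linorder_cases)
        case less
        then show ?thesis by (intro span_base) (auto simp: std_basis_so_def)
      next
        case greater
        then have "wedge (ax j) (ax i) \<in> span ?S" by (intro span_base) (auto simp: std_basis_so_def)
        then show ?thesis by (subst wedge_swap) (rule span_neg)
      qed (simp add: wedge_linear span_zero)
      have "X = (1/2) *\<^sub>R (\<Sum>i\<in>UNIV. \<Sum>j\<in>UNIV. X $ i $ j *\<^sub>R wedge (ax i) (ax j))"
          (is "X = ?R")
      proof -
        have "X $ a $ b = ?R $ a $ b" for a b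
        proof -
          have "(\<Sum>i\<in>UNIV. \<Sum>j\<in>UNIV. X $ i $ j *\<^sub>R wedge (ax i) (ax j)) $ a $ b =
            (\<Sum>i\<in>UNIV. \<Sum>j\<in>UNIV. (if i = a then if j = b then X $ i $ j else 0 else 0)
                - (if i = b then if j = a then X $ i $ j else 0 else 0))"
            unfolding sum_component vector_scaleR_component wedge_axis_component
            by (intro sum.cong refl) auto
          also have "\<dots> = X $ a $ b - X $ b $ a"
            by (simp add: sum_subtractf sum_delta2)
          finally show ?thesis using so_alg_component[OF X, of b a] by simp
        qed
        then show ?thesis unfolding vec_eq_iff by blast
      qed
      moreover have "?R \<in> span ?S" by (intro span_scale span_sum w)
      ultimately show "X \<in> span ?S" by simp
    qed
  qed
qed

section \<open>Positions of the frame vectors and the Cartan subalgebra\<close>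

lemma idx_pos_strict_mono: "i < j \<Longrightarrow> idx_pos i < idx_pos j"
  unfolding idx_pos_def by (rule psubset_card_mono) auto

lemma idx_pos_inj: "inj idx_pos"
  by (rule injI) (metis idx_pos_strict_mono linorder_cases order_less_irrefl)

lemma idx_pos_less_iff: "idx_pos i < idx_pos j \<longleftrightarrow> i < j"
  by (metis idx_pos_strict_mono linorder_cases order_less_asym order_less_irrefl)

lemma idx_pos_bij: "bij_betw idx_pos (UNIV :: 'n::{finite,linorder} set) {..<CARD('n)}"
proof -
  have "idx_pos i < CARD('n)" for i :: 'n
    unfolding idx_pos_def by (rule psubset_card_mono) auto
  then have "idx_pos ` (UNIV :: 'n set) = {..<CARD('n)}"
    by (intro card_subset_eq) (auto simp: card_image[OF idx_pos_inj])
  then show ?thesis using idx_pos_inj by (simp add: bij_betw_def)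
qed

definition ith :: "nat \<Rightarrow> 'n::{finite,linorder}" where
  "ith p = inv_into UNIV idx_pos p"

lemma ith_idx_pos [simp]: "ith (idx_pos i) = i"
  by (simp add: ith_def idx_pos_inj)

lemma idx_pos_ith: "p < CARD('n) \<Longrightarrow> idx_pos (ith p :: 'n::{finite,linorder}) = p"
  using idx_pos_bij[where 'n = 'n] by (auto simp: ith_def bij_betw_def intro!: f_inv_into_f)

lemma idx_pos_less: "idx_pos (i :: 'n::{finite,linorder}) < CARD('n)"
  using idx_pos_bij[where 'n = 'n] by (auto simp: bij_betw_def)

lemma ith_eq_iff: "p < CARD('n) \<Longrightarrow> q < CARD('n) \<Longrightarrow> (ith p ::
    'n::{finite,linorder}) = ith q \<longleftrightarrow> p = q"
  by (metis idx_pos_ith)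

lemma ith_less_iff: "p < CARD('n) \<Longrightarrow> q < CARD('n) \<Longrightarrow> (ith p ::
    'n::{finite,linorder}) < ith q \<longleftrightarrow> p < q"
  using idx_pos_less_iff[of "ith p :: 'n" "ith q"] by (simp add: idx_pos_ith)

text \<open>The unit generator of rotations in one block. Blocks are counted from 0 but weight
  coordinates from 1, hence the recurrent \<open>q + 1\<close>.\<close>

definition tor :: "nat \<Rightarrow> 'n::{finite,linorder} sqmat" where
  "tor q = wedge (ax (ith (2 * q))) (ax (ith (2 * q + 1)))"

lemma tor_in_so: "tor q \<in> so_alg" by (simp add: tor_def wedge_in_so)

lemma cartan_eq_sum:
  "(cartan \<theta> :: 'n::{finite,linorder} sqmat) = (\<Sum>q<CARD('n) div 2. \<theta> (q + 1) *\<^sub>R tor q)"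
proof -
  let ?m = "CARD('n) div 2"
  have "(cartan \<theta> :: 'n::{finite,linorder} sqmat) $ a $ b = (\<Sum>q<?m. \<theta> (q + 1) *\<^sub>R tor
      q) $ a $ b" for a b :: 'n
  proof -
    have eq: "a = ith p \<longleftrightarrow> idx_pos a = p" if "p < CARD('n)" for a :: 'n and p
      using that idx_pos_ith by auto
    have d: "(\<Sum>q<?m. if idx_pos a = 2 * q \<and> idx_pos b = 2 * q + 1 then \<theta> (q + 1) else 0) =
      (if even (idx_pos a) \<and> idx_pos b = idx_pos a + 1 then \<theta> (idx_pos a div 2 + 1) else 0)" for a b :: 'n
    proof (cases "even (idx_pos a) \<and> idx_pos b = idx_pos a + 1")
      case True
      then obtain k where k: "idx_pos a = 2 * k" by blast
      have "k < ?m" using idx_pos_less[of b] True k by simp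
      have "(\<Sum>q<?m. if idx_pos a = 2 * q \<and> idx_pos b = 2 * q + 1 then \<theta> (q + 1) else 0) =
        (\<Sum>q<?m. if q = k then \<theta> (q + 1) else 0)"
        by (rule sum.cong) (use True k in auto)
      then show ?thesis using \<open>k < ?m\<close> True k by simp
    next
      case False
      have "(\<Sum>q<?m. if idx_pos a = 2 * q \<and> idx_pos b = 2 * q + 1 then \<theta> (q + 1) else 0) = 0"
        by (rule sum.neutral) (use False in auto)
      then show ?thesis using False by (simp only: if_False)
    qed
    have "(\<Sum>q<?m. \<theta> (q + 1) *\<^sub>R tor q) $ a $ b = (\<Sum>q<?m. 
      (if idx_pos a = 2 * q \<and> idx_pos b = 2 * q + 1 then \<theta> (q + 1) else 0) -
      (if idx_pos b = 2 * q \<and> idx_pos a = 2 * q + 1 then \<theta> (q + 1) else 0))"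
      unfolding sum_component vector_scaleR_component tor_def wedge_axis_component
      by (rule sum.cong[OF refl]) (auto simp: eq)
    then show ?thesis unfolding sum_subtractf d by (auto simp: cartan_def)
  qed
  then show ?thesis unfolding vec_eq_iff by blast
qed

lemma cartan_in_so: "cartan \<theta> \<in> so_alg"
  unfolding cartan_eq_sum by (intro subspace_sum subspace_scale subspace_so_alg tor_in_so)

lemma cartan_mult_axis:
  fixes \<theta> :: "nat \<Rightarrow> real"
  defines "Z \<equiv> (cartan \<theta> :: 'n::{finite,linorder} sqmat)"
  shows "q < CARD('n) div 2 \<Longrightarrow> Z *v ax (ith (2 * q)) = - (\<theta> (q + 1) *\<^sub>R ax (ith (2
      * q + 1)))"
    and "q < CARD('n) div 2 \<Longrightarrow> Z *v ax (ith (2 * q + 1)) = \<theta> (q + 1) *\<^sub>R ax (ith (2 * q))"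
    and "odd CARD('n) \<Longrightarrow> Z *v ax (ith (2 * (CARD('n) div 2))) = 0"
proof -
  have eq: "a = ith p \<longleftrightarrow> idx_pos a = p" if "p < CARD('n)" for a :: 'n and p
    using that idx_pos_ith by auto
  have Z: "(Z *v ax b) $ a = Z $ a $ b" for a b
    by (simp add: matrix_vector_mult_basis column_def)
  have par: "even p \<Longrightarrow> 2 * q = Suc p \<Longrightarrow> False" for p q :: nat by presburger
  show "Z *v ax (ith (2 * q)) = - (\<theta> (q + 1) *\<^sub>R ax (ith (2 * q + 1)))" if q: "q < CARD('n) div 2"
    using q by (auto simp: vec_eq_iff Z) (auto simp: Z_def cartan_def axis_def eq idx_pos_ith dest: par)
  show "Z *v ax (ith (2 * q + 1)) = \<theta> (q + 1) *\<^sub>R ax (ith (2 * q))" if q: "q < CARD('n) div 2"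
    using q by (auto simp: vec_eq_iff Z) (auto simp: Z_def cartan_def axis_def eq idx_pos_ith dest: par)
  show "Z *v ax (ith (2 * (CARD('n) div 2))) = 0" if "odd CARD('n)"
  proof -
    define z where "z = 2 * (CARD('n) div 2)"
    have z: "even z" "CARD('n) = z + 1" using that by (auto simp: z_def)
    have "Z $ a $ ith z = 0" for a
    proof -
      have "idx_pos a < z + 1" using idx_pos_less[of a] z by simp
      then have "\<not> (even (idx_pos a) \<and> z = idx_pos a + 1)" "\<not> (even z \<and> idx_pos a = z + 1)"
        using z(1) par by auto
      moreover have "idx_pos (ith z :: 'n) = z" using z by (simp add: idx_pos_ith)
      ultimately show ?thesis unfolding Z_def cartan_def vec_lambda_beta by (simp only: if_False)
    qed
    then show ?thesis by (simp add: vec_eq_iff Z z_def)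
  qed
qed

lemma so_inner_cartan:
  "so_inner (cartan \<theta> :: 'n::{finite,linorder} sqmat) (cartan \<theta>') = wt_inner CARD('n) \<theta> \<theta>'"
proof -
  let ?C = "cartan \<theta>' :: 'n::{finite,linorder} sqmat"
  have lin: "linear (\<lambda>X. so_inner X ?C)" using bilinear_so_inner unfolding bilinear_def by blast
  have "so_inner (cartan \<theta>) ?C = (\<Sum>q<CARD('n) div 2. \<theta> (q + 1) * so_inner (tor q) ?C)"
    by (subst cartan_eq_sum) (simp add: linear_sum[OF lin] linear_scale[OF lin])
  also have "\<dots> = (\<Sum>q<CARD('n) div 2. \<theta> (q + 1) * \<theta>' (q + 1))"
  proof (rule sum.cong[OF refl])
    fix q assume "q \<in> {..<CARD('n) div 2}"
    then have "so_inner (tor q) ?C = \<theta>' (q + 1)"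
      unfolding tor_def so_inner_wedge_axis[OF cartan_in_so] by (simp add: cartan_def idx_pos_ith)
    then show "\<theta> (q + 1) * so_inner (tor q) ?C = \<theta> (q + 1) * \<theta>' (q + 1)" by simp
  qed
  also have "\<dots> = wt_inner CARD('n) \<theta> \<theta>'"
    unfolding wt_inner_def by (rule sum.reindex_bij_witness[of _ "\<lambda>j. j - 1" "\<lambda>q. q + 1"]) auto
  finally show ?thesis .
qed

section \<open>Exponentials of skew matrices\<close>

lemma linear_matrix_vector_real:
  fixes A :: "'f::real_normed_field^'n^'m"
  shows "linear ((*v) A)"
  by (rule linearI) (simp_all add: matrix_vector_mult_def vec_eq_iff sum.distrib algebra_simps scaleR_sum_right)

definition mat_endo :: "'f::{real_normed_field,euclidean_space}^'n^'n \<Rightarrow> ('f^'n) endo" where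
  "mat_endo A = endo_of ((*v) A)"

definition endo_mat :: "('f::{real_normed_field,euclidean_space}^'n) endo \<Rightarrow> 'f^'n^'n" where
  "endo_mat x = (\<chi> i j. endo_apply x (axis j 1) $ i)"

lemma endo_apply_mat_endo [simp]: "endo_apply (mat_endo A) v = A *v v"
  by (simp add: mat_endo_def linear_matrix_vector_real)

lemma mat_endo_mult: "mat_endo (A ** B) = mat_endo A * mat_endo B"
  by (rule endo_eqI) (simp add: matrix_vector_mul_assoc)

lemma mat_endo_one: "mat_endo (mat 1) = 1"
  by (rule endo_eqI) simp

lemma matrix_vector_mult_axis: "((A :: 'f::semiring_1^'n^'m) *v axis j 1) $ i = A $ i $ j"
proof -
  have "(\<Sum>k\<in>UNIV. A $ i $ k * (if k = j then 1 else 0)) = (\<Sum>k\<in>UNIV. if k = j then A $ i $ k else 0)"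
    by (rule sum.cong) auto
  then show ?thesis by (simp add: matrix_vector_mult_def axis_def)
qed

lemma endo_mat_mat_endo [simp]: "endo_mat (mat_endo A) = A"
  by (simp add: endo_mat_def vec_eq_iff matrix_vector_mult_axis)

text \<open>Restricted to real matrices: elements of \<open>endo\<close> are merely real linear, so
  over the complex numbers not every one of them comes from a matrix.\<close>

lemma mat_endo_endo_mat [simp]: "mat_endo (endo_mat x) = x" for x :: "(real^'n) endo"
proof (rule endo_eqI)
  fix v
  have lin: "linear (endo_apply x)"
  proof (rule linearI)
    show "endo_apply x (a + b) = endo_apply x a + endo_apply x b" for a b
      by transfer (simp add: blinfun.bilinear_simps)
    show "endo_apply x (r *\<^sub>R a) = r *\<^sub>R endo_apply x a" for a r
      by transfer (simp add: blinfun.bilinear_simps)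
  qed
  have "endo_mat x = matrix (endo_apply x)" by (simp add: endo_mat_def matrix_def)
  then show "endo_apply (mat_endo (endo_mat x)) v = endo_apply x v"
    using matrix_works[OF lin[unfolded linear_matrix_vector_mul_eq[symmetric]]] lin by (simp add: matrix_works)
qed

lemma matrix_vector_mult_scaleR: "(c *\<^sub>R A) *v v = c *\<^sub>R (A *v v)"
  for A :: "'f::real_normed_field^'n^'m"
  by (simp add: matrix_vector_mult_def vec_eq_iff scaleR_sum_right)

lemma linear_mat_endo: "linear mat_endo"
  by (rule linearI; rule endo_eqI) (simp_all add: matrix_vector_mult_add_rdistrib matrix_vector_mult_scaleR)

lemma bounded_linear_mat_endo: "bounded_linear mat_endo"
  using linear_mat_endo by (simp add: linear_conv_bounded_linear)

lemma bounded_linear_vec_lambda: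
  assumes "\<And>i. bounded_linear (f i)"
  shows "bounded_linear (\<lambda>x. \<chi> i. f i x)"
proof -
  have "\<exists>K. \<forall>x. norm (f i x) \<le> norm x * K" for i
    using bounded_linear.bounded[OF assms] .
  then obtain K where K: "\<And>i x. norm (f i x) \<le> norm x * K i" by metis
  show ?thesis
  proof (rule bounded_linear_intro[where K = "\<Sum>i\<in>UNIV. K i"])
    fix x
    have "norm (\<chi> i. f i x) \<le> (\<Sum>i\<in>UNIV. norm (f i x))"
      unfolding norm_vec_def using L2_set_le_sum[of UNIV "\<lambda>i. norm (f i x)"] by simp
    also have "\<dots> \<le> (\<Sum>i\<in>UNIV. norm x * K i)" by (intro sum_mono K)
    finally show "norm (\<chi> i. f i x) \<le> norm x * (\<Sum>i\<in>UNIV. K i)" by (simp add: sum_distrib_left)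
  qed (simp_all add: vec_eq_iff bounded_linear.linear[OF assms] linear_add linear_scale)
qed

lemma bounded_linear_endo_mat: "bounded_linear endo_mat"
  unfolding endo_mat_def
  by (intro bounded_linear_vec_lambda bounded_linear_compose[OF bounded_linear_vec_nth bounded_linear_endo_apply])

text \<open>The derivative is again a conjugate, namely of the commutator; hence the lemma can be
  iterated to get second derivatives.\<close>

lemma exp_conj_has_vector_derivative:
  fixes y z :: "'a::{real_normed_algebra_1,banach}"
  shows "((\<lambda>t. exp (t *\<^sub>R y) * z * exp (t *\<^sub>R (- y))) has_vector_derivative
    exp (t *\<^sub>R y) * (y * z - z * y) * exp (t *\<^sub>R (- y))) (at t)"
proof -
  have "((\<lambda>t. exp (t *\<^sub>R y) * z) has_vector_derivative exp (t *\<^sub>R y) * y * z) (at t)"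
    by (rule bounded_linear.has_vector_derivative[OF bounded_linear_mult_left])
      (rule exp_scaleR_has_vector_derivative_right)
  from has_vector_derivative_mult[OF this exp_scaleR_has_vector_derivative_left[of "- y" t]]
  show ?thesis by (simp add: algebra_simps)
qed

text \<open>First and second order conditions at a maximum along a conjugation orbit. Each
  derivative replaces the conjugated element by its commutator with y.\<close>

lemma exp_conj_maximum:
  fixes y z :: "'a::{real_normed_algebra_1,banach}" and \<phi> :: "'a \<Rightarrow> real"
  assumes \<phi>: "bounded_linear \<phi>"
    and max: "\<And>t. \<phi> (exp (t *\<^sub>R y) * z * exp (t *\<^sub>R (- y))) \<le> \<phi> z"
  shows "\<phi> (y * z - z * y) = 0" "\<phi> (y * (y * z - z * y) - (y * z - z * y) * y) \<le> 0"
proof -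
  define f where "f w t = \<phi> (exp (t *\<^sub>R y) * w * exp (t *\<^sub>R (- y)))" for w t
  have f': "(f w has_real_derivative f (y * w - w * y) t) (at t)" for w t
    unfolding f_def has_real_derivative_iff_has_vector_derivative
    by (rule bounded_linear.has_vector_derivative[OF \<phi> exp_conj_has_vector_derivative])
  have f0: "f w 0 = \<phi> w" for w by (simp add: f_def)
  have fmax: "f z t \<le> f z 0" for t using max by (simp add: f_def)
  have 1: "f (y * z - z * y) 0 = 0"
    using DERIV_local_max[OF f'[of z 0], of 1] fmax by simp
  then show "\<phi> (y * z - z * y) = 0" by (simp add: f0)
  show "\<phi> (y * (y * z - z * y) - (y * z - z * y) * y) \<le> 0"
  proof (rule ccontr)
    assume "\<not> ?thesis"
    then have pos: "f (y * (y * z - z * y) - (y * z - z * y) * y) 0 > 0" by (simp add: f0)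
    obtain d where d: "d > 0" "\<And>h. 0 < h \<Longrightarrow> h < d \<Longrightarrow> f (y * z - z * y) 0 < f
        (y * z - z * y) (0 + h)"
      using DERIV_pos_inc_right[OF f' pos] by blast
    \<comment> \<open>A positive second derivative makes the first derivative, which is 0 at 0,
      positive just to the right; then f would exceed its maximum.\<close>
    have "f z 0 < f z (d / 2)"
    proof (rule DERIV_pos_imp_increasing_open[of 0 "d/2"])
      show "0 < d / 2" using d by simp
      show "\<exists>l. (f z has_real_derivative l) (at x) \<and> 0 < l" if "0 < x" "x < d / 2" for x
        using f'[of z x] d(2)[of x] that 1 by auto
      show "continuous_on {0..d / 2} (f z)"
        using f' by (intro DERIV_continuous_on) (blast intro: has_field_derivative_at_within)
    qed
    with fmax show False by (meson not_less)
  qed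
qed

lemma exp_skew_inner:
  fixes y :: "'e::euclidean_space endo"
  assumes skew: "\<And>v w. endo_apply y v \<bullet> w = - (v \<bullet> endo_apply y w)"
  shows "endo_apply (exp (t *\<^sub>R y)) v \<bullet> endo_apply (exp (t *\<^sub>R y)) w = v \<bullet> w"
proof -
  define g where "g t = endo_apply (exp (t *\<^sub>R y)) v \<bullet> endo_apply (exp (t *\<^sub>R y)) w" for t
  have d: "((\<lambda>t. endo_apply (exp (t *\<^sub>R y)) v) has_vector_derivative endo_apply (y * exp (t
      *\<^sub>R y)) v) (at t)" for v t
    by (rule bounded_linear.has_vector_derivative[OF bounded_linear_endo_apply exp_scaleR_has_vector_derivative_left])
  have "(g has_vector_derivative 0) (at t)" for t
    unfolding g_def
    using bounded_bilinear.has_vector_derivative[OF bounded_bilinear_inner d[of v t] d[of w t]] skew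
    by simp
  then obtain c where "\<And>t. g t = c"
    using has_vector_derivative_zero_constant[OF convex_UNIV, of g] by auto
  then have "g t = g 0" by simp
  then show ?thesis by (simp add: g_def)
qed

lemma so_alg_inner: "X \<in> so_alg \<Longrightarrow> (X *v v) \<bullet> w = - (v \<bullet> (X *v w))"
proof -
  assume "X \<in> so_alg"
  have "v \<bullet> (X *v w) = (v v* X) \<bullet> w" by (simp add: dot_lmul_matrix)
  also have "v v* X = (- X) *v v"
    using so_alg_transpose[OF \<open>X \<in> so_alg\<close>] transpose_matrix_vector[of X v] by simp
  also have "(- X) *v v = - (X *v v)"
    by (simp add: matrix_vector_mult_def vec_eq_iff sum_negf)
  finally show ?thesis by simp
qed

lemma exp_so_in_SO:
  assumes "X \<in> so_alg"
  shows "orthogonal_matrix (endo_mat (exp (mat_endo X)))" "det (endo_mat (exp (mat_endo X))) = 1"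
proof -
  have orth: "orthogonal_matrix (endo_mat (exp (mat_endo X)))" if "X \<in> so_alg" for X :: "real^'n^'n"
  proof -
    let ?A = "endo_mat (exp (mat_endo X))"
    have A: "?A *v v = endo_apply (exp (mat_endo X)) v" for v
      by (metis endo_apply_mat_endo mat_endo_endo_mat)
    have "(?A *v v) \<bullet> (?A *v w) = v \<bullet> w" for v w
      unfolding A using exp_skew_inner[of "mat_endo X" 1 v w] so_alg_inner[OF that] by simp
    then have "orthogonal_transformation ((*v) ?A)"
      by (simp add: orthogonal_transformation_def)
    then show ?thesis by (simp add: orthogonal_transformation_matrix)
  qed
  then show "orthogonal_matrix (endo_mat (exp (mat_endo X)))" using assms .
  \<comment> \<open>The determinant is 1 because the exponential of X is the square of the
    orthogonal matrix obtained from X/2.\<close>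
  have "(1/2) *\<^sub>R X \<in> so_alg" using assms subspace_so_alg by (rule subspace_scale[rotated])
  from orth[OF this] have "det (endo_mat (exp (mat_endo ((1/2) *\<^sub>R X)))) ^ 2 = 1"
    using det_orthogonal_matrix by fastforce
  moreover have "endo_mat (exp (mat_endo X)) = endo_mat (exp (mat_endo ((1/2) *\<^sub>R X))) ** endo_mat (exp
      (mat_endo ((1/2) *\<^sub>R X)))"
  proof -
    have "mat_endo X = mat_endo ((1/2) *\<^sub>R X) + mat_endo ((1/2) *\<^sub>R X)"
      by (simp flip: linear_add[OF linear_mat_endo] scaleR_left_distrib)
    then have "exp (mat_endo X) = exp (mat_endo ((1/2) *\<^sub>R X)) * exp (mat_endo ((1/2) *\<^sub>R X))"
      using exp_add_commuting by metis
    then have "mat_endo (endo_mat (exp (mat_endo X))) = mat_endo (endo_mat (exp (mat_endo ((1/2) *\<^sub>R X)))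
        ** endo_mat (exp (mat_endo ((1/2) *\<^sub>R X))))"
      by (simp add: mat_endo_mult)
    then show ?thesis by (metis endo_mat_mat_endo)
  qed
  ultimately show "det (endo_mat (exp (mat_endo X))) = 1" by (simp add: det_mul power2_eq_square)
qed

lemma orthogonal_matrix_transpose_mult:
  "orthogonal_matrix A \<Longrightarrow> transpose A ** A = mat 1" "orthogonal_matrix A \<Longrightarrow> A **
      transpose A = mat 1"
  by (simp_all add: orthogonal_matrix_def)

lemma mat_endo_transpose_exp:
  assumes "X \<in> so_alg"
  shows "mat_endo (transpose (endo_mat (exp (mat_endo X)))) = exp (- mat_endo X)"
proof -
  let ?A = "endo_mat (exp (mat_endo X))"
  have "mat_endo (transpose ?A) * exp (mat_endo X) = 1"
    using arg_cong[OF orthogonal_matrix_transpose_mult(1)[OF exp_so_in_SO(1)[OF assms]], of mat_endo]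
    by (simp add: mat_endo_mult mat_endo_one)
  then have "mat_endo (transpose ?A) * (exp (mat_endo X) * exp (- mat_endo X)) = exp (- mat_endo X)"
    by (simp add: mult.assoc[symmetric])
  then show ?thesis by (simp add: exp_minus_inverse)
qed

lemma compact_SO: "compact {A :: real^'n^'n. orthogonal_matrix A \<and> det A = 1}"
proof -
  have c: "continuous_on UNIV (\<lambda>A :: real^'n^'n. transpose A ** A)" 
    unfolding matrix_matrix_mult_def transpose_def
    by (intro continuous_intros)
  have d: "continuous_on UNIV (det :: real^'n^'n \<Rightarrow> real)"
    unfolding det_def by (intro continuous_intros)
  have "{A :: real^'n^'n. orthogonal_matrix A \<and> det A = 1} = {A. transpose A ** A = mat 1} \<inter> {A. det A = 1}"
    by (auto simp: orthogonal_matrix)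
  moreover have "closed {A :: real^'n^'n. transpose A ** A = mat 1}" "closed {A :: real^'n^'n. det A = 1}"
    using c d by (auto intro!: closed_Collect_eq continuous_on_const)
  ultimately have "closed {A :: real^'n^'n. orthogonal_matrix A \<and> det A = 1}" by auto
  moreover have "bounded {A :: real^'n^'n. orthogonal_matrix A \<and> det A = 1}"
  proof (rule boundedI)
    fix A :: "real^'n^'n" assume "A \<in> {A. orthogonal_matrix A \<and> det A = 1}"
    then have "A \<bullet> A = mat 1 \<bullet> (mat 1 :: real^'n^'n)"
      using inner_matrix_mult_left[of A "mat 1" A] by (simp add: orthogonal_matrix_def)
    then show "norm A \<le> norm (mat 1 :: real^'n^'n)" by (simp add: norm_eq_sqrt_inner)
  qed
  ultimately show ?thesis by (simp add: compact_eq_bounded_closed)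
qed

section \<open>Conjugation into the dominant Weyl chamber\<close>

lemma linear_bracket_right: "linear (bracket X)"
  by (rule linearI) (simp_all add: bracket_def matrix_matrix_mult_def vec_eq_iff sum.distrib
    sum_distrib_left algebra_simps)

lemma linear_bracket_left: "linear (\<lambda>X. bracket X Y)"
  using linear_bracket_right[of Y] by (subst bracket_uminus) (rule linear_compose_neg)

lemma bracket_cartan_tor: "q < CARD('n) div 2 \<Longrightarrow>
    bracket (cartan \<theta> :: 'n::{finite,linorder} sqmat) (tor q) = 0"
  unfolding tor_def bracket_wedge[OF cartan_in_so] cartan_mult_axis by (simp add: wedge_linear)

lemma bracket_cartan_cartan:
  "bracket (cartan \<theta>) (cartan \<theta>' :: 'n::{finite,linorder} sqmat) = 0"
  by (subst cartan_eq_sum[of \<theta>'])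
    (simp add: linear_sum[OF linear_bracket_right] linear_scale[OF linear_bracket_right] bracket_cartan_tor)

lemma tor_eq_cartan:
  "q < CARD('n) div 2 \<Longrightarrow> (tor q :: 'n::{finite,linorder} sqmat) = cartan (eps (q + 1))"
proof -
  assume q: "q < CARD('n) div 2"
  have "(\<Sum>p<CARD('n) div 2. eps (q + 1) (p + 1) *\<^sub>R (tor p :: 'n::{finite,linorder} sqmat)) =
      (\<Sum>p<CARD('n) div 2. if p = q then tor p else 0)"
    by (rule sum.cong) (auto simp: eps_def)
  then show ?thesis using q by (simp add: cartan_eq_sum)
qed

lemma bracket_tor_tor: "p < CARD('n) div 2 \<Longrightarrow> q < CARD('n) div 2 \<Longrightarrow>
    bracket (tor p) (tor q :: 'n::{finite,linorder} sqmat) = 0"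
  by (simp add: tor_eq_cartan bracket_cartan_cartan)

lemma ith_cases:
  fixes i :: "'n::{finite,linorder}"
  obtains (even) q where "q < CARD('n) div 2" "i = ith (2 * q)"
    | (odd) q where "q < CARD('n) div 2" "i = ith (2 * q + 1)"
    | (last) "odd CARD('n)" "i = ith (2 * (CARD('n) div 2))"
proof -
  define p where "p = idx_pos i"
  have p: "i = ith p" "p < CARD('n)" by (simp_all add: p_def idx_pos_less)
  consider "even p" "p div 2 < CARD('n) div 2" | "odd p" | "even p" "\<not> p div 2 < CARD('n) div 2" by blast
  then show ?thesis
  proof cases
    case 1
    then show ?thesis using p by (intro that(1)[of "p div 2"]) auto
  next
    case 2
    then show ?thesis using p by (intro that(2)[of "p div 2"]) (auto elim!: oddE)
  next
    case 3
    then have "p = 2 * (CARD('n) div 2)" "odd CARD('n)" using p(2) by presburger+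
    then show ?thesis using p by (intro that(3)) auto
  qed
qed

text \<open>Positive and pairwise distinct coefficients make \<open>cartan h\<close> regular.
  Commuting with it gives homogeneous linear relations between the entries of each 2 x 2 block of Z;
  outside the diagonal blocks they are nondegenerate because the squares of the coefficients
  differ.\<close>

lemma cartan_centralizer:
  fixes Z :: "'n::{finite,linorder} sqmat"
  assumes Z: "Z \<in> so_alg" and com: "bracket Z (cartan h) = 0"
    and h: "\<And>q. q < CARD('n) div 2 \<Longrightarrow> h (q + 1) > 0"
    and hinj: "\<And>p q. p < CARD('n) div 2 \<Longrightarrow> q < CARD('n) div 2 \<Longrightarrow> p \<noteq>
        q \<Longrightarrow> h (p + 1) \<noteq> h (q + 1)"
  obtains \<theta> where "Z = cartan \<theta>"
proof -
  let ?m = "CARD('n) div 2"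
  let ?H = "cartan h :: 'n::{finite,linorder} sqmat"
  \<comment> \<open>The coefficients are read off the diagonal blocks of Z, so that W has zero
    diagonal blocks from the start.\<close>
  define \<theta> where "\<theta> j = Z $ ith (2 * (j - 1)) $ ith (2 * (j - 1) + 1)" for j
  define W where "W = Z - cartan \<theta>"
  have W: "W \<in> so_alg" unfolding W_def by (intro subspace_diff subspace_so_alg Z cartan_in_so)
  have "bracket W ?H = 0"
    unfolding W_def by (simp add: linear_diff[OF linear_bracket_left] com bracket_cartan_cartan)
  then have WH: "W ** ?H = ?H ** W" by (simp add: bracket_def)
  define w where "w a b = ax a \<bullet> (W *v ax b)" for a b
  have wW: "w a b = W $ a $ b" for a b
    unfolding w_def by (simp add: inner_axis' matrix_vector_mult_axis)
  have eq: "ax a \<bullet> (W *v (?H *v ax b)) = - ((?H *v ax a) \<bullet> (W *v ax b))" for a b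
    using so_alg_inner[OF cartan_in_so, of h "ax a" "W *v ax b"]
    by (simp add: matrix_vector_mul_assoc WH)
  note lin = linear_matrix_vector_real[of W]
  have c: "q < ?m \<Longrightarrow> ?H *v ax (ith (2 * q)) = - (h (q + 1) *\<^sub>R ax (ith (2 * q + 1)))"
     "q < ?m \<Longrightarrow> ?H *v ax (ith (2 * q + 1)) = h (q + 1) *\<^sub>R ax (ith (2 * q))"
     "odd CARD('n) \<Longrightarrow> ?H *v ax (ith (2 * ?m)) = 0" for q
    by (rule cartan_mult_axis; assumption)+
  let ?e = "\<lambda>q. ith (2 * q) :: 'n" and ?f = "\<lambda>q. ith (2 * q + 1) :: 'n"
  \<comment> \<open>For fixed p and q the four entries fall into two pairs, each satisfying a 2 x 2
    system with determinant \<open>(h (q + 1))\<^sup>2 - (h (p + 1))\<^sup>2\<close>.\<close>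
  have E: "h (q + 1) * w (?e p) (?e q) = h (p + 1) * w (?f p) (?f q)"
      "h (q + 1) * w (?f p) (?f q) = h (p + 1) * w (?e p) (?e q)"
      "h (q + 1) * w (?e p) (?f q) = - (h (p + 1) * w (?f p) (?e q))"
      "h (q + 1) * w (?f p) (?e q) = - (h (p + 1) * w (?e p) (?f q))"
    if "p < ?m" "q < ?m" for p q
    using eq[of "?e p" "?f q"] eq[of "?f p" "?e q"] eq[of "?e p" "?e q"] eq[of "?f p" "?f q"]
    unfolding w_def by (simp_all only: c that linear_neg[OF lin] linear_scale[OF lin])
       (simp_all add: inner_simps)
  have off: "w (?e p) (?e q) = 0" "w (?f p) (?f q) = 0" "w (?e p) (?f q) = 0" "w (?f p) (?e q) = 0"
    if pq: "p < ?m" "q < ?m" "p \<noteq> q" for p q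
  proof -
    have "h (p + 1) \<noteq> h (q + 1)" "h (p + 1) + h (q + 1) > 0" using h[OF pq(1)] h[OF pq(2)] hinj[OF pq] by auto
    then have nz: "(h (q + 1))\<^sup>2 - (h (p + 1))\<^sup>2 \<noteq> 0"
      by (simp add: power2_eq_square square_diff_square_factored)
    \<comment> \<open>The sign s distinguishes the two systems.\<close>
    have *: "x = 0 \<and> y = 0" if "h (q + 1) * x = s * (h (p + 1) * y)" "h (q + 1) * y = s * (h (p + 1) * x)"
        "s * s = 1" for x y s :: real
    proof -
      have "h (q + 1) * (h (q + 1) * x) = s * (h (p + 1) * (h (q + 1) * y))" using that(1) by simp
      also have "\<dots> = (s * s) * (h (p + 1) * (h (p + 1) * x))" using that(2) by simp
      finally have "((h (q + 1))\<^sup>2 - (h (p + 1))\<^sup>2) * x = 0" using that(3) by (simp add: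
          power2_eq_square algebra_simps)
      then have "x = 0" using nz by simp
      moreover from this have "y = 0" using that(2) h[OF pq(2)] by simp
      ultimately show ?thesis by simp
    qed
    show "w (?e p) (?e q) = 0" "w (?f p) (?f q) = 0"
      using *[of _ 1] E(1,2)[OF pq(1,2)] by auto
    show "w (?e p) (?f q) = 0" "w (?f p) (?e q) = 0"
      using *[of _ "-1"] E(3,4)[OF pq(1,2)] by auto
  qed
  \<comment> \<open>For odd n the last axis vector is unpaired; \<open>cartan h\<close> kills it,
    and the entries in its column survive only with a positive factor in front.\<close>
  have L: "w (?f p) (ith (2 * ?m)) = 0" "w (?e p) (ith (2 * ?m)) = 0" if "p < ?m" "odd CARD('n)" for p
  proof -
    have Hz: "?H *v ax (ith (2 * ?m)) = 0" by (rule c(3)[OF that(2)])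
    have "h (p + 1) * w (?f p) (ith (2 * ?m)) = 0" "h (p + 1) * w (?e p) (ith (2 * ?m)) = 0"
      using eq[of "?e p" "ith (2 * ?m)"] eq[of "?f p" "ith (2 * ?m)"]
      unfolding w_def c(1,2)[OF that(1)] Hz linear_0[OF lin] by simp_all
    then show "w (?f p) (ith (2 * ?m)) = 0" "w (?e p) (ith (2 * ?m)) = 0" using h[OF that(1)] by simp_all
  qed
  have sk: "w a b = - w b a" for a b unfolding wW by (rule so_alg_component[OF W])
  have sk0: "w a a = 0" for a using sk[of a a] by simp
  have diag: "w (?e q) (?f q) = 0" if "q < ?m" for q
  proof -
    have "W $ ?e q $ ?f q = Z $ ?e q $ ?f q - (cartan \<theta> *v ax (?f q)) $ ?e q"
      by (simp only: W_def vector_minus_component matrix_vector_mult_axis)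
    also have "(cartan \<theta> *v ax (?f q)) $ ?e q = \<theta> (q + 1)"
      unfolding cartan_mult_axis(2)[OF that] by (simp add: axis_def)
    finally show ?thesis by (simp add: wW \<theta>_def)
  qed
  have "w a b = 0" for a b
  proof (cases a rule: ith_cases)
    case (even p)
    show ?thesis
    proof (cases b rule: ith_cases)
      case (even q)
      then show ?thesis using \<open>p < ?m\<close> \<open>a = _\<close> off sk0 by (cases "p = q") auto
    next
      case (odd q)
      then show ?thesis using even off diag by (cases "p = q") auto
    next
      case last
      then show ?thesis using even L by auto
    qed
  next
    case (odd p)
    show ?thesis
    proof (cases b rule: ith_cases)
      case (even q)
      then show ?thesis using odd off diag sk[of a b] by (cases "p = q") auto
    next
      case (odd q)
      then show ?thesis using \<open>p < ?m\<close> \<open>a = _\<close> off sk0 by (cases "p = q") auto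
    next
      case last
      then show ?thesis using odd L by auto
    qed
  next
    case last
    then show ?thesis using sk[of a b] sk0 L by (cases b rule: ith_cases) auto
  qed
  then have "W = 0" by (simp add: vec_eq_iff wW)
  then show ?thesis using that W_def by simp
qed

text \<open>Maximise \<open>A \<mapsto> \<langle>AXA\<^sup>T, H\<rangle>\<close> over \<open>SO(n)\<close> for a regular dominant \<open>H\<close>: at a maximum the first
  order condition puts \<open>AXA\<^sup>T\<close> into the Cartan subalgebra and the second order condition makes it dominant.\<close>

theorem so_normal_form:
  fixes X :: "'n::{finite,linorder} sqmat"
  assumes X: "X \<in> so_alg"
  obtains A \<theta> where "orthogonal_matrix A" "det A = 1" "X = A ** cartan \<theta> ** transpose A"
    "\<And>\<alpha>. \<alpha> \<in> positive_roots CARD('n) \<Longrightarrow> 0 \<le> wt_inner CARD('n)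
        \<alpha> \<theta>"
proof -
  let ?m = "CARD('n) div 2"
  \<comment> \<open>The coefficients m, m - 1, ..., 1 are positive and strictly decreasing, hence
    regular and dominant.\<close>
  define h where "h j = real (?m + 1 - j)" for j
  let ?H = "cartan h :: 'n::{finite,linorder} sqmat"
  let ?K = "{A :: 'n::{finite,linorder} sqmat. orthogonal_matrix A \<and> det A = 1}"
  have lin: "linear (\<lambda>X. so_inner X ?H)"
    using bilinear_so_inner unfolding bilinear_def by blast
  have cont: "continuous_on ?K (\<lambda>A. so_inner (A ** X ** transpose A) ?H)"
    unfolding so_inner_eq matrix_matrix_mult_def transpose_def by (intro continuous_intros) auto
  have "mat 1 \<in> ?K" by (simp add: orthogonal_matrix_id)
  then have "?K \<noteq> {}" by blast
  then have "\<exists>A\<in>?K. \<forall>B\<in>?K. so_inner (B ** X ** transpose B) ?H \<le> so_inner (A ** X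
      ** transpose A) ?H"
    by (rule continuous_attains_sup[OF compact_SO _ cont])
  then obtain A where A: "A \<in> ?K"
    and Amax: "\<And>B. B \<in> ?K \<Longrightarrow> so_inner (B ** X ** transpose B) ?H \<le> so_inner (A ** X
        ** transpose A) ?H"
    by blast
  define Z where "Z = A ** X ** transpose A"
  have Z: "Z \<in> so_alg" unfolding Z_def by (rule conj_in_so[OF X])
  have orders: "so_inner (bracket Y Z) ?H = 0" "so_inner (bracket Y (bracket Y Z)) ?H \<le> 0"
    if Y: "Y \<in> so_alg" for Y
  proof -
    define \<phi> where "\<phi> x = so_inner (endo_mat x) ?H" for x
    have \<phi>: "bounded_linear \<phi>"
      unfolding \<phi>_def
      using bounded_linear_compose[OF _ bounded_linear_endo_mat] lin[unfolded linear_conv_bounded_linear] by blast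
    have "\<phi> (exp (t *\<^sub>R mat_endo Y) * mat_endo Z * exp (t *\<^sub>R (- mat_endo Y))) \<le> \<phi>
        (mat_endo Z)" for t
    proof -
      have tY: "t *\<^sub>R Y \<in> so_alg" by (rule subspace_scale[OF subspace_so_alg Y])
      define U where "U = endo_mat (exp (mat_endo (t *\<^sub>R Y)))"
      have U: "orthogonal_matrix U" "det U = 1" using exp_so_in_SO[OF tY] by (simp_all add: U_def)
      have "U ** A \<in> ?K" using A U by (simp add: orthogonal_matrix_mul det_mul)
      from Amax[OF this] have "so_inner (U ** Z ** transpose U) ?H \<le> so_inner Z ?H"
        by (simp add: Z_def matrix_transpose_mul matrix_mul_assoc)
      moreover have eq: "mat_endo (U ** Z ** transpose U) = exp (t *\<^sub>R mat_endo Y) * mat_endo Z * exp (t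
          *\<^sub>R (- mat_endo Y))"
        using mat_endo_transpose_exp[OF tY] by (simp add: mat_endo_mult U_def linear_scale[OF linear_mat_endo])
      ultimately show ?thesis unfolding \<phi>_def eq[symmetric] by simp
    qed
    note * = exp_conj_maximum[OF \<phi> this]
    have br: "mat_endo P * mat_endo Q - mat_endo Q * mat_endo P = mat_endo (bracket P Q)" for P Q ::
        "'n::{finite,linorder} sqmat"
      by (simp add: bracket_def linear_diff[OF linear_mat_endo] mat_endo_mult)
    show "so_inner (bracket Y Z) ?H = 0" "so_inner (bracket Y (bracket Y Z)) ?H \<le> 0"
      using * unfolding br by (simp_all add: \<phi>_def)
  qed
  \<comment> \<open>Taking \<open>bracket Z ?H\<close> itself as Y turns the first order condition
    into the vanishing of its length.\<close>
  have "so_inner (bracket Z ?H) (bracket Z ?H) = 0"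
    using orders(1)[OF bracket_in_so[OF Z cartan_in_so]] so_inner_bracket[OF Z cartan_in_so] by metis
  then have "bracket Z ?H = 0" by (simp add: so_inner_eq)
  then obtain \<theta> where \<theta>: "Z = cartan \<theta>"
    by (rule cartan_centralizer[OF Z]) (auto simp: h_def)
  \<comment> \<open>Moving one bracket across the invariant form makes the second order condition a
    statement about the two images of Y under bracketing with Z and with H.\<close>
  have second: "so_inner (bracket Z Y) (bracket ?H Y) \<ge> 0" if Y: "Y \<in> so_alg" for Y
  proof -
    have "so_inner (bracket Y (bracket Y Z)) ?H = - so_inner (bracket (bracket Y Z) Y) ?H"
      by (subst bracket_uminus) (simp add: so_inner_eq)
    also have "\<dots> = - so_inner (bracket Y Z) (bracket Y ?H)"
      by (simp add: so_inner_bracket[OF Y cartan_in_so])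
    also have "\<dots> = - so_inner (bracket Z Y) (bracket ?H Y)"
      by (subst (1 2) bracket_uminus) (simp add: so_inner_eq)
    finally show ?thesis using orders(2)[OF Y] by simp
  qed
  let ?e = "\<lambda>q. ith (2 * q) :: 'n" and ?f = "\<lambda>q. ith (2 * q + 1) :: 'n"
  have pair: "\<theta> (p + 1) - s * \<theta> (q + 1) \<ge> 0" if pq: "p < q" "q < ?m" and s: "s = 1 \<or> s =
      -1" for p q s
  proof -
    \<comment> \<open>Y and W are real root vectors for the root taking \<tau> to \<tau>(p+1) - s
      \<tau>(q+1): every Cartan element sends Y to that value times s W. The second order condition
      then says that \<theta> and h do not have opposite signs on this root.\<close>
    define Y where "Y = wedge (ax (?e p)) (ax (?e q)) + s *\<^sub>R wedge (ax (?f p)) (ax (?f q))"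
    define W where "W = wedge (ax (?e p)) (ax (?f q)) - s *\<^sub>R wedge (ax (?f p)) (ax (?e q))"
    have Y: "Y \<in> so_alg" unfolding Y_def by (intro subspace_add subspace_scale subspace_so_alg wedge_in_so)
    have "p < ?m" using pq by simp
    have ss: "s * s = 1" using s by auto
    have br: "bracket (cartan \<tau>) Y = (s * \<tau> (p + 1) - \<tau> (q + 1)) *\<^sub>R W" for \<tau>
    proof -
      have "bracket (cartan \<tau>) Y = - (\<tau> (p + 1) *\<^sub>R wedge (ax (?f p)) (ax (?e q))) - \<tau> (q
          + 1) *\<^sub>R wedge (ax (?e p)) (ax (?f q))
         + s *\<^sub>R (\<tau> (p + 1) *\<^sub>R wedge (ax (?e p)) (ax (?f q)) + \<tau> (q + 1) *\<^sub>R wedge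
             (ax (?f p)) (ax (?e q)))"
        unfolding Y_def linear_add[OF linear_bracket_right] linear_scale[OF linear_bracket_right]
          bracket_wedge[OF cartan_in_so] cartan_mult_axis(1,2)[OF \<open>p < ?m\<close>]
              cartan_mult_axis(1,2)[OF \<open>q < ?m\<close>] wedge_linear by simp
      also have "\<dots> = (s * \<tau> (p + 1) - \<tau> (q + 1)) *\<^sub>R wedge (ax (?e p)) (ax (?f q))
          - ((s * s) * \<tau> (p + 1) - s * \<tau> (q + 1)) *\<^sub>R wedge (ax (?f p)) (ax (?e q))"
        unfolding ss by (simp add: algebra_simps)
      also have "\<dots> = (s * \<tau> (p + 1) - \<tau> (q + 1)) *\<^sub>R W"
        unfolding W_def by (simp add: algebra_simps)
      finally show ?thesis .
    qed
    have "W $ ?e p $ ?f q = 1"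
      unfolding W_def using pq by (simp add: wedge_axis_component ith_eq_iff)
    then have "W \<bullet> W > 0" by auto
    have "(s * \<theta> (p + 1) - \<theta> (q + 1)) * (s * h (p + 1) - h (q + 1)) * (W \<bullet> W) \<ge> 0"
      using second[OF Y] unfolding \<theta> br by (simp add: so_inner_eq ac_simps)
    then have "(s * \<theta> (p + 1) - \<theta> (q + 1)) * (s * h (p + 1) - h (q + 1)) \<ge> 0"
      using \<open>W \<bullet> W > 0\<close> by (simp add: zero_le_mult_iff)
    also have "(s * \<theta> (p + 1) - \<theta> (q + 1)) * (s * h (p + 1) - h (q + 1)) = (\<theta> (p + 1) - s
        * \<theta> (q + 1)) * (h (p + 1) - s * h (q + 1))"
      using s by (auto simp: algebra_simps)
    finally have "(\<theta> (p + 1) - s * \<theta> (q + 1)) * (h (p + 1) - s * h (q + 1)) \<ge> 0" .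
    moreover have "h (p + 1) - s * h (q + 1) > 0" using s pq by (auto simp: h_def)
    ultimately show ?thesis by (simp add: zero_le_mult_iff)
  qed
  have single: "\<theta> (p + 1) \<ge> 0" if p: "p < ?m" and odd: "odd CARD('n)" for p
  proof -
    \<comment> \<open>The short roots of odd n: the second wedge factor is the unpaired axis vector,
      which all Cartan elements kill.\<close>
    define Y where "Y = wedge (ax (?e p)) (ax (?e ?m))"
    define W where "W = wedge (ax (?f p)) (ax (?e ?m))"
    have Y: "Y \<in> so_alg" unfolding Y_def by (rule wedge_in_so)
    have m: "2 * ?m < CARD('n)" using odd by presburger
    have br: "bracket (cartan \<tau>) Y = - (\<tau> (p + 1) *\<^sub>R W)" for \<tau>
      unfolding Y_def W_def bracket_wedge[OF cartan_in_so] cartan_mult_axis(1)[OF p] cartan_mult_axis(3)[OF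
          odd] wedge_linear
      by simp
    have "W $ ?f p $ ?e ?m = 1"
      unfolding W_def using p m by (simp add: wedge_axis_component ith_eq_iff)
    then have "W \<bullet> W > 0" by auto
    have "\<theta> (p + 1) * h (p + 1) * (W \<bullet> W) \<ge> 0"
      using second[OF Y] unfolding \<theta> br by (simp add: so_inner_eq ac_simps)
    then have "\<theta> (p + 1) * h (p + 1) \<ge> 0"
      using \<open>W \<bullet> W > 0\<close> by (simp add: zero_le_mult_iff)
    moreover have "h (p + 1) > 0" using p by (simp add: h_def)
    ultimately show ?thesis by (simp add: zero_le_mult_iff)
  qed
  have dom: "0 \<le> wt_inner CARD('n) \<alpha> \<theta>" if \<alpha>: "\<alpha> \<in> positive_roots CARD('n)"
      for \<alpha>
  proof -
    have e: "wt_inner CARD('n) (eps i) \<theta> = \<theta> i" if "1 \<le> i" "i \<le> ?m" for i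
    proof -
      have "wt_inner CARD('n) (eps i) \<theta> = (\<Sum>j=1..?m. if j = i then \<theta> j else 0)"
        unfolding wt_inner_def eps_def by (rule sum.cong) auto
      then show ?thesis using that by simp
    qed
    have ea: "wt_inner CARD('n) (\<lambda>k. eps i k + eps j k) \<theta> = wt_inner CARD('n) (eps i) \<theta> +
        wt_inner CARD('n) (eps j) \<theta>"
      "wt_inner CARD('n) (\<lambda>k. eps i k - eps j k) \<theta> = wt_inner CARD('n) (eps i) \<theta> -
          wt_inner CARD('n) (eps j) \<theta>" for i j
      by (simp_all add: wt_inner_def algebra_simps sum.distrib sum_subtractf)
    from \<alpha> consider i j where "1 \<le> i" "i < j" "j \<le> ?m" "\<alpha> = (\<lambda>k. eps i k + eps j
        k) \<or> \<alpha> = (\<lambda>k. eps i k - eps j k)"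
      | i where "odd CARD('n)" "1 \<le> i" "i \<le> ?m" "\<alpha> = eps i"
      unfolding positive_roots_def by blast
    then show ?thesis
    proof cases
      case 1
      then have "\<theta> i + \<theta> j \<ge> 0" "\<theta> i - \<theta> j \<ge> 0"
        using pair[of "i - 1" "j - 1" "-1"] pair[of "i - 1" "j - 1" 1] by auto
      then show ?thesis using 1 by (auto simp: ea e)
    next
      case 2
      then show ?thesis using single[of "i - 1"] by (simp add: e)
    qed
  qed
  have oA: "orthogonal_matrix A" "det A = 1" using A by auto
  \<comment> \<open>The maximiser conjugates X into the Cartan subalgebra, so its transpose is the
    witness.\<close>
  have "X = transpose A ** cartan \<theta> ** transpose (transpose A)"
  proof -
    have "transpose A ** Z ** A = (transpose A ** A) ** X ** (transpose A ** A)"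
      by (simp add: Z_def matrix_mul_assoc)
    then show ?thesis using orthogonal_matrix_transpose_mult(1)[OF oA(1)] by (simp add: \<theta>)
  qed
  moreover have "orthogonal_matrix (transpose A)" using oA by (simp add: orthogonal_matrix_transpose)
  moreover have "det (transpose A) = 1" using oA by simp
  ultimately show ?thesis using dom that by blast
qed

section \<open>The differential of a representation\<close>

lemma exp_intertwine:
  fixes g x y :: "'a::{real_normed_algebra_1,banach}"
  assumes "g * x = y * g"
  shows "g * exp x = exp y * g"
proof -
  have p: "g * x ^ n = y ^ n * g" for n
  proof (induction n)
    case (Suc n)
    have "g * x ^ Suc n = (g * x) * x ^ n" by (simp add: mult.assoc)
    also have "\<dots> = y * (g * x ^ n)" by (simp add: assms mult.assoc)
    also have "\<dots> = y ^ Suc n * g" by (simp add: Suc mult.assoc)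
    finally show ?case .
  qed simp
  have "g * exp x = (\<Sum>n. g * (x ^ n /\<^sub>R fact n))"
    unfolding exp_def by (rule suminf_mult[OF summable_exp_generic, symmetric])
  also have "\<dots> = (\<Sum>n. (y ^ n /\<^sub>R fact n) * g)" by (simp add: p)
  also have "\<dots> = exp y * g"
    unfolding exp_def by (rule suminf_mult2[OF summable_exp_generic, symmetric])
  finally show ?thesis .
qed

lemma exp_scaleR_has_vector_derivative_0:
  fixes x :: "'a::{real_normed_algebra_1,banach}"
  shows "((\<lambda>t. exp (t *\<^sub>R x)) has_vector_derivative x) (at 0)"
  using exp_scaleR_has_vector_derivative_left[of x 0] by simp

lemma exp_scaleR_inject:
  fixes x y :: "'a::{real_normed_algebra_1,banach}"
  assumes "\<And>t. exp (t *\<^sub>R x) = exp (t *\<^sub>R y)"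
  shows "x = y"
  using vector_derivative_unique_at[OF exp_scaleR_has_vector_derivative_0[of x]]
    exp_scaleR_has_vector_derivative_0[of y] assms by simp

lemma mat_endo_inject: "mat_endo A = mat_endo B \<Longrightarrow> A = B"
  by (metis endo_mat_mat_endo)

text \<open>The ambient algebras of \<open>SO(n)\<close> and \<open>Spin(n)\<close> are no instances of an algebra class; \<open>L\<close> moves the
  group into a Banach algebra, where the exponential series of the library is available.\<close>

locale rot_group =
  fixes G :: "'g::real_normed_vector monoid"
    and \<iota> :: "'n::{finite,linorder} sqmat \<Rightarrow> 'g"
    and L :: "'g \<Rightarrow> 'a::{real_normed_algebra_1,banach}" and M :: "'a \<Rightarrow> 'g"
    and \<sigma> :: "'a \<Rightarrow> 'n::{finite,linorder} sqmat"
  assumes linear_iota: "linear \<iota>"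
    and bl_L: "bounded_linear L" and bl_M: "bounded_linear M" and bl_sig: "bounded_linear \<sigma>"
    and M_L [simp]: "M (L x) = x"
    and sig_L: "X \<in> so_alg \<Longrightarrow> \<sigma> (L (\<iota> X)) = X"
    and L_mult: "L (x \<otimes>\<^bsub>G\<^esub> y) = L x * L y" and L_one: "L \<one>\<^bsub>G\<^esub> = 1"
    and one_mem: "\<one>\<^bsub>G\<^esub> \<in> carrier G"
    and mult_mem: "g \<in> carrier G \<Longrightarrow> h \<in> carrier G \<Longrightarrow> g
        \<otimes>\<^bsub>G\<^esub> h \<in> carrier G"
    and inv_mem: "g \<in> carrier G \<Longrightarrow> \<exists>h\<in>carrier G. g \<otimes>\<^bsub>G\<^esub> h
        = \<one>\<^bsub>G\<^esub> \<and> h \<otimes>\<^bsub>G\<^esub> g = \<one>\<^bsub>G\<^esub>"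
    and L_bracket: "X \<in> so_alg \<Longrightarrow> Y \<in> so_alg \<Longrightarrow>
      L (\<iota> X) * L (\<iota> Y) - L (\<iota> Y) * L (\<iota> X) = L (\<iota> (bracket X Y))"
    and exp_mem: "X \<in> so_alg \<Longrightarrow> \<exists>g\<in>carrier G. L g = exp (L (\<iota> X))"
    and Ad_mem: "g \<in> carrier G \<Longrightarrow> \<exists>A. orthogonal_matrix A \<and>
      (\<forall>X\<in>so_alg. L g * L (\<iota> X) = L (\<iota> (A ** X ** transpose A)) * L g)"
    and Ad_surj: "orthogonal_matrix A \<Longrightarrow> det A = 1 \<Longrightarrow>
      \<exists>g\<in>carrier G. \<forall>X\<in>so_alg. L g * L (\<iota> X) = L (\<iota> (A ** X ** transpose A)) * L g"
begin

lemma L_inject: "L x = L y \<Longrightarrow> x = y" by (metis M_L)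

lemma L_pow: "L (x [^]\<^bsub>G\<^esub> (k::nat)) = L x ^ k"
  by (induction k) (simp_all add: L_mult L_one power_commutes)

text \<open>The series of \<open>exp_in\<close> converges because its image under \<open>L\<close>
  is the exponential series and the bounded left inverse \<open>M\<close> carries the limit
  back.\<close>

lemma exp_in_eq: "exp_in G x = M (exp (L x))" and L_exp_in: "L (exp_in G x) = exp (L x)"
proof -
  have "(\<lambda>k. (L x ^ k) /\<^sub>R fact k) sums exp (L x)"
    unfolding exp_def by (rule summable_sums[OF summable_exp_generic])
  then have s: "(\<lambda>k. L ((x [^]\<^bsub>G\<^esub> k) /\<^sub>R fact k)) sums exp (L x)"
    by (simp add: L_pow linear_scale[OF bounded_linear.linear[OF bl_L]])
  have s': "(\<lambda>k. (x [^]\<^bsub>G\<^esub> k) /\<^sub>R fact k) sums M (exp (L x))"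
    using bounded_linear.sums[OF bl_M s] by simp
  show 1: "exp_in G x = M (exp (L x))"
    unfolding exp_in_def by (rule sums_unique[OF s', symmetric])
  show "L (exp_in G x) = exp (L x)"
    unfolding 1 using bounded_linear.sums[OF bl_L s'] s sums_unique2 by blast
qed

lemma L_scale: "L (c *\<^sub>R x) = c *\<^sub>R L x"
  by (simp add: linear_scale[OF bounded_linear.linear[OF bl_L]])

lemma L_add: "L (x + y) = L x + L y"
  by (simp add: linear_add[OF bounded_linear.linear[OF bl_L]])

lemma iota_scale: "\<iota> (c *\<^sub>R X) = c *\<^sub>R \<iota> X" by (rule linear_scale[OF linear_iota])

lemma exp_in_mem:
  assumes "X \<in> so_alg"
  shows "exp_in G (t *\<^sub>R \<iota> X) \<in> carrier G"
proof -
  have "t *\<^sub>R X \<in> so_alg" by (rule subspace_scale[OF subspace_so_alg assms])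
  from exp_mem[OF this] obtain g where "g \<in> carrier G" "L g = exp (L (t *\<^sub>R \<iota> X))"
    by (auto simp: iota_scale)
  then have "g = exp_in G (t *\<^sub>R \<iota> X)" by (intro L_inject) (simp add: L_exp_in)
  with \<open>g \<in> carrier G\<close> show ?thesis by simp
qed

lemma exp_in_add: "exp_in G ((s + t) *\<^sub>R x) = exp_in G (s *\<^sub>R x) \<otimes>\<^bsub>G\<^esub> exp_in
    G (t *\<^sub>R x)"
proof (rule L_inject)
  have "exp (s *\<^sub>R L x + t *\<^sub>R L x) = exp (s *\<^sub>R L x) * exp (t *\<^sub>R L x)"
    by (rule exp_add_commuting) simp
  then show "L (exp_in G ((s + t) *\<^sub>R x)) = L (exp_in G (s *\<^sub>R x) \<otimes>\<^bsub>G\<^esub> exp_in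
      G (t *\<^sub>R x))"
    by (simp add: L_exp_in L_mult L_scale L_add scaleR_add_left)
qed

lemma exp_in_0: "exp_in G 0 = \<one>\<^bsub>G\<^esub>"
  by (rule L_inject) (simp add: L_exp_in L_one linear_0[OF bounded_linear.linear[OF bl_L]])

lemma continuous_exp_in: "continuous_on UNIV (\<lambda>t. exp_in G (t *\<^sub>R x))"
proof -
  have "continuous_on UNIV (\<lambda>t. exp (t *\<^sub>R L x))"
    by (intro continuous_at_imp_continuous_on ballI)
      (rule has_vector_derivative_continuous[OF exp_scaleR_has_vector_derivative_left])
  then show ?thesis
    unfolding exp_in_eq L_scale
    by (rule bounded_linear.continuous_on[OF bl_M])
qed

end

section \<open>The differential as a homomorphism of Lie algebras\<close>

locale rot_rep = rot_group G \<iota> L M \<sigma>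
  for G :: "'g::real_normed_vector monoid"
    and \<iota> :: "'n::{finite,linorder} sqmat \<Rightarrow> 'g"
    and L :: "'g \<Rightarrow> 'a::{real_normed_algebra_1,banach}" and M and \<sigma> +
  fixes \<pi> :: "'g \<Rightarrow> 'f::{real_normed_field,euclidean_space}^'k^'k"
  assumes pi_mult: "g \<in> carrier G \<Longrightarrow> h \<in> carrier G \<Longrightarrow> \<pi> (g
      \<otimes>\<^bsub>G\<^esub> h) = \<pi> g ** \<pi> h"
    and pi_one: "\<pi> \<one>\<^bsub>G\<^esub> = mat 1"
    and pi_cont: "continuous_on (carrier G) \<pi>"
begin

abbreviation "D \<equiv> drep G \<iota> \<pi>"
abbreviation "DE X \<equiv> mat_endo (D X)"

text \<open>Continuity of the representation suffices: along a one-parameter subgroup it is an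
  exponential by \<open>continuous_one_param_group\<close>, so the derivative taken by
  \<open>drep\<close> exists.\<close>

lemma
  assumes X: "X \<in> so_alg"
  shows drep_has_vector_derivative: "((\<lambda>t. \<pi> (exp_in G (t *\<^sub>R \<iota> X)))
      has_vector_derivative D X) (at 0)"
    and rep_exp: "mat_endo (\<pi> (exp_in G (t *\<^sub>R \<iota> X))) = exp (t *\<^sub>R DE X)"
proof -
  define P where "P t = mat_endo (\<pi> (exp_in G (t *\<^sub>R \<iota> X)))" for t
  have "continuous_on UNIV (\<lambda>t. \<pi> (exp_in G (t *\<^sub>R \<iota> X)))"
    by (rule continuous_on_compose2[OF pi_cont continuous_exp_in]) (use exp_in_mem[OF X] in auto)
  then have "continuous_on UNIV P" unfolding P_def
    by (rule bounded_linear.continuous_on[OF bounded_linear_mat_endo])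
  moreover have "P (s + t) = P s * P t" for s t
    by (simp add: P_def exp_in_add pi_mult exp_in_mem[OF X] mat_endo_mult)
  moreover have "P 0 = 1" by (simp add: P_def exp_in_0 pi_one mat_endo_one)
  ultimately obtain Z where Z: "\<And>t. P t = exp (t *\<^sub>R Z)"
    by (rule continuous_one_param_group) blast
  have dP: "(P has_vector_derivative Z) (at 0)"
    using exp_scaleR_has_vector_derivative_0[of Z] by (simp add: Z[abs_def])
  have "((\<lambda>t. endo_mat (P t)) has_vector_derivative endo_mat Z) (at 0)"
    by (rule bounded_linear.has_vector_derivative[OF bounded_linear_endo_mat dP])
  then have d: "((\<lambda>t. \<pi> (exp_in G (t *\<^sub>R \<iota> X))) has_vector_derivative endo_mat Z) (at 0)"
    by (simp add: P_def)
  then have D: "D X = endo_mat Z" by (simp add: drep_def vector_derivative_at)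
  with d show "((\<lambda>t. \<pi> (exp_in G (t *\<^sub>R \<iota> X))) has_vector_derivative D X) (at 0)" by simp
  \<comment> \<open>The generator Z is so far an element of \<open>endo\<close> and might fail to be
    complex linear. Being the derivative of matrices, it is itself one.\<close>
  have "(P has_vector_derivative mat_endo (endo_mat Z)) (at 0)"
    unfolding P_def by (rule bounded_linear.has_vector_derivative[OF bounded_linear_mat_endo d])
  then have "mat_endo (endo_mat Z) = Z" using dP vector_derivative_unique_at by blast
  then show "mat_endo (\<pi> (exp_in G (t *\<^sub>R \<iota> X))) = exp (t *\<^sub>R DE X)"
    using Z[of t] by (simp add: P_def D)
qed

lemma drep_scale:
  assumes X: "X \<in> so_alg"
  shows "D (c *\<^sub>R X) = c *\<^sub>R D X"
proof (rule mat_endo_inject, rule exp_scaleR_inject)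
  fix t
  have "c *\<^sub>R X \<in> so_alg" by (rule subspace_scale[OF subspace_so_alg X])
  from rep_exp[OF this, of t] rep_exp[OF X, of "t * c"]
  show "exp (t *\<^sub>R DE (c *\<^sub>R X)) = exp (t *\<^sub>R mat_endo (c *\<^sub>R D X))"
    by (simp add: iota_scale linear_scale[OF linear_mat_endo])
qed

text \<open>Trotter's formula is applied twice, to the one-parameter subgroups in the group and to
  their images, and continuity of \<pi> identifies the two limits.\<close>

lemma exp_DE_add:
  assumes X: "X \<in> so_alg" and Y: "Y \<in> so_alg"
  shows "exp (DE (X + Y)) = exp (DE X + DE Y)"
proof -
  have XY: "X + Y \<in> so_alg" by (rule subspace_add[OF subspace_so_alg X Y])
  have prod_deriv: "((\<lambda>t. exp (t *\<^sub>R x) * exp (t *\<^sub>R y)) has_vector_derivative x + y) (at 0)"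
    for x y :: "'b::{real_normed_algebra_1,banach}"
    using has_vector_derivative_mult[OF exp_scaleR_has_vector_derivative_0[of x]
        exp_scaleR_has_vector_derivative_0[of y]]
    by (simp add: add.commute)
  define g where "g n = exp_in G ((1 / real (Suc n)) *\<^sub>R \<iota> X) \<otimes>\<^bsub>G\<^esub> exp_in G
      ((1 / real (Suc n)) *\<^sub>R \<iota> Y)" for n
  have g: "g n \<in> carrier G" for n unfolding g_def by (intro mult_mem exp_in_mem X Y)
  have gp: "g n [^]\<^bsub>G\<^esub> k \<in> carrier G" for n and k :: nat
    by (induction k) (simp_all add: one_mem mult_mem g)
  have pip: "mat_endo (\<pi> (g n [^]\<^bsub>G\<^esub> k)) = mat_endo (\<pi> (g n)) ^ k" for n and k :: nat
    by (induction k) (simp_all add: pi_one mat_endo_one pi_mult gp g mat_endo_mult power_commutes)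
  have "(\<lambda>n. (exp ((1 / real (Suc n)) *\<^sub>R L (\<iota> X)) * exp ((1 / real (Suc n)) *\<^sub>R L
      (\<iota> Y))) ^ Suc n)
      \<longlonglongrightarrow> exp (L (\<iota> X) + L (\<iota> Y))"
    by (rule power_inverse_nat_tendsto_exp[OF prod_deriv]) simp
  then have "(\<lambda>n. L (g n [^]\<^bsub>G\<^esub> Suc n)) \<longlonglongrightarrow> exp (L (\<iota> (X + Y)))"
    by (simp only: L_pow g_def L_mult L_exp_in L_scale linear_add[OF linear_iota] L_add)
  from bounded_linear.tendsto[OF bl_M this]
  have lim: "(\<lambda>n. g n [^]\<^bsub>G\<^esub> Suc n) \<longlonglongrightarrow> exp_in G (\<iota> (X + Y))"
    by (simp only: M_L exp_in_eq)
  \<comment> \<open>Continuity is available on the carrier only, so the limit has to be placed there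
    first.\<close>
  have mem: "exp_in G (\<iota> (X + Y)) \<in> carrier G" using exp_in_mem[OF XY, of 1] by simp
  have "(\<lambda>n. \<pi> (g n [^]\<^bsub>G\<^esub> Suc n)) \<longlonglongrightarrow> \<pi> (exp_in G (\<iota>
      (X + Y)))"
    by (rule continuous_on_tendsto_compose[OF pi_cont lim mem]) (simp add: gp del: nat_pow_Suc)
  from bounded_linear.tendsto[OF bounded_linear_mat_endo this]
  have lim1: "(\<lambda>n. mat_endo (\<pi> (g n)) ^ Suc n) \<longlonglongrightarrow> exp (DE (X + Y))"
    using rep_exp[OF XY, of 1] by (simp only: pip scaleR_one)
  have eq: "mat_endo (\<pi> (g n)) = exp ((1 / real (Suc n)) *\<^sub>R DE X) * exp ((1 / real (Suc n))
      *\<^sub>R DE Y)" for n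
    unfolding g_def by (simp only: pi_mult exp_in_mem X Y mat_endo_mult rep_exp)
  have lim2: "(\<lambda>n. (exp ((1 / real (Suc n)) *\<^sub>R DE X) * exp ((1 / real (Suc n)) *\<^sub>R DE Y)) ^ Suc n)
      \<longlonglongrightarrow> exp (DE X + DE Y)"
    by (rule power_inverse_nat_tendsto_exp[OF prod_deriv]) simp
  show ?thesis by (rule LIMSEQ_unique[OF lim1[unfolded eq] lim2])
qed

lemma drep_add:
  assumes X: "X \<in> so_alg" and Y: "Y \<in> so_alg"
  shows "D (X + Y) = D X + D Y"
proof (rule mat_endo_inject, rule exp_scaleR_inject)
  fix t
  have "t *\<^sub>R X \<in> so_alg" "t *\<^sub>R Y \<in> so_alg" by (intro subspace_scale[OF subspace_so_alg] X Y)+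
  from exp_DE_add[OF this] have "exp (DE (t *\<^sub>R (X + Y))) = exp (DE (t *\<^sub>R X) + DE (t *\<^sub>R Y))"
    by (simp only: scaleR_add_right)
  then show "exp (t *\<^sub>R DE (X + Y)) = exp (t *\<^sub>R mat_endo (D X + D Y))"
    unfolding drep_scale[OF X] drep_scale[OF Y] drep_scale[OF subspace_add[OF subspace_so_alg X Y]]
      linear_scale[OF linear_mat_endo] linear_add[OF linear_mat_endo] scaleR_add_right[of t "DE X"] .
qed

lemma linear_drep: "linear (D \<circ> skew_part)"
  by (rule linear_comp_skew_part) (simp_all add: drep_add drep_scale)

lemma skew_actionI:
  assumes "\<And>X v w. X \<in> so_alg \<Longrightarrow> (D X *v v) \<bullet> w = - (v \<bullet> (D X *v w))"
  shows "skew_action (\<lambda>X v. D X *v v)"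
  by (rule skew_action.intro) (simp_all add: assms drep_add drep_scale matrix_vector_mult_add_rdistrib
    matrix_vector_mult_scaleR linear_matrix_vector_real)

text \<open>Conjugating a one-parameter subgroup by g gives the one-parameter subgroup of the
  conjugated generator; the claim is the derivative at 0 of the image of this identity.\<close>

lemma drep_Ad:
  assumes g: "g \<in> carrier G" and X: "X \<in> so_alg"
    and A: "L g * L (\<iota> X) = L (\<iota> (A ** X ** transpose A)) * L g"
  shows "\<pi> g ** D X = D (A ** X ** transpose A) ** \<pi> g"
proof (rule mat_endo_inject)
  let ?Y = "A ** X ** transpose A"
  have Y: "?Y \<in> so_alg" by (rule conj_in_so[OF X])
  have "mat_endo (\<pi> g) * exp (t *\<^sub>R DE X) = exp (t *\<^sub>R DE ?Y) * mat_endo (\<pi> g)" for t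
  proof -
    have "L g * exp (t *\<^sub>R L (\<iota> X)) = exp (t *\<^sub>R L (\<iota> ?Y)) * L g"
      by (rule exp_intertwine) (simp add: A)
    then have "g \<otimes>\<^bsub>G\<^esub> exp_in G (t *\<^sub>R \<iota> X) = exp_in G (t *\<^sub>R \<iota>
        ?Y) \<otimes>\<^bsub>G\<^esub> g"
      by (intro L_inject) (simp add: L_mult L_exp_in L_scale)
    then have "\<pi> g ** \<pi> (exp_in G (t *\<^sub>R \<iota> X)) = \<pi> (exp_in G (t *\<^sub>R \<iota> ?Y))
        ** \<pi> g"
      using pi_mult g exp_in_mem X Y by metis
    then show ?thesis by (metis mat_endo_mult rep_exp X Y)
  qed
  moreover have "((\<lambda>t. mat_endo (\<pi> g) * exp (t *\<^sub>R DE X)) has_vector_derivative mat_endo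
      (\<pi> g) * DE X) (at 0)"
    by (rule bounded_linear.has_vector_derivative[OF bounded_linear_mult_right exp_scaleR_has_vector_derivative_0])
  moreover have "((\<lambda>t. exp (t *\<^sub>R DE ?Y) * mat_endo (\<pi> g)) has_vector_derivative DE ?Y *
      mat_endo (\<pi> g)) (at 0)"
    by (rule bounded_linear.has_vector_derivative[OF bounded_linear_mult_left exp_scaleR_has_vector_derivative_0])
  ultimately show "mat_endo (\<pi> g ** D X) = mat_endo (D ?Y ** \<pi> g)"
    using vector_derivative_unique_at by (simp add: mat_endo_mult) 
qed

text \<open>The curve of adjoint images of X under the subgroup generated by Y is differentiated
  twice over: once in so(n), where it gives the bracket, and once after applying the representation,
  where it gives the commutator.\<close>

lemma drep_bracket:
  assumes X: "X \<in> so_alg" and Y: "Y \<in> so_alg"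
  shows "D (bracket Y X) = D Y ** D X - D X ** D Y"
proof -
  \<comment> \<open>The map \<sigma> reads the so(n) element back from the Banach algebra;
    \<open>skew_part\<close> in the next claim only makes \<open>D\<close> linear on all matrices,
    so that it commutes with differentiation.\<close>
  define Z where "Z t = \<sigma> (exp (t *\<^sub>R L (\<iota> Y)) * L (\<iota> X) * exp (t *\<^sub>R (- L
      (\<iota> Y))))" for t
  have ZD: "DE (skew_part (Z t)) = exp (t *\<^sub>R DE Y) * DE X * exp (t *\<^sub>R (- DE Y))" for t
  proof -
    define g where "g = exp_in G (t *\<^sub>R \<iota> Y)"
    have g: "g \<in> carrier G" unfolding g_def by (rule exp_in_mem[OF Y])
    have Lg: "L g = exp (t *\<^sub>R L (\<iota> Y))" by (simp add: g_def L_exp_in L_scale)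
    obtain A where A: "L g * L (\<iota> X) = L (\<iota> (A ** X ** transpose A)) * L g"
      using Ad_mem[OF g] X by blast
    have so: "A ** X ** transpose A \<in> so_alg" by (rule conj_in_so[OF X])
    have "Z t = \<sigma> (L (\<iota> (A ** X ** transpose A)) * (L g * exp (t *\<^sub>R (- L (\<iota> Y)))))"
      unfolding Z_def Lg[symmetric] A by (simp only: mult.assoc)
    also have "L g * exp (t *\<^sub>R (- L (\<iota> Y))) = 1" by (simp add: Lg exp_minus_inverse)
    finally have "Z t = A ** X ** transpose A" using sig_L[OF so] by simp
    then have Zt: "skew_part (Z t) = A ** X ** transpose A" by (simp add: skew_part_id[OF so])
    have "mat_endo (\<pi> g) * DE X = DE (A ** X ** transpose A) * mat_endo (\<pi> g)"
      using drep_Ad[OF g X A] by (metis mat_endo_mult)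
    moreover have "mat_endo (\<pi> g) = exp (t *\<^sub>R DE Y)" unfolding g_def by (rule rep_exp[OF Y])
    ultimately have "exp (t *\<^sub>R DE Y) * DE X * exp (t *\<^sub>R (- DE Y)) =
        DE (skew_part (Z t)) * (exp (t *\<^sub>R DE Y) * exp (t *\<^sub>R (- DE Y)))"
      by (simp add: Zt mult.assoc)
    then show ?thesis by (simp add: exp_minus_inverse)
  qed
  have "(Z has_vector_derivative \<sigma> (L (\<iota> Y) * L (\<iota> X) - L (\<iota> X) * L (\<iota> Y))) (at 0)"
    unfolding Z_def
    using bounded_linear.has_vector_derivative[OF bl_sig exp_conj_has_vector_derivative[where t = 0]] by simp
  then have "(Z has_vector_derivative bracket Y X) (at 0)"
    by (simp add: L_bracket X Y sig_L bracket_in_so)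
  moreover have "bounded_linear (\<lambda>x. mat_endo ((D \<circ> skew_part) x))"
    using linear_compose[OF linear_drep linear_mat_endo] by (simp add: linear_conv_bounded_linear o_def)
  ultimately have "((\<lambda>t. mat_endo ((D \<circ> skew_part) (Z t))) has_vector_derivative mat_endo ((D
      \<circ> skew_part) (bracket Y X))) (at 0)"
    using bounded_linear.has_vector_derivative by blast
  then have "((\<lambda>t. exp (t *\<^sub>R DE Y) * DE X * exp (t *\<^sub>R (- DE Y))) has_vector_derivative DE
      (bracket Y X)) (at 0)"
    by (simp add: ZD skew_part_id bracket_in_so X Y)
  moreover have "((\<lambda>t. exp (t *\<^sub>R DE Y) * DE X * exp (t *\<^sub>R (- DE Y)))
      has_vector_derivative DE Y * DE X - DE X * DE Y) (at 0)"
    using exp_conj_has_vector_derivative[of "DE Y" "DE X" 0] by simp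
  ultimately have "DE (bracket Y X) = DE Y * DE X - DE X * DE Y"
    using vector_derivative_unique_at by blast
  then have "DE (bracket Y X) = mat_endo (D Y ** D X - D X ** D Y)"
    by (simp add: mat_endo_mult linear_diff[OF linear_mat_endo])
  then show ?thesis by (rule mat_endo_inject)
qed

end

section \<open>Weights and the norm bound\<close>

lemma scaleR_eq_of_real_scale: "c *\<^sub>R v = complex_of_real c *s v" for v :: "complex^'k"
  unfolding vec_eq_iff vector_scaleR_component vector_smult_component by (simp add: scaleR_conv_of_real)

lemma vec_subspace_imp_subspace: "vec.subspace V \<Longrightarrow> subspace V" for V :: "(complex^'k) set"
  unfolding subspace_def vec.subspace_def by (simp add: scaleR_eq_of_real_scale)

lemma inner_ii_left: "(\<i> *s x) \<bullet> y = - (x \<bullet> (\<i> *s y))" for x y :: "complex^'k"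
  unfolding inner_vec_def sum_negf[symmetric] by (rule sum.cong) (simp_all add: inner_complex_def)

lemma linear_ii: "linear ((*s) \<i> :: complex^'k \<Rightarrow> _)"
  by (rule linearI) (simp_all add: vec_eq_iff algebra_simps)

lemma inner_adjoint: "(A *v x) \<bullet> y = x \<bullet> (adjoint_mat A *v y)" for A :: "complex^'k^'k"
proof -
  have i: "a \<bullet> b = Re (a * cnj b)" for a b :: complex by (simp add: inner_complex_def)
  have "(A *v x) \<bullet> y = Re (\<Sum>i\<in>UNIV. \<Sum>j\<in>UNIV. A $ i $ j * x $ j * cnj (y $ i))"
    by (simp add: inner_vec_def i matrix_vector_mult_def sum_distrib_right)
  also have "\<dots> = Re (\<Sum>j\<in>UNIV. \<Sum>i\<in>UNIV. A $ i $ j * x $ j * cnj (y $ i))"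
    by (subst sum.swap) simp
  also have "\<dots> = x \<bullet> (adjoint_mat A *v y)"
    by (simp add: inner_vec_def i matrix_vector_mult_def adjoint_mat_def sum_distrib_left ac_simps)
  finally show ?thesis .
qed

lemma matrix_vector_mult_scale: "A *v (c *s x) = c *s (A *v x)" for A :: "'f::field^'n^'m"
  by (simp add: vector_scalar_commute)

lemma so_inner_conj:
  assumes "orthogonal_matrix A"
  shows "so_inner (A ** X ** transpose A) (A ** Y ** transpose A) = so_inner X Y"
proof -
  have "(A ** X ** transpose A) \<bullet> (A ** Y ** transpose A) = X \<bullet> (transpose A ** (A ** Y **
      transpose A ** A))"
    by (simp add: inner_matrix_mult_right[of "A ** X"] inner_matrix_mult_left[of A])
  also have "transpose A ** (A ** Y ** transpose A ** A) = (transpose A ** A) ** Y ** (transpose A ** A)"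
    by (simp add: matrix_mul_assoc)
  also have "\<dots> = Y" using assms by (simp add: orthogonal_matrix)
  finally show ?thesis by (simp add: so_inner_eq)
qed

lemma linear_conj: "linear (\<lambda>X. A ** X ** transpose (A :: real^'n^'n))"
  by (rule linearI) (simp_all add: matrix_matrix_mult_def vec_eq_iff sum.distrib
    sum_distrib_left sum_distrib_right algebra_simps)

lemma orthonormal_basis_so_conj:
  fixes A :: "real^'n^'n"
  assumes A: "orthogonal_matrix A" and B: "orthonormal_basis_so B"
  shows "orthonormal_basis_so ((\<lambda>X. A ** X ** transpose A) ` B)"
    and "inj_on (\<lambda>X. A ** X ** transpose A) S"
proof -
  let ?c = "\<lambda>X. A ** X ** transpose A"
  have inv: "transpose A ** ?c X ** A = X" for X
  proof -
    have "transpose A ** ?c X ** A = (transpose A ** A) ** X ** (transpose A ** A)"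
      by (simp add: matrix_mul_assoc)
    then show ?thesis using A by (simp add: orthogonal_matrix)
  qed
  have inv': "?c (transpose A ** X ** A) = X" for X
  proof -
    have "?c (transpose A ** X ** A) = (A ** transpose A) ** X ** (A ** transpose A)"
      by (simp add: matrix_mul_assoc)
    then show ?thesis using A by (simp add: orthogonal_matrix_def)
  qed
  show "inj_on ?c S" for S by (rule inj_on_inverseI) (rule inv)
  then have inj: "?c X = ?c Y \<longleftrightarrow> X = Y" for X Y by (metis inv)
  have "?c ` so_alg = so_alg"
  proof
    show "?c ` so_alg \<subseteq> so_alg" using conj_in_so by blast
    show "so_alg \<subseteq> ?c ` so_alg"
    proof
      fix X :: "real^'n^'n" assume "X \<in> so_alg"
      then have "transpose A ** X ** A \<in> so_alg" using conj_in_so[of X "transpose A"] by simp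
      then show "X \<in> ?c ` so_alg" using inv'[of X] by (metis imageI)
    qed
  qed
  moreover have "span (?c ` B) = ?c ` span B" by (rule linear_span_image[OF linear_conj])
  moreover have "?c ` B \<subseteq> so_alg" using B conj_in_so unfolding orthonormal_basis_so_def by blast
  ultimately show "orthonormal_basis_so (?c ` B)"
    using B by (auto simp: orthonormal_basis_so_def so_inner_conj[OF A] inj)
qed

text \<open>\<open>V\<close> is allowed to be a proper subspace so that a constituent of a
  complexified real representation is covered along with an irreducible unitary module.\<close>

locale hw_rep = rot_rep G \<iota> L M \<sigma> \<pi>
  for G :: "'g::real_normed_vector monoid"
    and \<iota> :: "'n::{finite,linorder} sqmat \<Rightarrow> 'g"
    and L :: "'g \<Rightarrow> 'a::{real_normed_algebra_1,banach}" and M and \<sigma>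
    and \<pi> :: "'g \<Rightarrow> complex^'k^'k" +
  fixes V :: "(complex^'k) set" and lam :: "nat \<Rightarrow> real"
  assumes unitary: "g \<in> carrier G \<Longrightarrow> adjoint_mat (\<pi> g) ** \<pi> g = mat 1"
    and irred: "irreducible_on G \<pi> V"
    and hw: "highest_weight_on G \<iota> \<pi> V lam"
begin

lemma V_subspace: "vec.subspace V" and V_ne: "V \<noteq> {0}" and V_inv: "g \<in> carrier G \<Longrightarrow> v
    \<in> V \<Longrightarrow> \<pi> g *v v \<in> V"
  using irred by (auto simp: irreducible_on_def invariant_subspace_def)

lemma V_real: "subspace V" by (rule vec_subspace_imp_subspace[OF V_subspace])

lemma rep_curve_derivative:
  assumes X: "X \<in> so_alg"
  shows "((\<lambda>t. \<pi> (exp_in G (t *\<^sub>R \<iota> X)) *v v) has_vector_derivative D X *v v) (at 0)"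
proof -
  have "linear (\<lambda>A :: complex^'k^'k. A *v v)"
    by (rule linearI) (simp_all add: matrix_vector_mult_add_rdistrib matrix_vector_mult_scaleR)
  then have "bounded_linear (\<lambda>A :: complex^'k^'k. A *v v)" by (simp add: linear_conv_bounded_linear)
  from bounded_linear.has_vector_derivative[OF this drep_has_vector_derivative[OF X]] show ?thesis .
qed

lemma D_skew:
  assumes X: "X \<in> so_alg"
  shows "(D X *v v) \<bullet> w = - (v \<bullet> (D X *v w))"
proof -
  let ?U = "\<lambda>t. \<pi> (exp_in G (t *\<^sub>R \<iota> X))"
  have "(?U t *v v) \<bullet> (?U t *v w) = v \<bullet> w" for t
    using unitary[OF exp_in_mem[OF X], of t]
    by (simp add: inner_adjoint matrix_vector_mul_assoc)
  then have "((\<lambda>t. (?U t *v v) \<bullet> (?U t *v w)) has_vector_derivative 0) (at 0)" by simp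
  moreover have "((\<lambda>t. (?U t *v v) \<bullet> (?U t *v w)) has_vector_derivative v \<bullet> (D X *v w)
      + (D X *v v) \<bullet> w) (at 0)"
    using bounded_bilinear.has_vector_derivative[OF bounded_bilinear_inner rep_curve_derivative[OF X, of v]
        rep_curve_derivative[OF X, of w]]
    by (simp add: exp_in_0 pi_one)
  ultimately have "v \<bullet> (D X *v w) + (D X *v v) \<bullet> w = 0" using vector_derivative_unique_at by blast
  then show ?thesis by simp
qed

text \<open>The derivative of a curve in \<open>V\<close> stays in \<open>V\<close>: its component
  \<open>z\<close> orthogonal to \<open>V\<close> is tested against the curve, on which the product
  with \<open>z\<close> is constantly 0.\<close>

lemma D_mem:
  assumes X: "X \<in> so_alg" and v: "v \<in> V"
  shows "D X *v v \<in> V"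
proof -
  let ?U = "\<lambda>t. \<pi> (exp_in G (t *\<^sub>R \<iota> X))"
  obtain y z where yz: "y \<in> span V" "\<And>w. w \<in> span V \<Longrightarrow> orthogonal z w" "D X *v v = y + z"
    by (rule orthogonal_subspace_decomp_exists[of V "D X *v v"]) blast
  have y: "y \<in> V" using yz(1) V_real by (metis span_eq_iff)
  have zw: "z \<bullet> w = 0" if "w \<in> V" for w using yz(2) that span_base by (auto simp: orthogonal_def)
  have "z \<bullet> (?U t *v v) = 0" for t using zw V_inv[OF exp_in_mem[OF X] v] by blast
  then have "((\<lambda>t. z \<bullet> (?U t *v v)) has_vector_derivative 0) (at 0)" by simp
  moreover have "((\<lambda>t. z \<bullet> (?U t *v v)) has_vector_derivative z \<bullet> (D X *v v)) (at 0)"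
    by (rule bounded_linear.has_vector_derivative[OF bounded_linear_inner_right rep_curve_derivative[OF X]])
  ultimately have "z \<bullet> (D X *v v) = 0" using vector_derivative_unique_at by blast
  then have "z \<bullet> z = 0" using zw[OF y] by (simp add: yz(3) inner_add_right)
  then show ?thesis using y yz(3) by simp
qed

lemma D_commutator:
  assumes "X \<in> so_alg" "Y \<in> so_alg"
  shows "D X *v (D Y *v v) = D Y *v (D X *v v) + D (bracket X Y) *v v"
  using drep_bracket[OF assms(2) assms(1)]
  by (simp add: matrix_vector_mul_assoc matrix_vector_mult_diff_rdistrib)

lemma D_uminus: "X \<in> so_alg \<Longrightarrow> D (- X) = - D X"
  using drep_scale[of X "-1"] by simp

lemma D_0: "D 0 = 0"
  using drep_scale[of 0 0] subspace_0[OF subspace_so_alg] by simp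

lemma linear_D_apply: "linear (\<lambda>v. D X *v v)" by (rule linear_matrix_vector_real)

lemma D_cartan: "D (cartan \<theta>) *v v = (\<Sum>q<(CARD('n) div 2). \<theta> (q + 1) *\<^sub>R (D (tor q) *v v))"
proof -
  have lin: "linear (\<lambda>X. (D \<circ> skew_part) X *v v)"
    using linear_drep by (intro linearI) (simp_all only: linear_add linear_scale
        matrix_vector_mult_add_rdistrib matrix_vector_mult_scaleR)
  have "(cartan \<theta> :: 'n::{finite,linorder} sqmat) = skew_part (cartan \<theta>)"
    by (simp add: skew_part_id cartan_in_so)
  also have "\<dots> = skew_part (\<Sum>q<(CARD('n) div 2). \<theta> (q + 1) *\<^sub>R tor q)"
    by (simp only: cartan_eq_sum)
  finally have "D (cartan \<theta>) *v v = (D \<circ> skew_part) (\<Sum>q<(CARD('n) div 2). \<theta> (q + 1)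
      *\<^sub>R tor q) *v v"
    by simp
  also have "\<dots> = (\<Sum>q<(CARD('n) div 2). \<theta> (q + 1) *\<^sub>R (D (tor q) *v v))"
    unfolding linear_sum[OF lin] linear_scale[OF lin] by (simp add: skew_part_id tor_in_so)
  finally show ?thesis .
qed

lemma wt_inner_eps: "q < (CARD('n) div 2) \<Longrightarrow> wt_inner CARD('n) \<mu> (eps (q + 1)) = \<mu> (q + 1)"
proof -
  assume q: "q < (CARD('n) div 2)"
  have "wt_inner CARD('n) \<mu> (eps (q + 1)) = (\<Sum>j=1..(CARD('n) div 2). if j = q + 1 then \<mu> j else 0)"
    unfolding wt_inner_def eps_def by (rule sum.cong) auto
  then show ?thesis using q by simp
qed

text \<open>Replaces the condition on all \<theta> by one condition for each block.\<close>

lemma weight_space_iff: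
  "v \<in> weight_space D V \<mu> \<longleftrightarrow> v \<in> V \<and> (\<forall>q<(CARD('n) div 2). D (tor
      q) *v v = (\<i> * of_real (\<mu> (q + 1))) *s v)"
proof (intro iffI conjI allI impI)
  assume v: "v \<in> weight_space D V \<mu>"
  then show "v \<in> V" by (simp add: weight_space_def)
  fix q assume "q < (CARD('n) div 2)"
  then show "D (tor q) *v v = (\<i> * of_real (\<mu> (q + 1))) *s v"
    using v by (simp only: tor_eq_cartan weight_space_def wt_inner_eps mem_Collect_eq)
next
  assume v: "v \<in> V \<and> (\<forall>q<(CARD('n) div 2). D (tor q) *v v = (\<i> * of_real (\<mu> (q + 1))) *s v)"
  have "D (cartan \<theta>) *v v = (\<i> * of_real (wt_inner CARD('n) \<mu> \<theta>)) *s v" for \<theta>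
  proof -
    have "D (cartan \<theta>) *v v = (\<Sum>q<(CARD('n) div 2). (\<i> * of_real (\<mu> (q + 1) * \<theta> (q +
        1))) *s v)"
      unfolding D_cartan by (rule sum.cong) (use v in \<open>simp_all add: scaleR_eq_of_real_scale
          vector_smult_assoc ac_simps\<close>)
    also have "\<dots> = (\<Sum>q<(CARD('n) div 2). \<i> * of_real (\<mu> (q + 1) * \<theta> (q + 1))) *s v"
      by (simp add: vec.scale_sum_left)
    also have "(\<Sum>q<(CARD('n) div 2). \<i> * of_real (\<mu> (q + 1) * \<theta> (q + 1))) = \<i> *
        complex_of_real (\<Sum>q<(CARD('n) div 2). \<mu> (q + 1) * \<theta> (q + 1))"
      by (simp add: sum_distrib_left)
    also have "(\<Sum>q<(CARD('n) div 2). \<mu> (q + 1) * \<theta> (q + 1)) = wt_inner CARD('n) \<mu> \<theta>"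
      unfolding wt_inner_def by (rule sum.reindex_bij_witness[of _ "\<lambda>j. j - 1" "\<lambda>q. q + 1"]) auto
    finally show ?thesis .
  qed
  then show "v \<in> weight_space D V \<mu>" using v by (simp add: weight_space_def)
qed

lemma eigen_subspace:
  assumes "vec.subspace S"
  shows "vec.subspace {v \<in> S. D X *v v = c *s v}"
  using assms unfolding vec.subspace_def
  by (auto simp: matrix_vector_right_distrib matrix_vector_mult_scale vector_smult_assoc vector_add_ldistrib
      mult.commute)

text \<open>Simultaneous diagonalisation, one torus generator at a time. The induction keeps a
  nonzero subspace that is invariant under all generators and on which the first j act by scalars;
  it survives the next step because the generators commute.\<close>

lemma joint_weight_vector:
  assumes S: "vec.subspace S" "S \<subseteq> V" "S \<noteq> {0}"
    and inv: "\<And>q v. q < (CARD('n) div 2) \<Longrightarrow> v \<in> S \<Longrightarrow> D (tor q) *v v \<in> S"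
  obtains \<mu> v where "v \<in> S" "v \<noteq> 0" "v \<in> weight_space D V \<mu>"
proof -
  have "\<exists>T \<mu>. vec.subspace T \<and> T \<subseteq> S \<and> T \<noteq> {0} \<and> (\<forall>q v. q <
      (CARD('n) div 2) \<longrightarrow> v \<in> T \<longrightarrow> D (tor q) *v v \<in> T) \<and>
     (\<forall>q<j. \<forall>v\<in>T. D (tor q) *v v = (\<i> * of_real (\<mu> (q + 1))) *s v)" if "j \<le>
         (CARD('n) div 2)" for j
    using that
  proof (induction j)
    case 0
    then show ?case using S inv by (intro exI[of _ S]) auto
  next
    case (Suc j)
    then have "j \<le> CARD('n) div 2" by simp
    from Suc.IH[OF this] obtain T \<mu> where T: "vec.subspace T" "T \<subseteq> S" "T \<noteq> {0}"
      "\<And>q v. q < (CARD('n) div 2) \<Longrightarrow> v \<in> T \<Longrightarrow> D (tor q) *v v \<in> T"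
      "\<And>q v. q < j \<Longrightarrow> v \<in> T \<Longrightarrow> D (tor q) *v v = (\<i> * of_real (\<mu>
          (q + 1))) *s v" by blast
    \<comment> \<open>Multiplication by the imaginary unit and the skew operator
      \<open>D (tor j)\<close> commute and are both skew for the real inner product, so their
      product is self-adjoint and has a real eigenvalue.\<close>
    define F where "F v = - (\<i> *s (D (tor j) *v v))" for v
    have "linear F" unfolding F_def
      by (intro linear_compose_neg linear_compose[OF linear_D_apply linear_ii, unfolded o_def])
    moreover have "F x \<in> T" if "x \<in> T" for x
      unfolding F_def using T(1) T(4)[OF _ that, of j] Suc.prems
      by (intro vec.subspace_neg vec.subspace_scale) auto
    moreover have "F x \<bullet> y = x \<bullet> F y" for x y
      unfolding F_def by (simp add: inner_ii_left D_skew tor_in_so matrix_vector_mult_scale)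
    ultimately obtain x c where x: "x \<in> T" "x \<noteq> 0" "F x = c *\<^sub>R x"
      using self_adjoint_has_eigenvector[of F T] vec_subspace_imp_subspace[OF T(1)] T(3) by metis
    have "\<i> *s F x = D (tor j) *v x" by (simp add: F_def vector_smult_assoc)
    then have Dx: "D (tor j) *v x = (\<i> * of_real c) *s x"
      by (simp add: x(3) scaleR_eq_of_real_scale vector_smult_assoc)
    define T' where "T' = {v \<in> T. D (tor j) *v v = (\<i> * of_real c) *s v}"
    have "vec.subspace T'" unfolding T'_def by (rule eigen_subspace[OF T(1)])
    moreover have "T' \<subseteq> S" using T(2) by (auto simp: T'_def)
    moreover have "T' \<noteq> {0}" using x Dx by (auto simp: T'_def)
    moreover have "D (tor q) *v v \<in> T'" if "q < (CARD('n) div 2)" "v \<in> T'" for q v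
    proof -
      have "D (tor j) *v (D (tor q) *v v) = D (tor q) *v (D (tor j) *v v)"
        using D_commutator[OF tor_in_so tor_in_so, of j q v] that(1) Suc.prems
        by (simp add: bracket_tor_tor D_0)
      then show ?thesis using that T(4) by (simp add: T'_def matrix_vector_mult_scale)
    qed
    moreover have "D (tor q) *v v = (\<i> * of_real ((\<mu>(j + 1 := c)) (q + 1))) *s v" if "q < Suc j" "v
        \<in> T'" for q v
      using that T(5)[of q v] by (cases "q = j") (auto simp: T'_def)
    ultimately show ?case by blast
  qed
  from this[OF order_refl] obtain T \<mu> where T: "vec.subspace T" "T \<subseteq> S" "T \<noteq> {0}"
     "\<And>q v. q < (CARD('n) div 2) \<Longrightarrow> v \<in> T \<Longrightarrow> D (tor q) *v v = (\<i> *
         of_real (\<mu> (q + 1))) *s v" by blast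
  then obtain v where v: "v \<in> T" "v \<noteq> 0" using vec.subspace_0[OF T(1)] by blast
  show ?thesis by (rule that[of v \<mu>]) (use v T S(2) in \<open>auto simp: weight_space_iff\<close>)
qed

lemma weight_below:
  assumes "v \<in> weight_space D V \<mu>" "v \<noteq> 0"
  obtains c :: "(nat \<Rightarrow> real) \<Rightarrow> nat" where
    "\<And>j. j \<in> {1..(CARD('n) div 2)} \<Longrightarrow> lam j - \<mu> j =
        (\<Sum>\<alpha>\<in>positive_roots CARD('n). of_nat (c \<alpha>) * \<alpha> j)"
  using hw assms unfolding highest_weight_on_def by blast

text \<open>After conjugation the eigenvalue is the value of some weight \<mu> at a dominant
  \<theta>. This is at most the value of the highest weight, and Cauchy-Schwarz bounds the latter by
  the two lengths.\<close>

lemma eigenvalue_le: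
  assumes X: "X \<in> so_alg" and u: "u \<in> V" "u \<noteq> 0" and ev: "D X *v u = (\<i> * of_real s) *s u"
  shows "s \<le> sqrt (wt_inner CARD('n) lam lam * so_inner X X)"
proof -
  obtain A \<theta> where A: "orthogonal_matrix A" "det A = 1" "X = A ** cartan \<theta> ** transpose A"
    and dom: "\<And>\<alpha>. \<alpha> \<in> positive_roots CARD('n) \<Longrightarrow> 0 \<le> wt_inner
        CARD('n) \<alpha> \<theta>"
    using so_normal_form[OF X] by blast
  let ?C = "cartan \<theta> :: 'n::{finite,linorder} sqmat"
  obtain g where g: "g \<in> carrier G" "L g * L (\<iota> ?C) = L (\<iota> (A ** ?C ** transpose A)) * L g"
    using Ad_surj[OF A(1,2)] cartan_in_so by blast
  obtain h where h: "h \<in> carrier G" "h \<otimes>\<^bsub>G\<^esub> g = \<one>\<^bsub>G\<^esub>" "g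
      \<otimes>\<^bsub>G\<^esub> h = \<one>\<^bsub>G\<^esub>" using inv_mem[OF g(1)] by blast
  have hg: "\<pi> h ** \<pi> g = mat 1" "\<pi> g ** \<pi> h = mat 1" using pi_mult h g(1) pi_one by metis+
  have gD: "\<pi> g ** D ?C = D X ** \<pi> g" using drep_Ad[OF g(1) cartan_in_so g(2)] A(3) by simp
  define u' where "u' = \<pi> h *v u"
  have gu: "\<pi> g *v u' = u" by (simp add: u'_def matrix_vector_mul_assoc hg)
  have u': "u' \<in> V" "u' \<noteq> 0" using V_inv[OF h(1) u(1)] gu u(2) by (auto simp: u'_def)
  have "\<pi> g *v (D ?C *v u') = (\<i> * of_real s) *s u"
    using ev gu by (simp add: matrix_vector_mul_assoc gD) (simp flip: matrix_vector_mul_assoc)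
  then have "\<pi> h *v (\<pi> g *v (D ?C *v u')) = (\<i> * of_real s) *s u'"
    by (simp add: matrix_vector_mult_scale u'_def)
  moreover have "\<pi> h *v (\<pi> g *v y) = y" for y by (simp add: matrix_vector_mul_assoc hg)
  ultimately have Cu: "D ?C *v u' = (\<i> * of_real s) *s u'" by simp
  \<comment> \<open>The transported vector need not be a weight vector, but the torus preserves the
    whole eigenspace of \<open>cartan \<theta>\<close>, which therefore contains one.\<close>
  define S where "S = {v \<in> V. D ?C *v v = (\<i> * of_real s) *s v}"
  have "vec.subspace S" unfolding S_def by (rule eigen_subspace[OF V_subspace])
  moreover have "S \<noteq> {0}" using u' Cu by (auto simp: S_def)
  moreover have "D (tor q) *v v \<in> S" if "q < (CARD('n) div 2)" "v \<in> S" for q v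
  proof -
    have "D ?C *v (D (tor q) *v v) = D (tor q) *v (D ?C *v v)"
      using D_commutator[OF cartan_in_so tor_in_so, of \<theta> q v] bracket_cartan_tor[OF that(1)] D_0 by simp
    then show ?thesis using that by (simp add: S_def matrix_vector_mult_scale D_mem tor_in_so)
  qed
  moreover have "S \<subseteq> V" by (auto simp: S_def)
  ultimately obtain \<mu> v where v: "v \<in> S" "v \<noteq> 0" "v \<in> weight_space D V \<mu>"
    using joint_weight_vector by metis
  have "(\<i> * of_real (wt_inner CARD('n) \<mu> \<theta>)) *s v = (\<i> * of_real s) *s v"
    using v by (simp add: S_def weight_space_def)
  then have s: "s = wt_inner CARD('n) \<mu> \<theta>" using v(2) by simp
  obtain c :: "(nat \<Rightarrow> real) \<Rightarrow> nat" where
    c: "\<And>j. j \<in> {1..(CARD('n) div 2)} \<Longrightarrow> lam j - \<mu> j =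
        (\<Sum>\<alpha>\<in>positive_roots CARD('n). of_nat (c \<alpha>) * \<alpha> j)"
    using weight_below[OF v(3,2)] by blast
  \<comment> \<open>The difference of the weights is a combination of positive roots with natural
    coefficients, and each root is nonnegative at the dominant \<theta>.\<close>
  have "wt_inner CARD('n) lam \<theta> - wt_inner CARD('n) \<mu> \<theta> = (\<Sum>j=1..(CARD('n) div 2). (lam
      j - \<mu> j) * \<theta> j)"
    by (simp add: wt_inner_def sum_subtractf left_diff_distrib)
  also have "\<dots> = (\<Sum>j=1..(CARD('n) div 2). (\<Sum>\<alpha>\<in>positive_roots CARD('n). of_nat (c
      \<alpha>) * \<alpha> j) * \<theta> j)"
    by (rule sum.cong) (simp_all add: c)
  also have "\<dots> = (\<Sum>\<alpha>\<in>positive_roots CARD('n). of_nat (c \<alpha>) * wt_inner CARD('n)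
      \<alpha> \<theta>)"
    unfolding sum_distrib_right wt_inner_def by (subst sum.swap) (simp add: sum_distrib_left ac_simps)
  also have "\<dots> \<ge> 0" by (intro sum_nonneg mult_nonneg_nonneg) (simp_all add: dom)
  finally have "s \<le> wt_inner CARD('n) lam \<theta>" using s by simp
  also have "\<dots> = so_inner (cartan lam) ?C" by (simp add: so_inner_cartan)
  also have "\<dots> \<le> norm (cartan lam :: 'n::{finite,linorder} sqmat) * norm ?C / 2"
    unfolding so_inner_eq by (simp add: norm_cauchy_schwarz)
  also have "\<dots> = sqrt (so_inner (cartan lam :: 'n::{finite,linorder} sqmat) (cartan lam) * so_inner ?C ?C)"
    by (simp add: so_inner_eq norm_eq_sqrt_inner real_sqrt_mult real_sqrt_divide)
  also have "so_inner ?C ?C = so_inner X X"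
    by (simp add: A(3) so_inner_conj[OF A(1)])
  finally show ?thesis by (simp add: so_inner_cartan)
qed

text \<open>The largest eigenvalue c of minus the square of \<open>D X\<close> on \<open>V\<close>
  is the squared operator norm there. Its root, up to sign, is an eigenvalue of \<open>D X\<close>
  divided by the imaginary unit, to which \<open>eigenvalue_le\<close> applies.\<close>

lemma drep_norm_bound:
  assumes X: "X \<in> so_alg" and v: "v \<in> V"
  shows "(norm (D X *v v))\<^sup>2 \<le> wt_inner CARD('n) lam lam * so_inner X X * (norm v)\<^sup>2"
proof -
  define F where "F v = - (D X *v (D X *v v))" for v
  have Fn: "F y \<bullet> y = (norm (D X *v y))\<^sup>2" for y
    using D_skew[OF X, of "D X *v y" y] by (simp add: F_def power2_norm_eq_inner)
  have "linear F" unfolding F_def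
    by (intro linear_compose_neg linear_compose[OF linear_D_apply linear_D_apply, unfolded o_def])
  moreover have "F x \<in> V" if "x \<in> V" for x
    unfolding F_def using that X by (intro subspace_neg[OF V_real] D_mem)
  moreover have "F x \<bullet> y = x \<bullet> F y" for x y by (simp add: F_def D_skew[OF X])
  ultimately obtain x c where x: "x \<in> V" "x \<noteq> 0" "F x = c *\<^sub>R x" "\<And>y. y \<in> V
      \<Longrightarrow> F y \<bullet> y \<le> c * (y \<bullet> y)"
    using self_adjoint_has_eigenvector[of F V] V_real V_ne by metis
  have "0 \<le> F x \<bullet> x" unfolding Fn by simp
  then have c0: "0 \<le> c" using x(2,3) by (simp add: zero_le_mult_iff) (metis inner_gt_zero_iff not_less)
  define s where "s = sqrt c"
  have ss: "s * s = c" using c0 by (simp add: s_def)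
  have DD: "D X *v (D X *v x) = - (of_real (s * s) *s x)"
    using x(3) by (simp add: F_def ss scaleR_eq_of_real_scale) (metis minus_minus)
  define b where "b = sqrt (wt_inner CARD('n) lam lam * so_inner X X)"
  have "s \<le> b"
  \<comment> \<open>From (D X)^2 x = - s^2 x the displayed vector lies in the kernel of D X - i s.
    If it is nonzero it is an eigenvector for s; if it vanishes, x is one for - s, that is, for s
    after replacing X by - X.\<close>
  proof (cases "D X *v x + (\<i> * of_real s) *s x = 0")
    case False
    have ii: "\<i> * of_real s * (\<i> * of_real s) = - (complex_of_real s * complex_of_real s)"
      by (simp add: algebra_simps)
    show ?thesis unfolding b_def
    proof (rule eigenvalue_le[OF X _ False])
      show "D X *v x + (\<i> * of_real s) *s x \<in> V"
        by (intro vec.subspace_add[OF V_subspace] vec.subspace_scale[OF V_subspace] D_mem X x(1))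
      show "D X *v (D X *v x + (\<i> * of_real s) *s x) = (\<i> * of_real s) *s (D X *v x + (\<i> * of_real s) *s x)"
        using ii by (simp add: matrix_vector_right_distrib matrix_vector_mult_scale DD vector_add_ldistrib
            vector_smult_assoc)
    qed
  next
    case True
    then have "D (- X) *v x = (\<i> * of_real s) *s x"
      unfolding D_uminus[OF X] by (simp add: add_eq_0_iff2 matrix_vector_mult_def vec_eq_iff sum_negf)
    from eigenvalue_le[OF subspace_neg[OF subspace_so_alg X] x(1,2) this]
    show ?thesis by (simp add: b_def so_inner_eq)
  qed
  moreover have "s \<ge> 0" using c0 by (simp add: s_def)
  ultimately have "c \<le> b * b" unfolding ss[symmetric] by (intro mult_mono) auto
  moreover have "wt_inner CARD('n) lam lam * so_inner X X \<ge> 0"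
    by (rule mult_nonneg_nonneg) (auto simp: wt_inner_def so_inner_eq intro: sum_nonneg)
  ultimately have "c \<le> wt_inner CARD('n) lam lam * so_inner X X" by (simp add: b_def)
  then have "c * (v \<bullet> v) \<le> wt_inner CARD('n) lam lam * so_inner X X * (v \<bullet> v)"
    by (intro mult_right_mono) auto
  then show ?thesis using x(4)[OF v] by (simp add: Fn power2_norm_eq_inner)
qed

end

section \<open>The Casimir operator\<close>

lemma matrix_vector_mult_uminus: "(- A) *v x = - (A *v x)" for A :: "'f::ring_1^'n^'m"
  by (simp add: matrix_vector_mult_def vec_eq_iff sum_negf)

lemma sum_std_basis_so:
  fixes f :: "'n::{finite,linorder} sqmat \<Rightarrow> 'b::comm_monoid_add"
  shows "(\<Sum>X\<in>std_basis_so. f X) = (\<Sum>a<CARD('n). \<Sum>b\<in>{a<..<CARD('n)}. f (wedge (ax (ith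
      a)) (ax (ith b))))"
proof -
  have "(\<Sum>X\<in>std_basis_so. f X) = (\<Sum>(i, j)\<in>{(i :: 'n, j). i < j}. f (wedge (ax i) (ax j)))"
    unfolding std_basis_so_def
    by (subst sum.reindex[OF inj_on_wedge_axis]) (simp add: o_def case_prod_unfold)
  also have "\<dots> = (\<Sum>(a, b)\<in>(SIGMA a:{..<CARD('n)}. {a<..<CARD('n)}). f (wedge (ax (ith a)) (ax (ith b))))"
    by (rule sum.reindex_bij_witness[of _ "\<lambda>(a, b). (ith a, ith b)" "\<lambda>(i, j). (idx_pos i, idx_pos j)"])
      (auto simp: idx_pos_ith ith_less_iff idx_pos_less idx_pos_strict_mono)
  also have "\<dots> = (\<Sum>a<CARD('n). \<Sum>b\<in>{a<..<CARD('n)}. f (wedge (ax (ith a)) (ax (ith b))))"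
    by (subst sum.Sigma) auto
  finally show ?thesis .
qed

lemma sum_lessThan_double: "(\<Sum>a<2 * k. g a) = (\<Sum>q<k. g (2 * q) + g (2 * q + 1))"
  for g :: "nat \<Rightarrow> 'b::comm_monoid_add"
  by (induction k) (simp_all add: ac_simps)

text \<open>Groups the basis for the raising argument: each block contributes its torus generator
  and, for every later position b, the two wedges of the block with the axis vector at b. For odd n
  the last row is empty.\<close>

lemma sum_std_basis_so_blocks:
  fixes f :: "'n::{finite,linorder} sqmat \<Rightarrow> 'b::comm_monoid_add"
  shows "(\<Sum>X\<in>std_basis_so. f X) = (\<Sum>q<CARD('n) div 2. f (tor q) +
    (\<Sum>b\<in>{2 * q + 2..<CARD('n)}. f (wedge (ax (ith (2 * q))) (ax (ith b))) + f (wedge (ax (ith (2 * q +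
        1))) (ax (ith b)))))"
proof -
  let ?n = "CARD('n)" and ?m = "CARD('n) div 2"
  define g where "g a = (\<Sum>b\<in>{a<..<?n}. f (wedge (ax (ith a)) (ax (ith b))))" for a
  have "(\<Sum>X\<in>std_basis_so. f X) = (\<Sum>a<?n. g a)" by (simp add: sum_std_basis_so g_def)
  also have "\<dots> = (\<Sum>a<2 * ?m. g a)"
  proof (cases "even ?n")
    case False
    then have n: "?n = Suc (2 * ?m)" by presburger
    have "g (2 * ?m) = 0" unfolding g_def by (rule sum.neutral) (use n in auto)
    then show ?thesis by (subst n) simp
  qed simp
  also have "\<dots> = (\<Sum>q<?m. g (2 * q) + g (2 * q + 1))" by (rule sum_lessThan_double)
  also have "\<dots> = (\<Sum>q<?m. f (tor q) +
    (\<Sum>b\<in>{2 * q + 2..<?n}. f (wedge (ax (ith (2 * q))) (ax (ith b))) + f (wedge (ax (ith (2 * q + 1)))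
        (ax (ith b)))))"
  proof (rule sum.cong[OF refl])
    fix q assume "q \<in> {..<?m}"
    then have "{2 * q<..<?n} = insert (2 * q + 1) {2 * q + 2..<?n}" "{2 * q + 1<..<?n} = {2 * q + 2..<?n}" by auto
    then show "g (2 * q) + g (2 * q + 1) = f (tor q) +
      (\<Sum>b\<in>{2 * q + 2..<?n}. f (wedge (ax (ith (2 * q))) (ax (ith b))) + f (wedge (ax (ith (2 * q +
          1))) (ax (ith b))))"
      by (simp add: g_def tor_def sum.distrib ac_simps)
  qed
  finally show ?thesis .
qed

context hw_rep
begin

text \<open>Schur's lemma. Conjugation permutes orthonormal bases and the sum of squares does not
  depend on the basis, so the operator commutes with the group; its eigenspace for a real
  eigenvalue, supplied by self-adjointness, is then all of \<open>V\<close>.\<close>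

lemma casimir_scalar:
  obtains c where "\<And>v. v \<in> V \<Longrightarrow> (\<Sum>X\<in>std_basis_so. D X *v (D X *v v)) = c *\<^sub>R v"
proof -
  let ?SB = "std_basis_so :: ('n::{finite,linorder} sqmat) set"
  define F where "F v = (\<Sum>X\<in>?SB. D X *v (D X *v v))" for v
  have SB: "X \<in> so_alg" if "X \<in> ?SB" for X
    using orthonormal_std_basis_so that unfolding orthonormal_basis_so_def by blast
  have F: "linear F" unfolding F_def
    by (intro linear_compose_sum ballI linear_compose[OF linear_D_apply linear_D_apply, unfolded o_def])
  have FV: "F v \<in> V" if "v \<in> V" for v
    unfolding F_def by (intro subspace_sum[OF V_real] D_mem SB that)
  have sa: "F x \<bullet> y = x \<bullet> F y" for x y
    unfolding F_def inner_sum_left inner_sum_right by (rule sum.cong) (simp_all add: D_skew SB)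
  obtain x c where x: "x \<in> V" "x \<noteq> 0" "F x = c *\<^sub>R x"
    by (rule self_adjoint_has_eigenvector[OF F V_real V_ne FV sa])
  have FG: "F (\<pi> g *v v) = \<pi> g *v F v" if g: "g \<in> carrier G" for g v
  proof -
    obtain A where A: "orthogonal_matrix A" "\<And>X. X \<in> so_alg \<Longrightarrow> L g * L (\<iota> X) = L
        (\<iota> (A ** X ** transpose A)) * L g"
      using Ad_mem[OF g] by blast
    let ?c = "\<lambda>X. A ** X ** transpose A"
    have gD: "\<pi> g *v (D X *v w) = D (?c X) *v (\<pi> g *v w)" if "X \<in> so_alg" for X w
      using drep_Ad[OF g that A(2)[OF that]] by (simp add: matrix_vector_mul_assoc)
    have "\<pi> g *v F v = (\<Sum>X\<in>?SB. \<pi> g *v (D X *v (D X *v v)))"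
      unfolding F_def by (rule linear_sum[OF linear_matrix_vector_real])
    also have "\<dots> = (\<Sum>X\<in>?SB. D (?c X) *v (D (?c X) *v (\<pi> g *v v)))"
      by (rule sum.cong) (simp_all add: gD SB)
    also have "\<dots> = (\<Sum>X\<in>?c ` ?SB. D X *v (D X *v (\<pi> g *v v)))"
      by (subst sum.reindex[OF orthonormal_basis_so_conj(2)[OF A(1) orthonormal_std_basis_so]]) simp
    also have "\<dots> = F (\<pi> g *v v)" unfolding F_def
      by (rule skew_action.sum_squares_basis_invariant[OF skew_actionI[OF D_skew]
          orthonormal_basis_so_conj(1)[OF A(1) orthonormal_std_basis_so] orthonormal_std_basis_so])
    finally show ?thesis by simp
  qed
  have Fc: "F (a *s v) = a *s F v" for a v
    by (simp add: F_def matrix_vector_mult_scale vec.scale_sum_right)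
  define S where "S = {v \<in> V. F v = c *\<^sub>R v}"
  have "invariant_subspace G \<pi> S"
    unfolding invariant_subspace_def
  proof (intro conjI ballI)
    show "vec.subspace S"
      using V_subspace unfolding S_def vec.subspace_def
      by (auto simp: linear_0[OF F] linear_add[OF F] Fc scaleR_add_right scaleR_eq_of_real_scale
          vector_smult_assoc mult.commute)
    show "\<pi> g *v v \<in> S" if "g \<in> carrier G" "v \<in> S" for g v
      using that by (simp add: S_def FG V_inv linear_scale[OF linear_matrix_vector_real])
  qed
  moreover have "S \<subseteq> V" by (auto simp: S_def)
  moreover have "S \<noteq> {0}" using x by (auto simp: S_def)
  ultimately have "S = V" using irred by (auto simp: irreducible_on_def)
  then have "F v = c *\<^sub>R v" if "v \<in> V" for v using that by (auto simp: S_def)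
  then show ?thesis unfolding F_def by (rule that)
qed

section \<open>Raising operators and the Casimir eigenvalue\<close>

lemma tor_axis:
  assumes "q < CARD('n) div 2"
  shows "(tor q :: 'n::{finite,linorder} sqmat) *v ax (ith (2 * q)) = - ax (ith (2 * q + 1))"
    "(tor q :: 'n::{finite,linorder} sqmat) *v ax (ith (2 * q + 1)) = ax (ith (2 * q))"
    "b < CARD('n) \<Longrightarrow> b \<noteq> 2 * q \<Longrightarrow> b \<noteq> 2 * q + 1 \<Longrightarrow>
      (tor q :: 'n::{finite,linorder} sqmat) *v ax (ith b) = 0"
  using assms by (simp_all add: tor_def wedge_axis_mult ith_eq_iff)

text \<open>\<open>E\<^sub>e\<^sub>z + \<i>E\<^sub>f\<^sub>z\<close> raises coordinate \<open>q + 1\<close> of the weight by 1 and keeps the earlier ones; the sum of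
  the first \<open>q + 1\<close> coordinates is nonnegative on positive roots, so the result vanishes on a highest weight vector.\<close>

lemma raising_kills:
  assumes v: "v \<in> weight_space D V lam" and q: "q < CARD('n) div 2" and b: "2 * q + 2 \<le> b" "b < CARD('n)"
  shows "D (wedge (ax (ith (2 * q))) (ax (ith b))) *v v + \<i> *s (D (wedge (ax (ith (2 * q + 1))) (ax (ith
      b))) *v v) = 0"
    (is "D ?Ee *v v + \<i> *s (D ?Ef *v v) = 0")
proof (rule ccontr)
  define u where "u = D ?Ee *v v + \<i> *s (D ?Ef *v v)"
  assume "\<not> ?thesis"
  then have u0: "u \<noteq> 0" by (simp add: u_def)
  have vV: "v \<in> V" and wt: "\<And>p. p < CARD('n) div 2 \<Longrightarrow> D (tor p) *v v = (\<i> * of_real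
      (lam (p + 1))) *s v"
    using v by (auto simp: weight_space_iff)
  have uV: "u \<in> V" unfolding u_def
    by (intro vec.subspace_add[OF V_subspace] vec.subspace_scale[OF V_subspace] D_mem wedge_in_so vV)
  have D_tor: "D (tor p) *v (D E *v v) = (\<i> * of_real (lam (p + 1))) *s (D E *v v) + D (bracket (tor p) E) *v v"
    if "p < CARD('n) div 2" "E \<in> so_alg" for p E
    using D_commutator[OF tor_in_so that(2), of p v] wt[OF that(1)] by (simp add: matrix_vector_mult_scale)
  have low: "D (tor p) *v u = (\<i> * of_real (lam (p + 1))) *s u" if "p < q" for p
  proof -
    have p: "p < CARD('n) div 2" using that q by simp
    have "bracket (tor p) ?Ee = 0" "bracket (tor p) ?Ef = 0"
      using that q b by (simp_all add: bracket_wedge[OF tor_in_so] tor_axis(3)[OF p] wedge_linear)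
    then show ?thesis
      using p by (simp add: u_def matrix_vector_right_distrib matrix_vector_mult_scale D_tor wedge_in_so D_0
        vector_add_ldistrib vector_smult_assoc mult.commute)
  qed
  have top: "D (tor q) *v u = (\<i> * of_real (lam (q + 1) + 1)) *s u"
  proof -
    have "(tor q :: 'n::{finite,linorder} sqmat) *v ax (ith b) = 0"
      by (rule tor_axis(3)[OF q]) (use b in auto)
    then have br: "bracket (tor q) ?Ee = - ?Ef" "bracket (tor q) ?Ef = ?Ee"
      unfolding bracket_wedge[OF tor_in_so] tor_axis(1,2)[OF q] by (simp_all add: wedge_linear)
    have "D (tor q) *v (D ?Ee *v v) = (\<i> * of_real (lam (q + 1))) *s (D ?Ee *v v) - D ?Ef *v v"
      "D (tor q) *v (D ?Ef *v v) = (\<i> * of_real (lam (q + 1))) *s (D ?Ef *v v) + D ?Ee *v v"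
      unfolding D_tor[OF q wedge_in_so] br D_uminus[OF wedge_in_so]
      by (simp_all add: matrix_vector_mult_def vec_eq_iff sum_negf)
    then show ?thesis
      unfolding u_def matrix_vector_right_distrib matrix_vector_mult_scale
      by (simp add: vec_eq_iff algebra_simps)
  qed
  \<comment> \<open>The vector u is known to be an eigenvector of the first q + 1 torus generators
    only. Their joint eigenspace is invariant under the whole torus and so contains a weight vector
    with the same first q + 1 coordinates.\<close>
  define S where "S = {w \<in> V. (\<forall>p<q. D (tor p) *v w = (\<i> * of_real (lam (p + 1))) *s w) \<and>
      D (tor q) *v w = (\<i> * of_real (lam (q + 1) + 1)) *s w}"
  have "vec.subspace S"
    using V_subspace unfolding vec.subspace_def S_def
    by (auto simp: matrix_vector_right_distrib matrix_vector_mult_scale vector_smult_assoc vector_add_ldistrib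
        mult.commute)
  moreover have "S \<subseteq> V" by (auto simp: S_def)
  moreover have "S \<noteq> {0}" using u0 uV low top by (auto simp: S_def)
  moreover have "D (tor p) *v w \<in> S" if p: "p < CARD('n) div 2" and w: "w \<in> S" for p w
  proof -
    have com: "D (tor p') *v (D (tor p) *v w) = D (tor p) *v (D (tor p') *v w)" if "p' < CARD('n) div 2" for p'
      using D_commutator[OF tor_in_so tor_in_so, of p' p w] bracket_tor_tor[OF that p] D_0 by simp
    show ?thesis using w q unfolding S_def
      by (auto simp: com matrix_vector_mult_scale D_mem tor_in_so)
  qed
  ultimately obtain \<mu> w where w: "w \<in> S" "w \<noteq> 0" "w \<in> weight_space D V \<mu>"
    using joint_weight_vector by metis
  have \<mu>: "\<mu> (p + 1) = (if p = q then lam (p + 1) + 1 else lam (p + 1))" if "p \<le> q" for p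
  proof -
    have "D (tor p) *v w = (\<i> * of_real (\<mu> (p + 1))) *s w" using w(3) that q by (simp add: weight_space_iff)
    moreover have "D (tor p) *v w = (\<i> * of_real (if p = q then lam (p + 1) + 1 else lam (p + 1))) *s w"
      using w(1) that by (auto simp: S_def)
    ultimately have "(\<i> * of_real (\<mu> (p + 1))) *s w = (\<i> * of_real (if p = q then lam (p + 1) + 1
        else lam (p + 1))) *s w" by metis
    from vec.scale_right_imp_eq[OF w(2) this] show ?thesis
      by (simp only: mult_cancel_left complex_i_not_zero of_real_eq_iff simp_thms)
  qed
  obtain c :: "(nat \<Rightarrow> real) \<Rightarrow> nat" where
    c: "\<And>j. j \<in> {1..CARD('n) div 2} \<Longrightarrow> lam j - \<mu> j =
        (\<Sum>\<alpha>\<in>positive_roots CARD('n). of_nat (c \<alpha>) * \<alpha> j)"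
    using weight_below[OF w(3,2)] by blast
  have "(\<Sum>j=1..q+1. lam j - \<mu> j) = (\<Sum>j=1..q+1. if j = q + 1 then -1 else 0)"
  proof (rule sum.cong[OF refl])
    fix j assume "j \<in> {1..q + 1}"
    then show "lam j - \<mu> j = (if j = q + 1 then -1 else 0)" using \<mu>[of "j - 1"] by auto
  qed
  then have neg: "(\<Sum>j=1..q+1. lam j - \<mu> j) = -1" by simp
  have "(\<Sum>j=1..q+1. lam j - \<mu> j) = (\<Sum>j=1..q+1. \<Sum>\<alpha>\<in>positive_roots CARD('n). of_nat
      (c \<alpha>) * \<alpha> j)"
    by (rule sum.cong) (use q in \<open>auto simp: c\<close>)
  also have "\<dots> = (\<Sum>\<alpha>\<in>positive_roots CARD('n). of_nat (c \<alpha>) * (\<Sum>j=1..q+1. \<alpha> j))"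
    by (subst sum.swap) (simp only: sum_distrib_left)
  \<comment> \<open>In a root \<open>eps i - eps j\<close> the positive entry comes first because i
    < j, so no partial sum is negative.\<close>
  also have "\<dots> \<ge> 0"
  proof (rule sum_nonneg)
    fix \<alpha> assume "\<alpha> \<in> positive_roots CARD('n)"
    moreover have e: "(\<Sum>j=1..q+1. eps i j) = (if i \<in> {1..q + 1} then 1 else 0)" for i
      unfolding eps_def by (rule sum.delta) simp
    ultimately have "0 \<le> (\<Sum>j=1..q+1. \<alpha> j)"
      unfolding positive_roots_def by (auto simp only: sum.distrib sum_subtractf e mem_Collect_eq Un_iff) auto
    then show "0 \<le> of_nat (c \<alpha>) * (\<Sum>j=1..q+1. \<alpha> j)" by (rule mult_nonneg_nonneg[OF
        of_nat_0_le_iff])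
  qed
  finally show False using neg by simp
qed

text \<open>On a vector killed by the raising operator each of the two images is a multiple of the
  other, so the sum of squares collapses to a multiple of the commutator of \<open>Ee\<close> and
  \<open>Ef\<close>, which is minus the torus generator of the block.\<close>

lemma casimir_pair:
  assumes v: "v \<in> weight_space D V lam" and q: "q < CARD('n) div 2" and b: "2 * q + 2 \<le> b" "b < CARD('n)"
  defines "Ee \<equiv> wedge (ax (ith (2 * q))) (ax (ith b))" and "Ef \<equiv> wedge (ax (ith (2 * q + 1))) (ax
      (ith b))"
  shows "D Ee *v (D Ee *v v) + D Ef *v (D Ef *v v) = - lam (q + 1) *\<^sub>R v"
proof -
  have so: "Ee \<in> so_alg" "Ef \<in> so_alg" by (simp_all add: Ee_def Ef_def wedge_in_so)
  have kill: "D Ee *v v + \<i> *s (D Ef *v v) = 0"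
    unfolding Ee_def Ef_def by (rule raising_kills[OF v q b])
  have e: "D Ee *v v = - (\<i> *s (D Ef *v v))" using kill by (simp add: add_eq_0_iff2)
  have f: "D Ef *v v = \<i> *s (D Ee *v v)" unfolding e by (simp add: vec_eq_iff)
  have "(Ee :: 'n::{finite,linorder} sqmat) *v ax (ith (2 * q + 1)) = 0" "Ee *v ax (ith b) = ax (ith (2 * q))"
    using q b by (simp_all add: Ee_def wedge_axis_mult ith_eq_iff)
  then have "bracket Ee Ef = wedge (ax (ith (2 * q + 1))) (ax (ith (2 * q)))"
    unfolding Ef_def bracket_wedge[OF so(1)] by (simp add: wedge_linear)
  also have "\<dots> = - tor q" unfolding tor_def by (rule wedge_swap)
  finally have "D Ee *v (D Ef *v v) = D Ef *v (D Ee *v v) - D (tor q) *v v"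
    using D_commutator[OF so, of v] by (simp add: D_uminus tor_in_so matrix_vector_mult_uminus)
  moreover have "D (tor q) *v v = (\<i> * of_real (lam (q + 1))) *s v"
    using v q by (simp add: weight_space_iff)
  ultimately have com: "D Ee *v (D Ef *v v) = D Ef *v (D Ee *v v) - (\<i> * of_real (lam (q + 1))) *s v" by simp
  have "D Ee *v (D Ee *v v) = - (\<i> *s (D Ee *v (D Ef *v v)))"
    using arg_cong[OF e, of "(*v) (D Ee)"] by (simp only: linear_neg[OF linear_D_apply] matrix_vector_mult_scale)
  moreover have "D Ef *v (D Ef *v v) = \<i> *s (D Ef *v (D Ee *v v))"
    using arg_cong[OF f, of "(*v) (D Ef)"] by (simp only: matrix_vector_mult_scale)
  ultimately show ?thesis
    unfolding com scaleR_eq_of_real_scale by (simp add: vec_eq_iff algebra_simps)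
qed

text \<open>The scalar is found on a highest weight vector: a torus generator contributes the square
  of its coordinate, and each position after the block contributes the coordinate once more.\<close>

lemma casimir:
  assumes v: "v \<in> V"
  shows "(\<Sum>X\<in>std_basis_so. D X *v (D X *v v)) = - wt_inner CARD('n) lam (\<lambda>k. lam k + 2 * rho
      CARD('n) k) *\<^sub>R v"
proof -
  let ?n = "CARD('n)" and ?m = "CARD('n) div 2"
  obtain c where c: "\<And>v. v \<in> V \<Longrightarrow> (\<Sum>X\<in>std_basis_so. D X *v (D X *v v)) = c *\<^sub>R v"
    using casimir_scalar by blast
  have "weight_space D V lam \<noteq> {0}" using hw by (simp add: highest_weight_on_def)
  moreover have "0 \<in> weight_space D V lam"
    using vec.subspace_0[OF V_subspace] by (simp add: weight_space_def)
  ultimately obtain u where u: "u \<in> weight_space D V lam" "u \<noteq> 0" by blast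
  have "(\<Sum>X\<in>std_basis_so. D X *v (D X *v u)) = (\<Sum>q<?m. - (lam (q + 1) * (lam (q + 1) + 2 * rho ?n
      (q + 1))) *\<^sub>R u)"
    unfolding sum_std_basis_so_blocks
  proof (rule sum.cong[OF refl])
    fix q assume "q \<in> {..<?m}"
    then have q: "q < ?m" by simp
    have t: "D (tor q) *v (D (tor q) *v u) = - (lam (q + 1) * lam (q + 1)) *\<^sub>R u"
    proof -
      have w: "D (tor q) *v u = (\<i> * of_real (lam (q + 1))) *s u" using u(1) q by (simp add: weight_space_iff)
      show ?thesis unfolding w matrix_vector_mult_scale scaleR_eq_of_real_scale
        by (simp add: vec_eq_iff algebra_simps)
    qed
    have "(\<Sum>b\<in>{2 * q + 2..<?n}. D (wedge (ax (ith (2 * q))) (ax (ith b))) *v (D (wedge (ax (ith (2 *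
        q))) (ax (ith b))) *v u)
        + D (wedge (ax (ith (2 * q + 1))) (ax (ith b))) *v (D (wedge (ax (ith (2 * q + 1))) (ax (ith b))) *v u))
        = (\<Sum>b\<in>{2 * q + 2..<?n}. - lam (q + 1) *\<^sub>R u)"
      by (rule sum.cong[OF refl], rule casimir_pair[OF u(1) q]) auto
    also have "\<dots> = - (lam (q + 1) * (2 * rho ?n (q + 1))) *\<^sub>R u"
    proof -
      have "2 * q + 2 \<le> ?n" using q by linarith
      \<comment> \<open>There are n - 2(q + 1) positions after the block, which is exactly twice the
        coordinate n/2 - (q + 1) of \<open>rho\<close>.\<close>
      then have "real (?n - (2 * q + 2)) = 2 * rho ?n (q + 1)"
        using q by (subst rho_eq) (auto simp: of_nat_diff)
      then have "(\<Sum>b\<in>{2 * q + 2..<?n}. - lam (q + 1)) = - (lam (q + 1) * (2 * rho ?n (q + 1)))"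
        by (simp add: mult.commute)
      then show ?thesis by (simp only: scaleR_sum_left[symmetric])
    qed
    finally show "D (tor q) *v (D (tor q) *v u) + (\<Sum>b\<in>{2 * q + 2..<?n}.
        D (wedge (ax (ith (2 * q))) (ax (ith b))) *v (D (wedge (ax (ith (2 * q))) (ax (ith b))) *v u)
        + D (wedge (ax (ith (2 * q + 1))) (ax (ith b))) *v (D (wedge (ax (ith (2 * q + 1))) (ax (ith b))) *v u))
       = - (lam (q + 1) * (lam (q + 1) + 2 * rho ?n (q + 1))) *\<^sub>R u"
      unfolding t by (simp only: scaleR_add_left[symmetric] distrib_left minus_add_distrib)
  qed
  also have "\<dots> = (\<Sum>q<?m. - (lam (q + 1) * (lam (q + 1) + 2 * rho ?n (q + 1)))) *\<^sub>R u"
    by (rule scaleR_sum_left[symmetric])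
  also have "(\<Sum>q<?m. - (lam (q + 1) * (lam (q + 1) + 2 * rho ?n (q + 1)))) = - wt_inner ?n lam
      (\<lambda>k. lam k + 2 * rho ?n k)"
    unfolding wt_inner_def sum_negf
    by (rule arg_cong[where f = uminus], rule sum.reindex_bij_witness[of _ "\<lambda>j. j - 1" "\<lambda>q. q +
        1"]) auto
  finally have "c *\<^sub>R u = - wt_inner ?n lam (\<lambda>k. lam k + 2 * rho ?n k) *\<^sub>R u"
    using c[of u] u(1) by (simp add: weight_space_iff)
  then have "c = - wt_inner ?n lam (\<lambda>k. lam k + 2 * rho ?n k)" using u(2) by (simp only:
      scaleR_cancel_right) simp
  then show ?thesis using c[OF v] by simp
qed

end

section \<open>The groups SO(n) and Spin(n)\<close>

lemma rot_group_SO: "rot_group SO_grp (\<lambda>X :: 'n::{finite,linorder} sqmat. X) mat_endo endo_mat endo_mat"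
proof (rule rot_group.intro)
  fix X Y g h A :: "'n::{finite,linorder} sqmat"
  show "linear (\<lambda>X :: 'n::{finite,linorder} sqmat. X)" by (rule linear_ident)
  show "bounded_linear (mat_endo :: 'n::{finite,linorder} sqmat \<Rightarrow> _)" by (rule bounded_linear_mat_endo)
  show "bounded_linear (endo_mat :: _ \<Rightarrow> 'n::{finite,linorder} sqmat)" by (rule bounded_linear_endo_mat)
  then show "bounded_linear (endo_mat :: _ \<Rightarrow> 'n::{finite,linorder} sqmat)" .
  show "endo_mat (mat_endo X) = X" by simp
  show "endo_mat (mat_endo X) = X" by simp
  show "mat_endo (X \<otimes>\<^bsub>SO_grp\<^esub> Y) = mat_endo X * mat_endo Y" by (simp add: SO_grp_def
      mat_endo_mult)
  show "mat_endo (\<one>\<^bsub>SO_grp\<^esub> :: 'n::{finite,linorder} sqmat) = 1" by (simp add: SO_grp_def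
      mat_endo_one)
  show "\<one>\<^bsub>SO_grp\<^esub> \<in> carrier (SO_grp :: ('n::{finite,linorder} sqmat) monoid)"
    by (simp add: SO_grp_def orthogonal_matrix_id)
  show "g \<otimes>\<^bsub>SO_grp\<^esub> h \<in> carrier SO_grp" if "g \<in> carrier SO_grp" "h \<in> carrier SO_grp"
    using that by (simp add: SO_grp_def orthogonal_matrix_mul det_mul)
  show "\<exists>h\<in>carrier SO_grp. g \<otimes>\<^bsub>SO_grp\<^esub> h = \<one>\<^bsub>SO_grp\<^esub>
      \<and> h \<otimes>\<^bsub>SO_grp\<^esub> g = \<one>\<^bsub>SO_grp\<^esub>" if "g \<in> carrier SO_grp"
    using that by (intro bexI[of _ "transpose g"]) (auto simp: SO_grp_def orthogonal_matrix_transpose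
        orthogonal_matrix_transpose_mult)
  show "mat_endo X * mat_endo Y - mat_endo Y * mat_endo X = mat_endo (bracket X Y)"
    by (simp add: bracket_def linear_diff[OF linear_mat_endo] mat_endo_mult)
  show "\<exists>g\<in>carrier SO_grp. mat_endo g = exp (mat_endo X)" if "X \<in> so_alg"
    using exp_so_in_SO[OF that] by (intro bexI[of _ "endo_mat (exp (mat_endo X))"]) (auto simp: SO_grp_def)
  have conj: "mat_endo B * mat_endo X = mat_endo (B ** X ** transpose B) * mat_endo B" if "orthogonal_matrix B" for B X
    using orthogonal_matrix_transpose_mult(1)[OF that] by (simp flip: mat_endo_mult matrix_mul_assoc)
  show "\<exists>A. orthogonal_matrix A \<and> (\<forall>X\<in>so_alg. mat_endo g * mat_endo X = mat_endo (A **
      X ** transpose A) * mat_endo g)"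
    if "g \<in> carrier SO_grp"
    using that conj[of g] by (auto simp: SO_grp_def)
  show "\<exists>g\<in>carrier SO_grp. \<forall>X\<in>so_alg. mat_endo g * mat_endo X = mat_endo (A ** X **
      transpose A) * mat_endo g"
    if "orthogonal_matrix A" "det A = 1"
    using that conj[of A] by (auto simp: SO_grp_def)
qed

section \<open>The Clifford algebra and its left regular representation\<close>

lemma linear_eq_axis:
  fixes f g :: "real^'i \<Rightarrow> 'b::real_vector"
  assumes f: "linear f" and g: "linear g" and eq: "\<And>A. f (axis A 1) = g (axis A 1)"
  shows "f x = g x"
proof -
  have x: "x = (\<Sum>A\<in>UNIV. x $ A *\<^sub>R axis A 1)"
    using basis_expansion[of x] by (simp add: scalar_mult_eq_scaleR)
  show ?thesis
    by (subst (1 2) x) (simp only: linear_sum[OF f] linear_sum[OF g] linear_scale[OF f] linear_scale[OF g] eq)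
qed

lemma linear_cl_left: "linear (\<lambda>x. cl_mult x y)" and linear_cl_right: "linear (cl_mult x)"
  using bilinear_cl_mult unfolding bilinear_def by auto

text \<open>On basis elements both sides carry the same sign because the sign is multiplicative
  under symmetric difference in either argument; linearity extends this in z, then y, then
  x.\<close>

lemma cl_mult_assoc:
  fixes x y z :: "real^(('n::{finite,linorder}) set)"
  shows "cl_mult (cl_mult x y) z = cl_mult x (cl_mult y z)"
proof -
  have sd: "sym_diff (sym_diff A B) C = sym_diff A (sym_diff B C)" for A B C :: "'n set" by blast
  have 1: "cl_mult (cl_mult (axis A 1) (axis B 1)) (axis C 1) = cl_mult (axis A 1) (cl_mult (axis B 1) (axis C
      1))" for A B C :: "'n set"
    unfolding cl_mult_axis linear_scale[OF linear_cl_left] linear_scale[OF linear_cl_right] cl_sign_sym_diff sd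
    by (simp add: ac_simps)
  have 2: "cl_mult (cl_mult (axis A 1) (axis B 1)) z = cl_mult (axis A 1) (cl_mult (axis B 1) z)" for A B ::
      "'n set" and z
    by (rule linear_eq_axis[of "\<lambda>z. cl_mult (cl_mult (axis A 1) (axis B 1)) z" "\<lambda>z. cl_mult
        (axis A 1) (cl_mult (axis B 1) z)"])
      (simp_all add: 1 linear_cl_right linear_compose[OF linear_cl_right linear_cl_right, unfolded o_def])
  have 3: "cl_mult (cl_mult (axis A 1) y) z = cl_mult (axis A 1) (cl_mult y z)" for A :: "'n set" and y z
    by (rule linear_eq_axis[of "\<lambda>y. cl_mult (cl_mult (axis A 1) y) z" "\<lambda>y. cl_mult (axis A 1)
        (cl_mult y z)"])
      (simp_all add: 2 linear_compose[OF linear_cl_right linear_cl_left, unfolded o_def]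
        linear_compose[OF linear_cl_left linear_cl_right, unfolded o_def])
  show ?thesis
    by (rule linear_eq_axis[of "\<lambda>x. cl_mult (cl_mult x y) z" "\<lambda>x. cl_mult x (cl_mult y z)"])
      (simp_all add: 3 linear_cl_left linear_compose[OF linear_cl_left linear_cl_left, unfolded o_def])
qed

lemma cl_mult_one:
  fixes x :: "real^(('n::{finite,linorder}) set)"
  shows "cl_mult cl_one x = x" "cl_mult x cl_one = x"
proof -
  have "cl_mult cl_one (axis A 1) = axis A 1" "cl_mult (axis A 1) cl_one = axis A 1" for A :: "'n set"
    unfolding cl_one_def cl_mult_axis by simp_all
  then show "cl_mult cl_one x = x" "cl_mult x cl_one = x"
    using linear_eq_axis[OF linear_cl_right linear_ident, of cl_one x] linear_eq_axis[OF linear_cl_left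
        linear_ident, of cl_one x] by auto
qed

lemma linear_cl_vec: "linear cl_vec"
  by (rule linearI) (simp_all add: cl_vec_def sum.distrib scaleR_sum_right algebra_simps)

lemma cl_vec_component: "cl_vec v $ {i} = v $ i"
proof -
  have "cl_vec v $ {i} = (\<Sum>j\<in>UNIV. if j = i then v $ j else 0)"
    unfolding cl_vec_def sum_component by (rule sum.cong) (auto simp: axis_def)
  then show ?thesis by simp
qed

lemma cl_vec_anticommute:
  fixes u v :: "real^('n::{finite,linorder})"
  shows "cl_mult (cl_vec u) (cl_vec v) + cl_mult (cl_vec v) (cl_vec u) = (- 2 * (u \<bullet> v)) *\<^sub>R cl_one"
proof -
  have 1: "cl_mult (cl_vec (axis i 1)) (cl_vec (axis j 1)) + cl_mult (cl_vec (axis j 1)) (cl_vec (axis i 1)) =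
    (- 2 * (axis i 1 \<bullet> (axis j 1 :: real^('n::{finite,linorder})))) *\<^sub>R cl_one" for i j :: 'n
  proof -
    have sd: "sym_diff {j} {i} = sym_diff {i} {j}" by blast
    have "cl_mult (cl_vec (axis i 1)) (cl_vec (axis j 1)) + cl_mult (cl_vec (axis j 1)) (cl_vec (axis i 1)) =
      ((if j \<le> i then - 1 else 1) + (if i \<le> j then - 1 else 1)) *\<^sub>R axis (sym_diff {i} {j}) (1 :: real)"
      unfolding cl_vec_axis cl_mult_axis cl_sign_single sd scaleR_add_left ..
    also have "\<dots> = (- 2 * (axis i 1 \<bullet> (axis j 1 :: real^('n::{finite,linorder})))) *\<^sub>R cl_one"
    proof (cases "i = j")
      case True
      then have "sym_diff {i} {j} = {}" by blast
      then show ?thesis using True by (simp only: cl_one_def inner_axis_axis) simp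
    next
      case False
      then have "(if j \<le> i then - 1 else 1) + (if i \<le> j then - 1 else 1) = (0 :: real)" by auto
      then show ?thesis using False by (simp only: inner_axis_axis) simp
    qed
    finally show ?thesis .
  qed
  have lin: "linear (\<lambda>v. cl_mult (cl_vec u) (cl_vec v) + cl_mult (cl_vec v) (cl_vec u))"
    "linear (\<lambda>v. cl_mult (cl_vec v) (cl_vec u) + cl_mult (cl_vec u) (cl_vec v))" for u ::
        "real^('n::{finite,linorder})"
    by (intro linear_compose_add linear_compose[OF linear_cl_vec linear_cl_right, unfolded o_def]
      linear_compose[OF linear_cl_vec linear_cl_left, unfolded o_def])+
  have lin': "linear (\<lambda>v. (- 2 * (u \<bullet> v)) *\<^sub>R cl_one)" "linear (\<lambda>v. (- 2 * (v
      \<bullet> u)) *\<^sub>R cl_one)" for u :: "real^('n::{finite,linorder})"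
    by (auto intro!: linearI simp: inner_simps algebra_simps)
  have 2: "cl_mult (cl_vec (axis i 1)) (cl_vec v) + cl_mult (cl_vec v) (cl_vec (axis i 1)) =
    (- 2 * (axis i 1 \<bullet> v)) *\<^sub>R cl_one" for i :: 'n and v
    by (rule linear_eq_axis[OF lin(1) lin'(1)]) (rule 1)
  show ?thesis by (rule linear_eq_axis[OF lin(2) lin'(2)]) (rule 2)
qed

text \<open>The left regular representation. It is faithful since evaluation at
  \<open>cl_one\<close> recovers x; the same evaluation is the left inverse \<open>M\<close> for the
  spin group.\<close>

definition cl_left :: "real^(('n::{finite,linorder}) set) \<Rightarrow> (real^('n set)) endo" where
  "cl_left x = endo_of (cl_mult x)"

lemma endo_apply_cl_left [simp]: "endo_apply (cl_left x) y = cl_mult x y"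
  by (simp add: cl_left_def linear_cl_right)

lemma cl_left_mult: "cl_left (cl_mult x y) = cl_left x * cl_left y"
  by (rule endo_eqI) (simp add: cl_mult_assoc)

lemma cl_left_one: "cl_left cl_one = 1"
  by (rule endo_eqI) (simp add: cl_mult_one)

lemma linear_cl_embed: "linear cl_left"
  by (rule linearI; rule endo_eqI) (simp_all add: linear_add[OF linear_cl_left] linear_scale[OF linear_cl_left])

lemma cl_left_inject: "cl_left x = cl_left y \<longleftrightarrow> x = y"
  by (metis cl_mult_one(2) endo_apply_cl_left)

abbreviation cE :: "real^('n::{finite,linorder}) \<Rightarrow> (real^('n set)) endo" where
  "cE v \<equiv> cl_left (cl_vec v)"

lemma linear_cE: "linear cE"
  using linear_compose[OF linear_cl_vec linear_cl_embed] by (simp add: o_def)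

lemma cE_anticommute: "cE u * cE v + cE v * cE u = (- 2 * (u \<bullet> v)) *\<^sub>R 1"
  using arg_cong[OF cl_vec_anticommute, of cl_left u v]
  by (simp only: linear_add[OF linear_cl_embed] linear_scale[OF linear_cl_embed] cl_left_mult cl_left_one)

lemma cE_square: "cE v * cE v = - (v \<bullet> v) *\<^sub>R 1"
proof -
  have "2 *\<^sub>R (cE v * cE v) = 2 *\<^sub>R (- (v \<bullet> v) *\<^sub>R 1)"
    using cE_anticommute[of v v] by (simp add: scaleR_2[symmetric])
  then show ?thesis by (simp only: scaleR_cancel_left) simp
qed

lemma cE_unit_square: "norm v = 1 \<Longrightarrow> cE v * cE v = - 1"
  by (simp add: cE_square norm_eq_1)

section \<open>Reflections and the adjoint action of the spin group\<close>

definition mirror :: "'a::real_inner \<Rightarrow> 'a \<Rightarrow> 'a" where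
  "mirror v u = u - (2 * (u \<bullet> v)) *\<^sub>R v"

lemma linear_mirror: "linear (mirror v)"
  by (rule linearI) (simp_all add: mirror_def inner_simps algebra_simps)

lemma orthogonal_mirror: "norm v = 1 \<Longrightarrow> orthogonal_transformation (mirror v)"
  unfolding orthogonal_transformation_def
  by (auto simp: linear_mirror) (simp add: mirror_def inner_simps norm_eq_1 inner_commute algebra_simps)

lemma mirror_mirror: "norm v = 1 \<Longrightarrow> mirror v (mirror v u) = u"
  by (simp add: mirror_def inner_simps norm_eq_1)

text \<open>A single unit vector realises a reflection only up to sign. The signs cancel in pairs,
  in accordance with the even words of \<open>spin_set\<close>.\<close>

lemma cE_mirror:
  assumes "norm v = 1"
  shows "cE v * cE u = - (cE (mirror v u) * cE v)"
proof -
  have "cE (mirror v u) * cE v = cE u * cE v - (2 * (u \<bullet> v)) *\<^sub>R (cE v * cE v)"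
    by (simp add: mirror_def linear_diff[OF linear_cE] linear_scale[OF linear_cE] algebra_simps)
  also have "\<dots> = - (cE v * cE u)"
    using cE_anticommute[of u v] by (simp add: cE_unit_square[OF assms] algebra_simps eq_neg_iff_add_eq_0)
  finally show ?thesis by simp
qed

lemma cE_mirror_mirror:
  assumes n: "norm v = 1" "norm w = 1" and g: "g * cE u = cE u' * g"
  shows "cE v * (cE w * g) * cE u = cE (mirror v (mirror w u')) * (cE v * (cE w * g))"
proof -
  have "cE v * (cE w * g) * cE u = cE v * (cE w * cE u') * g"
    by (simp add: mult.assoc g)
  also have "\<dots> = - (cE v * cE (mirror w u') * (cE w * g))"
    by (simp add: cE_mirror[OF n(2)] mult.assoc)
  also have "\<dots> = cE (mirror v (mirror w u')) * (cE v * (cE w * g))"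
    by (simp add: cE_mirror[OF n(1)] mult.assoc)
  finally show ?thesis .
qed

lemma spin_mult_closed: "x \<in> spin_set \<Longrightarrow> y \<in> spin_set \<Longrightarrow> cl_mult x y
    \<in> spin_set"
  by (induction x rule: spin_set.induct) (auto simp: cl_mult_one cl_mult_assoc intro: spin_set.intros)

lemma spin_pair: "norm v = 1 \<Longrightarrow> norm w = 1 \<Longrightarrow> \<exists>y\<in>spin_set. cl_left y
    = cE v * cE w"
  using spin_set.step[OF _ _ spin_set.one, of v w]
  by (intro bexI[of _ "cl_mult (cl_vec v) (cl_vec w)"]) (simp_all add: cl_mult_one cl_left_mult)

lemma spin_inverse:
  fixes x :: "real^(('n::{finite,linorder}) set)"
  shows "x \<in> spin_set \<Longrightarrow> \<exists>h\<in>spin_set. cl_left x * cl_left h = 1 \<and> cl_left h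
      * cl_left x = 1"
proof (induction x rule: spin_set.induct)
  case one
  show ?case by (intro bexI[of _ cl_one]) (auto simp: cl_left_one spin_set.one)
next
  case (step v w x)
  then obtain h where h: "h \<in> spin_set" "cl_left x * cl_left h = 1" "cl_left h * cl_left x = 1" by blast
  \<comment> \<open>The product of v and w is inverted by the product in reverse order: both vectors
    square to -1 and the two signs cancel.\<close>
  obtain y where y: "y \<in> spin_set" "cl_left y = cE w * cE v" using spin_pair step by blast
  have assoc: "a * b = c \<Longrightarrow> a * (b * z) = c * z" for a b c z :: "(real^('n set)) endo"
    by (simp add: mult.assoc[symmetric])
  have vv: "cE v * (cE v * z) = - z" and ww: "cE w * (cE w * z) = - z"
    and xh: "cl_left x * (cl_left h * z) = z" and hx: "cl_left h * (cl_left x * z) = z" for z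
    using assoc[OF cE_unit_square[OF step(1)], of z] assoc[OF cE_unit_square[OF step(2)], of z]
      assoc[OF h(2), of z] assoc[OF h(3), of z] by simp_all
  show ?case
    by (intro bexI[of _ "cl_mult h y"] spin_mult_closed h y)
      (simp add: cl_left_mult y mult.assoc xh hx vv ww cE_unit_square step(1,2) h)
qed

lemma spin_Ad_vec:
  "x \<in> spin_set \<Longrightarrow> \<exists>f. orthogonal_transformation f \<and> (\<forall>u. cl_left x *
      cE u = cE (f u) * cl_left x)"
proof (induction x rule: spin_set.induct)
  case one
  show ?case by (intro exI[of _ id]) (simp add: cl_left_one orthogonal_transformation_id)
next
  case (step v w x)
  then obtain f where f: "orthogonal_transformation f" "\<And>u. cl_left x * cE u = cE (f u) * cl_left x" by blast
  have "orthogonal_transformation (mirror v \<circ> (mirror w \<circ> f))"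
    using f(1) orthogonal_mirror step(1,2) by (intro orthogonal_transformation_compose)
  then have "orthogonal_transformation (\<lambda>u. mirror v (mirror w (f u)))" by (simp only: o_def)
  moreover have "cE v * (cE w * cl_left x) * cE u = cE (mirror v (mirror w (f u))) * (cE v * (cE w * cl_left x))" for u
    by (rule cE_mirror_mirror[OF step(1,2) f(2)])
  ultimately show ?case
    unfolding cl_left_mult by blast
qed

text \<open>Induction on a set containing all axis vectors that f may move; each reflection puts one
  more of them back in place.\<close>

lemma cartan_dieudonne:
  fixes f :: "real^'n \<Rightarrow> real^'n"
  assumes "orthogonal_transformation f"
  obtains vs where "\<And>v. v \<in> set vs \<Longrightarrow> norm v = 1" "f = foldr (\<lambda>v g. mirror v
      \<circ> g) vs id"
proof -
  have "\<exists>vs. (\<forall>v\<in>set vs. norm v = 1) \<and> f = foldr (\<lambda>v g. mirror v \<circ> g) vs id"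
    if "finite S" "orthogonal_transformation f" "\<And>i. i \<notin> S \<Longrightarrow> f (axis i 1) = axis i 1"
    for S and f :: "real^'n \<Rightarrow> real^'n"
    using that
  proof (induction S arbitrary: f rule: finite_induct)
    case empty
    have "f x = id x" for x
      by (rule linear_eq_axis[of f id]) (use empty in \<open>auto simp: orthogonal_transformation_def linear_id\<close>)
    then show ?case by (intro exI[of _ "[]"]) auto
  next
    case (insert j S)
    define w where "w = f (axis j 1)"
    show ?case
    proof (cases "w = axis j 1")
      case True
      then have "f (axis i 1) = axis i 1" if "i \<notin> S" for i
        using insert.prems(2)[of i] that by (cases "i = j") (simp_all add: w_def)
      then show ?thesis using insert.prems(1) by (intro insert.IH)
    next
      case False
      \<comment> \<open>Since w and the axis vector have the same length, the reflection along their
        difference interchanges them. Axis vectors already fixed by f are orthogonal to both and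
        stay fixed.\<close>
      define v where "v = (1 / norm (w - axis j 1)) *\<^sub>R (w - axis j 1)"
      have nv: "norm v = 1" using False by (simp add: v_def)
      have fi: "f x \<bullet> f y = x \<bullet> y" for x y using insert.prems(1) by (simp add:
          orthogonal_transformation_def)
      have ww: "w \<bullet> w = 1" unfolding w_def fi by (simp add: inner_axis_axis)
      define d where "d = (w - axis j 1) \<bullet> (w - axis j 1)"
      have d: "d \<noteq> 0" "norm (w - axis j 1) * norm (w - axis j 1) = d"
        using False by (auto simp: d_def power2_norm_eq_inner[symmetric] power2_eq_square)
      have wd: "2 * (w \<bullet> (w - axis j 1)) = d"
        using ww by (simp add: d_def inner_simps inner_axis_axis inner_commute)
      have "mirror v w = w - (2 * (w \<bullet> (w - axis j 1)) / d) *\<^sub>R (w - axis j 1)"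
        unfolding mirror_def v_def by (simp add: d(2)[symmetric])
      also have "\<dots> = axis j 1" unfolding wd using d(1) by simp
      finally have rw: "mirror v w = axis j 1" .
      have "orthogonal_transformation (mirror v \<circ> f)"
        by (intro orthogonal_transformation_compose orthogonal_mirror nv insert.prems)
      moreover have "(mirror v \<circ> f) (axis i 1) = axis i 1" if "i \<notin> S" for i
      proof (cases "i = j")
        case True
        then show ?thesis using rw by (simp add: w_def)
      next
        case False
        then have "f (axis i 1) = axis i 1" using insert.prems(2) that by simp
        moreover have "axis i 1 \<bullet> w = 0" using fi[of "axis i 1" "axis j 1"] False calculation
          by (simp add: w_def inner_axis_axis)
        ultimately show ?thesis using False by (simp add: mirror_def v_def inner_simps inner_axis_axis)
      qed
      ultimately obtain vs where vs: "\<forall>v\<in>set vs. norm v = 1" "mirror v \<circ> f = foldr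
          (\<lambda>v g. mirror v \<circ> g) vs id"
        using insert.IH[of "mirror v \<circ> f"] by blast
      have "f = mirror v \<circ> (mirror v \<circ> f)" by (auto simp: mirror_mirror[OF nv])
      then have "f = foldr (\<lambda>v g. mirror v \<circ> g) (v # vs) id" using vs(2) by simp
      moreover have "\<forall>x\<in>set (v # vs). norm x = 1" using vs(1) nv by simp
      ultimately show ?thesis by blast
    qed
  qed
  from this[of UNIV f] assms that show ?thesis by auto
qed

text \<open>An orthogonal change of frame taking an axis vector to v makes the reflection diagonal
  with a single entry -1.\<close>

lemma det_mirror:
  assumes "norm (v :: real^'n) = 1"
  shows "det (matrix (mirror v)) = - 1"
proof -
  fix k :: 'n
  obtain U where U: "orthogonal_matrix U" "U *v axis k 1 = v"
    using orthogonal_matrix_exists_basis[OF assms] by blast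
  define d :: "real^'n^'n" where "d = (\<chi> i j. if i = j then (if i = k then -1 else 1) else 0)"
  have inner: "(U *v x) \<bullet> (U *v y) = x \<bullet> y" for x y
    using U(1) orthogonal_transformation_matrix[of "(*v) U"] by (simp add: orthogonal_transformation_def)
  have "matrix (mirror v) ** U = U ** d"
  proof -
    have "(matrix (mirror v) ** U) *v x = (U ** d) *v x" for x
    proof -
      have "d *v x = x - (2 * x $ k) *\<^sub>R axis k 1"
      proof -
        have "(\<Sum>j\<in>UNIV. (if i = j then (if i = k then -1 else 1) else 0) * x $ j) = (if i = k then - x
            $ i else x $ i)" for i
        proof -
          have "(\<Sum>j\<in>UNIV. (if i = j then (if i = k then -1 else 1) else 0) * x $ j) =
            (\<Sum>j\<in>UNIV. if j = i then (if i = k then - x $ i else x $ i) else 0)"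
            by (rule sum.cong) auto
          then show ?thesis by simp
        qed
        then show ?thesis by (simp add: d_def matrix_vector_mult_def vec_eq_iff axis_def)
      qed
      moreover have "x \<bullet> axis k 1 = x $ k" by (simp add: inner_axis)
      ultimately show ?thesis
        using inner[of x "axis k 1"]
        by (simp add: matrix_works linear_mirror mirror_def U(2) matrix_vector_mul_assoc[symmetric]
          matrix_vector_mult_diff_distrib linear_scale[OF linear_matrix_vector_real])
    qed
    then show ?thesis by (simp add: matrix_eq)
  qed
  then have "det (matrix (mirror v)) * det U = det U * det d" by (metis det_mul)
  moreover have "det U \<noteq> 0" using det_orthogonal_matrix[OF U(1)] by auto
  moreover have "det d = -1"
  proof -
    have "det d = (\<Prod>i\<in>UNIV. d $ i $ i)" by (rule det_diagonal) (simp add: d_def)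
    also have "\<dots> = (\<Prod>i\<in>UNIV. if i = k then -1 else 1)" by (simp add: d_def)
    finally show ?thesis by simp
  qed
  ultimately have "det (matrix (mirror v)) * det U = - 1 * det U" by simp
  then show ?thesis using \<open>det U \<noteq> 0\<close> mult_right_cancel by blast
qed

section \<open>Quadratic Clifford elements: Lie algebra and exponentials of the spin group\<close>

lemma sum4_swap:
  "(\<Sum>i\<in>A. \<Sum>j\<in>B. \<Sum>k\<in>C. \<Sum>l\<in>E. F i j k l) = (\<Sum>k\<in>C. \<Sum>l\<in>E.
      \<Sum>i\<in>A. \<Sum>j\<in>B. F i j k l)"
  for F :: "_ \<Rightarrow> _ \<Rightarrow> _ \<Rightarrow> _ \<Rightarrow> 'b::comm_monoid_add"
proof -
  have "(\<Sum>i\<in>A. \<Sum>j\<in>B. \<Sum>k\<in>C. \<Sum>l\<in>E. F i j k l) = (\<Sum>i\<in>A.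
      \<Sum>k\<in>C. \<Sum>j\<in>B. \<Sum>l\<in>E. F i j k l)"
    by (rule sum.cong[OF refl], rule sum.swap)
  also have "\<dots> = (\<Sum>k\<in>C. \<Sum>i\<in>A. \<Sum>j\<in>B. \<Sum>l\<in>E. F i j k l)" by (rule sum.swap)
  also have "\<dots> = (\<Sum>k\<in>C. \<Sum>i\<in>A. \<Sum>l\<in>E. \<Sum>j\<in>B. F i j k l)"
    by (rule sum.cong[OF refl], rule sum.cong[OF refl], rule sum.swap)
  also have "\<dots> = (\<Sum>k\<in>C. \<Sum>l\<in>E. \<Sum>i\<in>A. \<Sum>j\<in>B. F i j k l)"
    by (rule sum.cong[OF refl], rule sum.swap)
  finally show ?thesis .
qed

text \<open>Four times the operator of \<open>spin_of_so\<close>, with the same transposed index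
  order. It is used for arbitrary matrices because the single terms of a bracket are not
  skew.\<close>

definition cl_quad :: "'n::{finite,linorder} sqmat \<Rightarrow> (real^('n set)) endo" where
  "cl_quad B = (\<Sum>i\<in>UNIV. \<Sum>j\<in>UNIV. B $ j $ i *\<^sub>R (cE (axis i 1) * cE (axis j 1)))"

lemma linear_cl_quad: "linear cl_quad"
  by (rule linearI) (simp_all add: cl_quad_def sum.distrib scaleR_sum_right algebra_simps)

lemma cl_left_spin_of_so: "cl_left (spin_of_so X) = (1/4) *\<^sub>R cl_quad X"
  by (simp add: spin_of_so_def cl_quad_def linear_scale[OF linear_cl_embed] linear_sum[OF linear_cl_embed] cl_left_mult)

lemma cE_matrix: "cE (M *v axis i 1) = (\<Sum>k\<in>UNIV. M $ k $ i *\<^sub>R cE (axis k 1))"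
proof -
  have "M *v axis i 1 = (\<Sum>k\<in>UNIV. M $ k $ i *\<^sub>R axis k 1)"
    using basis_expansion[of "M *v axis i 1"] by (simp add: scalar_mult_eq_scaleR matrix_vector_mult_axis)
  then show ?thesis by (simp add: linear_sum[OF linear_cE] linear_scale[OF linear_cE])
qed

text \<open>The two factors get separate matrices, so that the adjoint action (M = N) and each term
  of the product rule (one of them the identity) are instances.\<close>

lemma cl_quad_transform:
  "(\<Sum>i\<in>UNIV. \<Sum>j\<in>UNIV. B $ j $ i *\<^sub>R (cE (M *v axis i 1) * cE (N *v axis j 1))) =
      cl_quad (N ** B ** transpose M)"
proof -
  have "(\<Sum>i\<in>UNIV. \<Sum>j\<in>UNIV. B $ j $ i *\<^sub>R (cE (M *v axis i 1) * cE (N *v axis j 1))) =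
    (\<Sum>i\<in>UNIV. \<Sum>j\<in>UNIV. \<Sum>k\<in>UNIV. \<Sum>l\<in>UNIV. (N $ l $ j * B $ j $ i * M $ k $
        i) *\<^sub>R (cE (axis k 1) * cE (axis l 1)))"
    unfolding cE_matrix sum_product scaleR_sum_right
    by (intro sum.cong refl) (simp add: ac_simps)
  also have "\<dots> = (\<Sum>k\<in>UNIV. \<Sum>l\<in>UNIV. \<Sum>i\<in>UNIV. \<Sum>j\<in>UNIV. (N $ l $ j * B
      $ j $ i * M $ k $ i) *\<^sub>R (cE (axis k 1) * cE (axis l 1)))"
    by (rule sum4_swap)
  also have "\<dots> = cl_quad (N ** B ** transpose M)"
    unfolding cl_quad_def
    by (intro sum.cong refl)
      (simp add: matrix_matrix_mult_def transpose_def scaleR_sum_left sum_distrib_right)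
  finally show ?thesis .
qed

lemma spin_Ad:
  assumes f: "orthogonal_transformation f" "\<And>u. g * cE u = cE (f u) * g"
  shows "g * cl_left (spin_of_so X) = cl_left (spin_of_so (matrix f ** X ** transpose (matrix f))) * g"
proof -
  have m: "f u = matrix f *v u" for u using f(1) by (simp add: matrix_works orthogonal_transformation_linear)
  have "g * (cE u * cE v) = cE (matrix f *v u) * cE (matrix f *v v) * g" for u v
    unfolding m[symmetric] by (simp add: mult.assoc[symmetric] f(2)) (simp add: mult.assoc f(2))
  then have "g * cl_quad X = cl_quad (matrix f ** X ** transpose (matrix f)) * g"
    unfolding cl_quad_transform[symmetric] by (simp add: cl_quad_def sum_distrib_left sum_distrib_right)
  then show ?thesis by (simp add: cl_left_spin_of_so)
qed

text \<open>The commutator with \<open>spin_of_so X\<close> is a derivation that acts on vectors as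
  X; the product rule on quadratic elements gives \<open>Y ** transpose X + X ** Y\<close>, which is
  the bracket by skewness.\<close>

lemma spin_bracket:
  assumes X: "X \<in> so_alg"
  shows "cl_left (spin_of_so X) * cl_left (spin_of_so Y) - cl_left (spin_of_so Y) * cl_left (spin_of_so X) =
    cl_left (spin_of_so (bracket X Y))"
proof -
  let ?x = "cl_left (spin_of_so X)"
  have c: "?x * cE v = cE v * ?x + cE (X *v v)" for v
    using arg_cong[OF spin_of_so_commutator[OF X, of v], of cl_left]
    by (simp add: linear_diff[OF linear_cl_embed] cl_left_mult algebra_simps)
  have cc: "?x * (cE u * cE v) - (cE u * cE v) * ?x = cE (X *v u) * cE v + cE u * cE (X *v v)" for u v
  proof -
    have "?x * (cE u * cE v) = (cE u * ?x + cE (X *v u)) * cE v"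
      by (simp add: mult.assoc[symmetric] c)
    also have "\<dots> = cE u * (cE v * ?x + cE (X *v v)) + cE (X *v u) * cE v"
      by (simp add: distrib_right mult.assoc c)
    finally show ?thesis by (simp add: algebra_simps)
  qed
  have "?x * cl_quad Y - cl_quad Y * ?x = (\<Sum>i\<in>UNIV. \<Sum>j\<in>UNIV. Y $ j $ i *\<^sub>R
      (?x * (cE (axis i 1) * cE (axis j 1)) - (cE (axis i 1) * cE (axis j 1)) * ?x))"
    unfolding cl_quad_def sum_distrib_left sum_distrib_right sum_subtractf[symmetric]
    by (intro sum.cong refl) (simp add: scaleR_diff_right)
  also have "\<dots> = (\<Sum>i\<in>UNIV. \<Sum>j\<in>UNIV. Y $ j $ i *\<^sub>R (cE (X *v axis i 1) * cE (mat 1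
      *v axis j 1)))
     + (\<Sum>i\<in>UNIV. \<Sum>j\<in>UNIV. Y $ j $ i *\<^sub>R (cE (mat 1 *v axis i 1) * cE (X *v axis j 1)))"
    unfolding cc by (simp add: sum.distrib scaleR_add_right)
  also have "\<dots> = cl_quad (Y ** transpose X + X ** Y)"
    unfolding cl_quad_transform by (simp add: linear_add[OF linear_cl_quad])
  also have "Y ** transpose X + X ** Y = bracket X Y"
    by (simp add: so_alg_transpose[OF X] matrix_mult_minus_right bracket_def)
  finally have q: "?x * cl_quad Y - cl_quad Y * ?x = cl_quad (bracket X Y)" .
  have "?x * cl_left (spin_of_so Y) - cl_left (spin_of_so Y) * ?x = (1/4) *\<^sub>R (?x * cl_quad Y - cl_quad Y * ?x)"
    unfolding cl_left_spin_of_so[of Y] by (simp add: scaleR_diff_right)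
  then show ?thesis unfolding q by (simp only: cl_left_spin_of_so)
qed

lemma cl_quad_wedge_axis:
  "cl_quad (wedge (ax e) (ax f)) = cE (ax f) * cE (ax e) - cE (ax e) * cE (ax f)"
proof -
  have "cl_quad (wedge (ax e) (ax f)) =
    (\<Sum>i\<in>UNIV. \<Sum>j\<in>UNIV. (if i = f then if j = e then cE (axis i 1) * cE (axis j 1) else 0 else 0) -
      (if i = e then if j = f then cE (axis i 1) * cE (axis j 1) else 0 else 0))"
    unfolding cl_quad_def wedge_axis_component by (intro sum.cong refl) (simp split: if_splits)
  also have "\<dots> = cE (ax f) * cE (ax e) - cE (ax e) * cE (ax f)"
    by (simp add: sum_subtractf sum_delta2)
  finally show ?thesis .
qed

text \<open>The exponential is a rotation by half the angle and factors into two unit vectors: with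
  F F = -1 for F = \<open>cE (ax f)\<close>, the element cos + sin F E equals F (- cos F + sin
  E).\<close>

lemma spin_exp_wedge_axis:
  assumes ef: "e \<noteq> f"
  shows "\<exists>g\<in>spin_set. cl_left g = exp (t *\<^sub>R cl_left (spin_of_so (wedge (ax e) (ax f))))"
proof -
  let ?J = "cE (ax f) * cE (ax e)"
  have "cE (ax e) * cE (ax f) = - ?J"
    using cE_anticommute[of "ax e" "ax f"] ef by (simp add: inner_axis_axis eq_neg_iff_add_eq_0)
  then have "cl_quad (wedge (ax e) (ax f)) = 2 *\<^sub>R ?J" by (simp add: cl_quad_wedge_axis scaleR_2)
  then have w: "t *\<^sub>R cl_left (spin_of_so (wedge (ax e) (ax f))) = (t / 2) *\<^sub>R ?J"
    by (simp add: cl_left_spin_of_so)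
  have sq: "cE (ax e) * cE (ax e) = - 1" "cE (ax f) * cE (ax f) = - 1"
    by (simp_all add: cE_unit_square norm_axis_1)
  have "?J * ?J = cE (ax f) * (cE (ax e) * cE (ax f)) * cE (ax e)" by (simp add: mult.assoc)
  also have "\<dots> = - (cE (ax f) * (cE (ax f) * cE (ax e)) * cE (ax e))"
    by (simp add: \<open>cE (ax e) * cE (ax f) = - ?J\<close>)
  also have "\<dots> = - ((cE (ax f) * cE (ax f)) * (cE (ax e) * cE (ax e)))" by (simp only: mult.assoc)
  finally have "?J * ?J = - 1" by (simp add: sq)
  then have "exp ((t / 2) *\<^sub>R ?J) = cos (t / 2) *\<^sub>R 1 + sin (t / 2) *\<^sub>R ?J"
    by (rule exp_scaleR_of_square_minus_one)
  also have "\<dots> = cE (ax f) * cE ((- cos (t / 2)) *\<^sub>R ax f + sin (t / 2) *\<^sub>R ax e)"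
    unfolding linear_add[OF linear_cE] linear_scale[OF linear_cE] by (simp add: algebra_simps sq)
  finally have e: "exp (t *\<^sub>R cl_left (spin_of_so (wedge (ax e) (ax f)))) =
      cE (ax f) * cE ((- cos (t / 2)) *\<^sub>R ax f + sin (t / 2) *\<^sub>R ax e)" unfolding w .
  have "norm ((- cos (t / 2)) *\<^sub>R ax f + sin (t / 2) *\<^sub>R ax e) = 1"
    unfolding norm_eq_1 using ef
    by (simp add: inner_simps inner_axis_axis) (metis sin_cos_squared_add3 add.commute)
  then show ?thesis unfolding e by (intro spin_pair) (simp_all add: norm_axis_1)
qed

text \<open>The torus generators commute, so the exponential splits into the planar ones
  above.\<close>

lemma spin_exp_cartan: "\<exists>g\<in>spin_set. cl_left g = exp (cl_left (spin_of_so (cartan \<theta>)))"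
proof -
  let ?m = "CARD('a) div 2"
  define Z where "Z k = (\<Sum>q<k. \<theta> (q + 1) *\<^sub>R tor q :: 'a::{finite,linorder} sqmat)" for k
  have Zso: "Z k \<in> so_alg" for k
    unfolding Z_def by (intro subspace_sum subspace_scale subspace_so_alg tor_in_so)
  have lin: "linear (\<lambda>X. cl_left (spin_of_so X))"
    unfolding cl_left_spin_of_so by (rule linear_compose_scale_right[OF linear_cl_quad])
  have "\<exists>g\<in>spin_set. cl_left g = exp (cl_left (spin_of_so (Z k)))" if "k \<le> ?m" for k
    using that
  proof (induction k)
    case 0
    show ?case by (intro bexI[of _ cl_one]) (auto simp: Z_def linear_0[OF lin] cl_left_one spin_set.one)
  next
    case (Suc k)
    then obtain g where g: "g \<in> spin_set" "cl_left g = exp (cl_left (spin_of_so (Z k)))" by auto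
    have k: "k < ?m" using Suc.prems by simp
    have "(ith (2 * k) :: 'a) \<noteq> ith (2 * k + 1)" using k by (simp add: ith_eq_iff)
    then obtain h where h: "h \<in> spin_set" "cl_left h = exp (\<theta> (k + 1) *\<^sub>R cl_left (spin_of_so
        (tor k :: 'a::{finite,linorder} sqmat)))"
      unfolding tor_def using spin_exp_wedge_axis by blast
    have "bracket (tor k) (Z k) = 0"
      using k by (simp add: Z_def linear_sum[OF linear_bracket_right] linear_scale[OF linear_bracket_right]
          bracket_tor_tor)
    then have com: "cl_left (spin_of_so (tor k)) * cl_left (spin_of_so (Z k)) = cl_left (spin_of_so (Z k)) *
        cl_left (spin_of_so (tor k))"
      using spin_bracket[OF tor_in_so, of k "Z k"] by (simp add: linear_0[OF lin])
    have "cl_left (spin_of_so (Z (Suc k))) = cl_left (spin_of_so (Z k)) + \<theta> (k + 1) *\<^sub>R cl_left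
        (spin_of_so (tor k))"
      by (simp add: Z_def linear_add[OF lin] linear_scale[OF lin])
    then have "exp (cl_left (spin_of_so (Z (Suc k)))) = cl_left (cl_mult g h)"
      using com by (simp add: cl_left_mult g h exp_add_commuting)
    then show ?case using spin_mult_closed[OF g(1) h(1)] by metis
  qed
  from this[of ?m] show ?thesis by (simp add: Z_def cartan_eq_sum)
qed

text \<open>Surjectivity of the covering. Determinant 1 makes the number of reflections in a
  factorisation even, and each consecutive pair lifts to a pair of unit vectors.\<close>

lemma spin_Ad_surj:
  assumes A: "orthogonal_matrix A" "det A = 1"
  shows "\<exists>g\<in>spin_set. \<forall>X. cl_left g * cl_left (spin_of_so X) = cl_left (spin_of_so (A ** X
      ** transpose A)) * cl_left g"
proof -
  let ?F = "\<lambda>vs. foldr (\<lambda>v g. mirror v \<circ> g) vs id :: real^('a::{finite,linorder}) \<Rightarrow> _"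
  have oA: "orthogonal_transformation ((*v) A)" using A(1) by (simp add: orthogonal_transformation_matrix)
  obtain vs where vs: "\<And>v. v \<in> set vs \<Longrightarrow> norm v = 1" "(*v) A = ?F vs"
    using cartan_dieudonne[OF oA] by blast
  have oid: "orthogonal_transformation (id :: real^('a::{finite,linorder}) \<Rightarrow> _)"
    by (simp add: orthogonal_transformation_def linear_id)
  have orth: "orthogonal_transformation (?F us)" if "\<And>v. v \<in> set us \<Longrightarrow> norm v = 1" for us
    using that by (induction us) (auto simp: oid orthogonal_mirror intro!: orthogonal_transformation_compose)
  have det: "det (matrix (?F us)) = (- 1) ^ length us" if "\<And>v. v \<in> set us \<Longrightarrow> norm v = 1" for us
    using that
  proof (induction us)
    case (Cons v us)
    have "matrix (mirror v \<circ> ?F us) = matrix (mirror v) ** matrix (?F us)"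
      by (rule matrix_compose) (use Cons.prems orth[of us] in \<open>auto simp: linear_mirror
          orthogonal_transformation_linear\<close>)
    moreover have "?F (v # us) = mirror v \<circ> ?F us" by simp
    moreover have "det (matrix (?F us)) = (- 1) ^ length us"
      by (rule Cons.IH) (use Cons.prems in auto)
    moreover have "det (matrix (mirror v)) = - 1" using Cons.prems by (simp add: det_mirror)
    ultimately show ?case by (simp only: det_mul) simp
  qed (simp add: matrix_id_mat_1 id_def[symmetric])
  have "(- 1 :: real) ^ length vs = 1"
  proof -
    have "det (matrix (?F vs)) = (- 1) ^ length vs" by (rule det) (rule vs(1))
    then show ?thesis using A(2) unfolding vs(2)[symmetric] by simp
  qed
  then have "even (length vs)" by (metis neg_one_odd_power one_neq_neg_one)
  have "\<exists>g\<in>spin_set. \<forall>u. cl_left g * cE u = cE (?F us u) * cl_left g" if "even (length us)"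
      "\<And>v. v \<in> set us \<Longrightarrow> norm v = 1" for us
    using that
  proof (induction us rule: induct_list012)
    case 1
    show ?case by (intro bexI[of _ cl_one]) (auto simp: cl_left_one spin_set.one)
  next
    case (3 v w us)
    have "even (length us)" "\<And>x. x \<in> set us \<Longrightarrow> norm x = 1" using "3.prems" by auto
    from "3.IH"(1)[OF this] obtain g where g: "g \<in> spin_set" "\<And>u. cl_left g * cE u = cE (?F us u) * cl_left g"
      by blast
    have n: "norm v = 1" "norm w = 1" using 3 by auto
    show ?case
    proof (intro bexI[of _ "cl_mult (cl_vec v) (cl_mult (cl_vec w) g)"] allI spin_set.step n g)
      fix u
      show "cl_left (cl_mult (cl_vec v) (cl_mult (cl_vec w) g)) * cE u =
          cE (?F (v # w # us) u) * cl_left (cl_mult (cl_vec v) (cl_mult (cl_vec w) g))"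
        using cE_mirror_mirror[OF n g(2)] by (simp add: cl_left_mult)
    qed
  qed auto
  from this[OF \<open>even (length vs)\<close> vs(1)] obtain g where g: "g \<in> spin_set" "\<And>u. cl_left g
      * cE u = cE (A *v u) * cl_left g"
    unfolding vs(2)[symmetric] by blast
  have "matrix ((*v) A) = A" by simp
  then show ?thesis using spin_Ad[OF oA, of "cl_left g"] g by metis
qed

text \<open>The last map recovers X from \<open>spin_of_so X\<close> by taking commutators with the
  axis vectors and reading their vector components.\<close>

lemma rot_group_Spin:
  "rot_group Spin_grp (spin_of_so :: 'n::{finite,linorder} sqmat \<Rightarrow> _) cl_left
    (\<lambda>f. endo_apply f cl_one)
    (\<lambda>f. \<chi> i j. (cl_mult (endo_apply f cl_one) (axis {j} 1) - cl_mult (axis {j} 1) (endo_apply f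
        cl_one)) $ {i})"
proof (rule rot_group.intro)
  fix X Y A :: "'n::{finite,linorder} sqmat" and x y g h :: "real^('n set)"
  have inj: "spin_of_so X = endo_apply (cl_left (spin_of_so X)) cl_one" for X :: "'n::{finite,linorder} sqmat"
    by (simp add: cl_mult_one)
  have bl1: "bounded_linear (\<lambda>f. endo_apply f cl_one :: real^('n set))" by (rule bounded_linear_endo_apply)
  show "linear (spin_of_so :: 'n::{finite,linorder} sqmat \<Rightarrow> _)"
    by (rule linearI) (simp_all add: spin_of_so_def sum.distrib scaleR_sum_right algebra_simps)
  show "bounded_linear (cl_left :: real^('n set) \<Rightarrow> _)"
    using linear_cl_embed by (simp add: linear_conv_bounded_linear)
  show "bounded_linear (\<lambda>f. endo_apply f cl_one :: real^('n set))" by (rule bl1)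
  show "bounded_linear (\<lambda>f. \<chi> i j. (cl_mult (endo_apply f cl_one) (axis {j} 1) - cl_mult (axis {j}
      1) (endo_apply f cl_one)) $ {i} :: 'n::{finite,linorder} sqmat)"
  proof (intro bounded_linear_vec_lambda bounded_linear_compose[OF bounded_linear_vec_nth] bounded_linear_sub)
    fix j :: 'n
    show "bounded_linear (\<lambda>f. cl_mult (endo_apply f cl_one) (axis {j} 1))"
      using bounded_linear_compose[OF linear_cl_left[unfolded linear_conv_bounded_linear] bl1] .
    show "bounded_linear (\<lambda>f. cl_mult (axis {j} 1) (endo_apply f cl_one))"
      using bounded_linear_compose[OF linear_cl_right[unfolded linear_conv_bounded_linear] bl1] .
  qed
  show "endo_apply (cl_left x) cl_one = x" by (simp add: cl_mult_one)
  show "(\<chi> i j. (cl_mult (endo_apply (cl_left (spin_of_so X)) cl_one) (axis {j} 1)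
      - cl_mult (axis {j} 1) (endo_apply (cl_left (spin_of_so X)) cl_one)) $ {i}) = X" if "X \<in> so_alg"
    using spin_of_so_commutator[OF that, of "axis _ 1"]
    by (simp add: vec_eq_iff cl_mult_one cl_vec_axis[symmetric] cl_vec_component matrix_vector_mult_axis del:
        vector_minus_component)
  show "cl_left (x \<otimes>\<^bsub>Spin_grp\<^esub> y) = cl_left x * cl_left y" by (simp add: Spin_grp_def
      cl_left_mult)
  show "cl_left (\<one>\<^bsub>Spin_grp\<^esub> :: real^('n set)) = 1" by (simp add: Spin_grp_def cl_left_one)
  show "\<one>\<^bsub>Spin_grp\<^esub> \<in> carrier (Spin_grp :: (real^('n set)) monoid)" by (simp add:
      Spin_grp_def spin_set.one)
  show "g \<otimes>\<^bsub>Spin_grp\<^esub> h \<in> carrier Spin_grp" if "g \<in> carrier Spin_grp" "h \<in>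
      carrier Spin_grp"
    using that by (simp add: Spin_grp_def spin_mult_closed)
  show "\<exists>h\<in>carrier Spin_grp. g \<otimes>\<^bsub>Spin_grp\<^esub> h = \<one>\<^bsub>Spin_grp\<^esub>
      \<and> h \<otimes>\<^bsub>Spin_grp\<^esub> g = \<one>\<^bsub>Spin_grp\<^esub>" if "g \<in> carrier Spin_grp"
    using spin_inverse[of g] that by (simp add: Spin_grp_def cl_left_mult[symmetric] cl_left_one[symmetric]
        cl_left_inject)
  show "cl_left (spin_of_so X) * cl_left (spin_of_so Y) - cl_left (spin_of_so Y) * cl_left (spin_of_so X) =
      cl_left (spin_of_so (bracket X Y))" if "X \<in> so_alg"
    using that by (rule spin_bracket)
  show "\<exists>g\<in>carrier Spin_grp. cl_left g = exp (cl_left (spin_of_so X))" if X: "X \<in> so_alg"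
  proof -
    \<comment> \<open>Membership in \<open>spin_set\<close> calls for an explicit word. The
      exponential of a Cartan element has one, and a lift of B conjugates it into the exponential of
      X.\<close>
    obtain B \<theta> where B: "orthogonal_matrix B" "det B = 1" "X = B ** cartan \<theta> ** transpose B"
      using so_normal_form[OF X] by blast
    obtain g where g: "g \<in> spin_set" "cl_left g * cl_left (spin_of_so (cartan \<theta>)) = cl_left
        (spin_of_so X) * cl_left g"
      using spin_Ad_surj[OF B(1,2)] B(3) by blast
    obtain h where h: "h \<in> spin_set" "cl_left g * cl_left h = 1" using spin_inverse[OF g(1)] by blast
    obtain k where k: "k \<in> spin_set" "cl_left k = exp (cl_left (spin_of_so (cartan \<theta> ::
        'n::{finite,linorder} sqmat)))"
      using spin_exp_cartan by blast
    have "cl_left (cl_mult (cl_mult g k) h) = exp (cl_left (spin_of_so X))"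
      using exp_intertwine[OF g(2)] by (simp add: cl_left_mult k h mult.assoc)
    then show ?thesis using spin_mult_closed[OF spin_mult_closed[OF g(1) k(1)] h(1)]
      by (auto simp: Spin_grp_def)
  qed
  show "\<exists>A. orthogonal_matrix A \<and> (\<forall>X\<in>so_alg. cl_left g * cl_left (spin_of_so X) =
      cl_left (spin_of_so (A ** X ** transpose A)) * cl_left g)"
    if "g \<in> carrier Spin_grp"
  proof -
    have "g \<in> spin_set" using that by (simp add: Spin_grp_def)
    then obtain f where f: "orthogonal_transformation f" "\<And>u. cl_left g * cE u = cE (f u) * cl_left g"
      using spin_Ad_vec[of g] by blast
    then show ?thesis using spin_Ad[OF f] f(1) by (intro exI[of _ "matrix f"]) (auto simp:
        orthogonal_transformation_matrix)
  qed
  show "\<exists>g\<in>carrier Spin_grp. \<forall>X\<in>so_alg. cl_left g * cl_left (spin_of_so X) = cl_left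
      (spin_of_so (A ** X ** transpose A)) * cl_left g"
    if "orthogonal_matrix A" "det A = 1"
    using spin_Ad_surj[OF that] by (auto simp: Spin_grp_def)
qed

section \<open>The curvature term\<close>

lemma curvature_term_apply:
  fixes D :: "real^'n^'n \<Rightarrow> 'f::real_normed_field^'k^'k"
  shows "curvature_term B R D *v v = - (\<Sum>X\<in>B. D (R X) *v (D X *v v))"
proof -
  have "(\<Sum>X\<in>S. D (R X) ** D X) *v v = (\<Sum>X\<in>S. D (R X) *v (D X *v v))" for S
    by (induction S rule: infinite_finite_induct) (simp_all add: matrix_vector_mult_add_rdistrib
        matrix_vector_mul_assoc)
  then show ?thesis by (simp add: curvature_term_def matrix_vector_mult_uminus)
qed

text \<open>\<open>A\<close> enters through its action on vectors only, so that the real scalar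
  matrix and the complex one with entries \<open>of_real\<close> both fit.\<close>

lemma curvature_operator_bound:
  fixes R :: "real^'n^'n \<Rightarrow> real^'n^'n" and D :: "real^'n^'n \<Rightarrow>
      'f::{real_normed_field,euclidean_space}^'k^'k"
  assumes sk: "skew_action (\<lambda>X v. D X *v v)"
    and R: "curvature_operator R" and B: "orthonormal_basis_so B"
    and cas: "\<And>v. (\<Sum>X\<in>B. D X *v (D X *v v)) = - q *\<^sub>R v"
    and bound: "\<And>X v. X \<in> so_alg \<Longrightarrow> so_inner X X = 1 \<Longrightarrow> (norm (D X *v
        v))\<^sup>2 \<le> \<Lambda> * (norm v)\<^sup>2"
    and A: "\<And>v. A *v v = curvature_term B R D *v v - (\<Lambda> * eig_sum (q / \<Lambda>) R) *\<^sub>R v"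
  shows "0 \<le> v \<bullet> (A *v v)" and "(A *v v) \<bullet> w = v \<bullet> (A *v w)"
  using skew_action.curvature_form_lower_bound[OF sk R B cas bound, of v]
    skew_action.curvature_form_symmetric[OF sk R B, of v w]
  by (simp_all add: A curvature_term_apply inner_simps)

text \<open>\<open>adjoint_mat\<close> is also the adjoint for the real part of the hermitian
  product, so symmetry may be tested with the real inner product.\<close>

lemma psd_complexI:
  assumes "\<And>v w. (A *v v) \<bullet> w = v \<bullet> (A *v w)" "\<And>v. 0 \<le> v \<bullet> (A *v v)"
  shows "psd_complex A"
proof -
  have "adjoint_mat A *v w = A *v w" for w
  proof -
    have "v \<bullet> (adjoint_mat A *v w - A *v w) = 0" for v
      using assms(1)[of v w] by (simp add: inner_adjoint inner_diff_right)
    from this[of "adjoint_mat A *v w - A *v w"] show ?thesis by simp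
  qed
  then have "adjoint_mat A = A" by (simp add: matrix_eq)
  moreover have "Re (\<Sum>i\<in>UNIV. cnj (v $ i) * (A *v v) $ i) = v \<bullet> (A *v v)" for v
    by (simp add: inner_vec_def inner_complex_def)
  ultimately show ?thesis using assms(2) by (simp add: psd_complex_def)
qed

lemma psd_realI:
  assumes "\<And>v w. (A *v v) \<bullet> w = v \<bullet> (A *v w)" "\<And>v. 0 \<le> v \<bullet> (A *v v)"
  shows "psd_real A"
proof -
  have "transpose A *v w = A *v w" for w
  proof -
    have "v \<bullet> (transpose A *v w - A *v w) = 0" for v
      using assms(1)[of v w] dot_lmul_matrix[of w A v]
      by (simp add: transpose_matrix_vector inner_diff_right inner_commute)
    from this[of "transpose A *v w - A *v w"] show ?thesis by simp
  qed
  then have "transpose A = A" by (simp add: matrix_eq)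
  then show ?thesis using assms(2) by (simp add: psd_real_def)
qed

text \<open>Multiplicativity makes the image of the unit idempotent, and an idempotent with a left
  inverse is the identity.\<close>

lemma (in rot_group) hom_one:
  assumes mult: "\<And>g h. g \<in> carrier G \<Longrightarrow> h \<in> carrier G \<Longrightarrow> \<pi> (g
      \<otimes>\<^bsub>G\<^esub> h) = \<pi> g ** \<pi> h"
    and inv: "Q ** \<pi> \<one>\<^bsub>G\<^esub> = mat 1"
  shows "\<pi> \<one>\<^bsub>G\<^esub> = mat 1"
proof -
  have "\<one>\<^bsub>G\<^esub> \<otimes>\<^bsub>G\<^esub> \<one>\<^bsub>G\<^esub> = \<one>\<^bsub>G\<^esub>"
      by (rule L_inject) (simp add: L_mult L_one)
  then have "(Q ** \<pi> \<one>\<^bsub>G\<^esub>) ** \<pi> \<one>\<^bsub>G\<^esub> = Q ** \<pi> \<one>\<^bsub>G\<^esub>"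
    using mult[OF one_mem one_mem] by (metis matrix_mul_assoc)
  then show ?thesis by (simp add: inv)
qed

section \<open>The unitary case\<close>

lemma (in rot_group) unitary_bound:
  assumes \<pi>: "unitary_rep G \<pi>" and irr: "irreducible_on G \<pi> UNIV" and hw: "highest_weight_on G
      \<iota> \<pi> UNIV lam"
    and R: "curvature_operator R" and B: "orthonormal_basis_so B"
  shows "psd_complex (curvature_term B R (drep G \<iota> \<pi>)
    - mat (of_real (wt_inner CARD('n) lam lam * eig_sum (casimir_ratio CARD('n) lam) R)))"
proof -
  have U: "\<pi> g \<in> carrier U_grp" if "g \<in> carrier G" for g
    using \<pi> that by (auto simp: unitary_rep_def hom_def)
  have mult: "\<pi> (g \<otimes>\<^bsub>G\<^esub> h) = \<pi> g ** \<pi> h" if "g \<in> carrier G" "h \<in>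
      carrier G" for g h
    using \<pi> that by (auto simp: unitary_rep_def hom_def U_grp_def)
  have un: "adjoint_mat (\<pi> g) ** \<pi> g = mat 1" if "g \<in> carrier G" for g
    using U[OF that] by (simp add: U_grp_def)
  have one: "\<pi> \<one>\<^bsub>G\<^esub> = mat 1" by (rule hom_one[OF mult un[OF one_mem]])
  interpret hw_rep G \<iota> L M \<sigma> \<pi> UNIV lam
    by unfold_locales (use mult one un irr hw \<pi> in \<open>auto simp: unitary_rep_def\<close>)
  have sk: "skew_action (\<lambda>X v. D X *v v)" by (rule skew_actionI) (rule D_skew)
  have cas: "(\<Sum>X\<in>B. D X *v (D X *v v)) = - wt_inner CARD('n) lam (\<lambda>k. lam k + 2 * rho CARD('n)
      k) *\<^sub>R v" for v
    using casimir[OF UNIV_I, of v] skew_action.sum_squares_basis_invariant[OF sk B orthonormal_std_basis_so] by simp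
  have A: "(curvature_term B R D - mat (of_real c)) *v v = curvature_term B R D *v v - c *\<^sub>R v" for c v
    by (simp add: matrix_vector_mult_diff_rdistrib scaleR_eq_of_real_scale)
      (simp add: vec_eq_iff matrix_vector_mult_def mat_def if_distrib[of "\<lambda>x. x * _"] cong: if_cong)
  have bound: "(norm (D X *v v))\<^sup>2 \<le> wt_inner CARD('n) lam lam * (norm v)\<^sup>2"
    if "X \<in> so_alg" "so_inner X X = 1" for X v
    using drep_norm_bound[OF that(1) UNIV_I, of v] that(2) by simp
  show ?thesis
    unfolding casimir_ratio_def
    by (rule psd_complexI; rule curvature_operator_bound[OF sk R B cas bound A])
qed

text \<open>\<open>|T\<^sup>jx|\<close> is log-convex in \<open>j\<close>, so its growth rate bounds the first step.\<close>

lemma skew_iterate_bound: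
  fixes T :: "'e::real_inner \<Rightarrow> 'e"
  assumes skew: "\<And>x y. T x \<bullet> y = - (x \<bullet> T y)" and "\<Lambda> \<ge> 0"
    and bound: "\<And>j. (norm ((T ^^ j) x))\<^sup>2 \<le> \<Lambda> ^ j * C"
  shows "(norm (T x))\<^sup>2 \<le> \<Lambda> * (norm x)\<^sup>2"
proof (rule ccontr)
  define b where "b j = (norm ((T ^^ j) x))\<^sup>2" for j
  assume "\<not> ?thesis"
  then have less: "\<Lambda> * b 0 < b 1" by (simp add: b_def)
  have b0: "b 0 > 0"
  proof (rule ccontr)
    assume "\<not> b 0 > 0"
    then have "x = 0" by (simp add: b_def)
    moreover have "T 0 \<bullet> T 0 = 0" using skew[of 0 "T 0"] by simp
    ultimately show False using less by (simp add: b_def)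
  qed
  \<comment> \<open>The growth factor of the first step. Log-convexity makes the later factors at
    least as large.\<close>
  define q where "q = b 1 / b 0"
  have q: "q > \<Lambda>" using less b0 by (simp add: q_def field_simps)
  then have q0: "q > 0" using \<open>\<Lambda> \<ge> 0\<close> by simp
  have logconvex: "(b (Suc j))\<^sup>2 \<le> b j * b (Suc (Suc j))" for j
  proof -
    \<comment> \<open>Skewness moves one T to the other side, so Cauchy-Schwarz applies to the
      neighbouring iterates.\<close>
    have "b (Suc j) = - ((T ^^ j) x \<bullet> (T ^^ Suc (Suc j)) x)"
      by (simp add: b_def power2_norm_eq_inner skew)
    then have "\<bar>b (Suc j)\<bar> \<le> norm ((T ^^ j) x) * norm ((T ^^ Suc (Suc j)) x)"
      using Cauchy_Schwarz_ineq2 by (metis abs_minus_cancel)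
    then have "\<bar>b (Suc j)\<bar>\<^sup>2 \<le> (norm ((T ^^ j) x) * norm ((T ^^ Suc (Suc j)) x))\<^sup>2"
      by (intro power_mono) auto
    then show ?thesis by (simp add: b_def power_mult_distrib)
  qed
  have step: "b j > 0 \<and> q * b j \<le> b (Suc j)" for j
  proof (induction j)
    case 0
    show ?case using b0 by (simp add: q_def)
  next
    case (Suc j)
    then have pos: "b j > 0" and le: "q * b j \<le> b (Suc j)" by auto
    then have pos': "b (Suc j) > 0" using q0 by (meson less_le_trans mult_pos_pos)
    have "q * b j * b (Suc j) \<le> b (Suc j) * b (Suc j)" using le pos' by (intro mult_right_mono) auto
    also have "\<dots> \<le> b j * b (Suc (Suc j))" using logconvex[of j] by (simp add: power2_eq_square)
    finally have "b j * (q * b (Suc j)) \<le> b j * b (Suc (Suc j))" by (simp add: ac_simps)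
    then show ?case using pos pos' by simp
  qed
  have grow: "q ^ j * b 0 \<le> b j" for j
  proof (induction j)
    case (Suc j)
    have "q ^ Suc j * b 0 = q * (q ^ j * b 0)" by simp
    also have "\<dots> \<le> q * b j" using Suc q0 by (intro mult_left_mono) auto
    also have "\<dots> \<le> b (Suc j)" using step by blast
    finally show ?case .
  qed simp
  show False
  \<comment> \<open>If \<Lambda> = 0 the first iterate already contradicts the growth; otherwise the
    ratio of q and \<Lambda> exceeds 1 and its powers outgrow every constant.\<close>
  proof (cases "\<Lambda> = 0")
    case True
    then have "b 1 \<le> 0" using bound[of 1] by (simp add: b_def)
    moreover have "q * b 0 \<le> b 1" using grow[of 1] by simp
    ultimately show False using mult_pos_pos[OF q0 b0] by linarith
  next
    case False
    then have \<Lambda>: "\<Lambda> > 0" using \<open>\<Lambda> \<ge> 0\<close> by simp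
    obtain j where j: "C / b 0 < (q / \<Lambda>) ^ j" using real_arch_pow[of "q / \<Lambda>" "C / b 0"] q
        \<Lambda> by auto
    have "q ^ j * b 0 \<le> \<Lambda> ^ j * C" using grow[of j] bound[of j] by (simp add: b_def)
    then have "(q / \<Lambda>) ^ j \<le> C / b 0" using \<Lambda> b0 by (simp add: power_divide field_simps)
    then show False using j by simp
  qed
qed

section \<open>The orthogonal case: complexification and real parts\<close>

abbreviation cmat :: "real^'k^'k \<Rightarrow> complex^'k^'k" where "cmat \<equiv> map_matrix complex_of_real"

definition cvec :: "real^'k \<Rightarrow> complex^'k" where "cvec x = (\<chi> i. of_real (x $ i))"
definition rvec :: "complex^'k \<Rightarrow> real^'k" where "rvec v = (\<chi> i. Re (v $ i))"

lemma cmat_mult: "cmat (A ** B) = cmat A ** cmat B"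
  by (simp add: vec_eq_iff map_matrix_def matrix_matrix_mult_def)

lemma cmat_one: "cmat (mat 1) = mat 1"
  by (simp add: vec_eq_iff map_matrix_def mat_def)

lemma adjoint_cmat: "adjoint_mat (cmat A) = cmat (transpose A)"
  by (simp add: vec_eq_iff map_matrix_def adjoint_mat_def transpose_def)

lemma cmat_cvec: "cmat A *v cvec x = cvec (A *v x)"
  by (simp add: vec_eq_iff map_matrix_def matrix_vector_mult_def cvec_def)

lemma rvec_cmat: "rvec (cmat A *v v) = A *v rvec v"
  by (simp add: vec_eq_iff map_matrix_def matrix_vector_mult_def rvec_def)

lemma inner_cvec: "cvec x \<bullet> cvec y = x \<bullet> y"
  by (simp add: inner_vec_def cvec_def inner_complex_def)

lemma linear_rvec: "linear rvec"
  by (rule linearI) (simp_all add: vec_eq_iff rvec_def)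

lemma norm_rvec_le: "norm (rvec v) \<le> norm v"
  unfolding norm_vec_def rvec_def by (intro L2_set_mono) (simp_all add: abs_Re_le_cmod)

lemma bounded_linear_cmat: "bounded_linear cmat"
proof -
  have "linear cmat" by (rule linearI) (simp_all add: vec_eq_iff map_matrix_def, simp_all add: scaleR_conv_of_real)
  then show ?thesis by (simp add: linear_conv_bounded_linear)
qed

text \<open>Either form of \<open>real_highest_weight\<close> provides an irreducible complex
  constituent V with highest weight \<open>lam\<close>. Real parts of V form a nonzero invariant
  real subspace, hence everything, so each real x is the real part of some v in V and the relations
  satisfied by v can be read off for x.\<close>

lemma (in rot_group) orthogonal_bound:
  assumes \<pi>: "orthogonal_rep G \<pi>" and irr: "irreducible_on G \<pi> UNIV" and hw: "real_highest_weight G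
      \<iota> \<pi> lam"
    and R: "curvature_operator R" and B: "orthonormal_basis_so B"
  shows "psd_real (curvature_term B R (drep G \<iota> \<pi>)
    - mat (wt_inner CARD('n) lam lam * eig_sum (casimir_ratio CARD('n) lam) R))"
proof -
  let ?c = "complexified_rep \<pi>"
  obtain V where V: "irreducible_on G ?c V" "highest_weight_on G \<iota> ?c V lam"
    using hw unfolding real_highest_weight_def by blast
  have U: "orthogonal_matrix (\<pi> g)" if "g \<in> carrier G" for g
    using \<pi> that by (auto simp: orthogonal_rep_def hom_def O_grp_def)
  have mult: "\<pi> (g \<otimes>\<^bsub>G\<^esub> h) = \<pi> g ** \<pi> h" if "g \<in> carrier G" "h \<in>
      carrier G" for g h
    using \<pi> that by (auto simp: orthogonal_rep_def hom_def O_grp_def)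
  have one: "\<pi> \<one>\<^bsub>G\<^esub> = mat 1" by (rule hom_one[OF mult
      orthogonal_matrix_transpose_mult(1)[OF U[OF one_mem]]])
  have cont: "continuous_on (carrier G) \<pi>" using \<pi> by (simp add: orthogonal_rep_def)
  interpret r: rot_rep G \<iota> L M \<sigma> \<pi>
    by unfold_locales (use mult one cont in auto)
  have c: "?c g = cmat (\<pi> g)" for g by (simp add: complexified_rep_def)
  have ccont: "continuous_on (carrier G) ?c"
    unfolding c using bounded_linear.continuous_on[OF bounded_linear_cmat cont] .
  interpret c: hw_rep G \<iota> L M \<sigma> ?c V lam
    by unfold_locales (use mult one U V ccont in \<open>auto simp: c cmat_mult cmat_one adjoint_cmat
      orthogonal_matrix_transpose_mult simp flip: cmat_mult\<close>)
  let ?D = "drep G \<iota> \<pi>" and ?C = "drep G \<iota> ?c"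
  have DC: "?C X = cmat (?D X)" if "X \<in> so_alg" for X
    unfolding drep_def[of _ _ ?c] c
    by (rule vector_derivative_at, rule bounded_linear.has_vector_derivative[OF bounded_linear_cmat
        r.drep_has_vector_derivative[OF that]])
  have skew: "(?D X *v v) \<bullet> w = - (v \<bullet> (?D X *v w))" if "X \<in> so_alg" for X v w
    using c.D_skew[OF that, of "cvec v" "cvec w"] by (simp add: DC[OF that] cmat_cvec inner_cvec)
  have sk: "skew_action (\<lambda>X v. ?D X *v v)" by (rule r.skew_actionI) (rule skew)
  have "invariant_subspace G \<pi> (rvec ` V)"
    unfolding invariant_subspace_def
  proof (intro conjI ballI)
    have "subspace (rvec ` V)" by (rule linear_subspace_image[OF linear_rvec c.V_real])
    then show "vec.subspace (rvec ` V)" 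
      unfolding vec.subspace_def subspace_def unfolding scalar_mult_eq_scaleR .
    fix g x assume g: "g \<in> carrier G" and "x \<in> rvec ` V"
    then obtain v where v: "v \<in> V" "x = rvec v" by blast
    have "\<pi> g *v x = rvec (?c g *v v)" by (simp add: v c rvec_cmat)
    then show "\<pi> g *v x \<in> rvec ` V" using c.V_inv[OF g v(1)] by blast
  qed
  moreover have "rvec ` V \<noteq> {0}"
  proof
    assume "rvec ` V = {0}"
    then have z: "rvec v = 0" if "v \<in> V" for v using that by blast
    \<comment> \<open>V contains the multiple of v by the imaginary unit as well, whose real part is
      minus the imaginary part of v.\<close>
    have "v = 0" if "v \<in> V" for v
      using z[OF that] z[OF vec.subspace_scale[OF c.V_subspace that, of \<i>]]
      by (simp add: rvec_def vec_eq_iff complex_eq_iff)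
    then show False using c.V_ne vec.subspace_0[OF c.V_subspace] by blast
  qed
  ultimately have "rvec ` V = UNIV" using irr by (auto simp: irreducible_on_def)
  then have surj: "\<exists>v\<in>V. x = rvec v" for x by (metis UNIV_I imageE)
  let ?q = "wt_inner CARD('n) lam (\<lambda>k. lam k + 2 * rho CARD('n) k)" and ?\<Lambda> = "wt_inner CARD('n) lam lam"
  have cas: "(\<Sum>X\<in>B. ?D X *v (?D X *v x)) = - ?q *\<^sub>R x" for x
  proof -
    obtain v where v: "v \<in> V" "x = rvec v" using surj by blast
    have so: "X \<in> so_alg" if "X \<in> std_basis_so" for X :: "'n::{finite,linorder} sqmat"
      using that by (auto simp: std_basis_so_def wedge_in_so)
    have "(\<Sum>X\<in>B. ?D X *v (?D X *v x)) = (\<Sum>X\<in>std_basis_so. ?D X *v (?D X *v x))"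
      by (rule skew_action.sum_squares_basis_invariant[OF sk B orthonormal_std_basis_so])
    also have "\<dots> = (\<Sum>X\<in>std_basis_so. rvec (?C X *v (?C X *v v)))"
      by (rule sum.cong) (simp_all add: v so DC rvec_cmat)
    also have "\<dots> = rvec (\<Sum>X\<in>std_basis_so. ?C X *v (?C X *v v))" by (rule linear_sum[OF
        linear_rvec, symmetric])
    also have "\<dots> = - ?q *\<^sub>R x" unfolding c.casimir[OF v(1)] linear_scale[OF linear_rvec] v(2) ..
    finally show ?thesis .
  qed
  have bound: "(norm (?D X *v x))\<^sup>2 \<le> ?\<Lambda> * (norm x)\<^sup>2" if X: "X \<in> so_alg" "so_inner
      X X = 1" for X x
  proof -
    obtain v where v: "v \<in> V" "x = rvec v" using surj by blast
    have \<Lambda>0: "?\<Lambda> \<ge> 0" by (auto simp: wt_inner_def intro: sum_nonneg)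
    \<comment> \<open>The norm of v may exceed that of x, so one step gives too weak a bound. All
      iterates are followed instead: each costs at most a factor \<Lambda>, while the loss from v to
      x stays in the constant.\<close>
    have it: "(((*v) (?C X)) ^^ j) v \<in> V \<and> (norm ((((*v) (?C X)) ^^ j) v))\<^sup>2 \<le> ?\<Lambda> ^
        j * (norm v)\<^sup>2 \<and>
        (((*v) (?D X)) ^^ j) x = rvec ((((*v) (?C X)) ^^ j) v)" for j
    proof (induction j)
      case (Suc j)
      let ?w = "(((*v) (?C X)) ^^ j) v"
      have w: "?w \<in> V" "(norm ?w)\<^sup>2 \<le> ?\<Lambda> ^ j * (norm v)\<^sup>2" "(((*v) (?D X)) ^^ j) x
          = rvec ?w" using Suc by auto
      have "(norm (?C X *v ?w))\<^sup>2 \<le> ?\<Lambda> * (norm ?w)\<^sup>2" using c.drep_norm_bound[OF X(1)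
          w(1)] X(2) by simp
      also have "\<dots> \<le> ?\<Lambda> * (?\<Lambda> ^ j * (norm v)\<^sup>2)" by (rule mult_left_mono[OF
          w(2) \<Lambda>0])
      finally show ?case using c.D_mem[OF X(1) w(1)] w(3) by (simp add: DC[OF X(1)] rvec_cmat ac_simps)
    qed (simp add: v)
    show ?thesis
    proof (rule skew_iterate_bound[where C = "(norm v)\<^sup>2", OF skew[OF X(1)] \<Lambda>0])
      fix j
      have "(norm ((((*v) (?D X)) ^^ j) x))\<^sup>2 \<le> (norm ((((*v) (?C X)) ^^ j) v))\<^sup>2"
        using it[of j] norm_rvec_le by (auto intro: power_mono)
      then show "(norm ((((*v) (?D X)) ^^ j) x))\<^sup>2 \<le> ?\<Lambda> ^ j * (norm v)\<^sup>2" using it[of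
          j] by linarith
    qed
  qed
  have A: "(curvature_term B R ?D - mat a) *v v = curvature_term B R ?D *v v - a *\<^sub>R v" for a v
    by (simp add: matrix_vector_mult_diff_rdistrib)
      (simp add: vec_eq_iff matrix_vector_mult_def mat_def if_distrib[of "\<lambda>x. x * _"] cong: if_cong)
  show ?thesis
    unfolding casimir_ratio_def
    by (rule psd_realI; rule curvature_operator_bound[OF sk R B cas bound A])
qed

theorem theoremE:
  fixes R :: "real^('n::{finite,linorder})^('n::{finite,linorder}) \<Rightarrow> real^('n::{finite,linorder})^('n::{finite,linorder})"
  assumes "CARD('n) \<ge> 2"
    and "curvature_operator R"
  shows
    "(\<forall>(\<pi> :: real^('n::{finite,linorder})^('n::{finite,linorder}) \<Rightarrow> real^'k^'k) lam B.
        orthogonal_rep SO_grp \<pi> \<and> irreducible_on SO_grp \<pi> UNIV \<and> nontrivial_rep SO_grp \<pi> \<and>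
        real_highest_weight SO_grp (\<lambda>X :: real^('n::{finite,linorder})^('n::{finite,linorder}). X) \<pi> lam \<and> orthonormal_basis_so B \<longrightarrow>
        psd_real (curvature_term B R (drep SO_grp (\<lambda>X :: real^('n::{finite,linorder})^('n::{finite,linorder}). X) \<pi>)
          - mat (wt_inner CARD('n) lam lam * eig_sum (casimir_ratio CARD('n) lam) R))) \<and>
     (\<forall>(\<pi> :: real^('n::{finite,linorder})^('n::{finite,linorder}) \<Rightarrow> complex^'k^'k) lam B.
        unitary_rep SO_grp \<pi> \<and> irreducible_on SO_grp \<pi> UNIV \<and> nontrivial_rep SO_grp \<pi> \<and>
        highest_weight_on SO_grp (\<lambda>X :: real^('n::{finite,linorder})^('n::{finite,linorder}). X) \<pi> UNIV lam \<and> orthonormal_basis_so B \<longrightarrow>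
        psd_complex (curvature_term B R (drep SO_grp (\<lambda>X :: real^('n::{finite,linorder})^('n::{finite,linorder}). X) \<pi>)
          - mat (of_real (wt_inner CARD('n) lam lam * eig_sum (casimir_ratio CARD('n) lam) R)))) \<and>
     (\<forall>(\<pi> :: real^('n set) \<Rightarrow> real^'k^'k) lam B.
        orthogonal_rep Spin_grp \<pi> \<and> irreducible_on Spin_grp \<pi> UNIV \<and> nontrivial_rep Spin_grp \<pi> \<and>
        real_highest_weight Spin_grp spin_of_so \<pi> lam \<and> orthonormal_basis_so B \<longrightarrow>
        psd_real (curvature_term B R (drep Spin_grp spin_of_so \<pi>)
          - mat (wt_inner CARD('n) lam lam * eig_sum (casimir_ratio CARD('n) lam) R))) \<and>
     (\<forall>(\<pi> :: real^('n set) \<Rightarrow> complex^'k^'k) lam B.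
        unitary_rep Spin_grp \<pi> \<and> irreducible_on Spin_grp \<pi> UNIV \<and> nontrivial_rep Spin_grp \<pi> \<and>
        highest_weight_on Spin_grp spin_of_so \<pi> UNIV lam \<and> orthonormal_basis_so B \<longrightarrow>
        psd_complex (curvature_term B R (drep Spin_grp spin_of_so \<pi>)
          - mat (of_real (wt_inner CARD('n) lam lam * eig_sum (casimir_ratio CARD('n) lam) R))))"
  using rot_group.orthogonal_bound[OF rot_group_SO _ _ _ assms(2)]
    rot_group.unitary_bound[OF rot_group_SO _ _ _ assms(2)]
    rot_group.orthogonal_bound[OF rot_group_Spin _ _ _ assms(2)]
    rot_group.unitary_bound[OF rot_group_Spin _ _ _ assms(2)]
  by blast

end
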